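(* Let $\mathcal{E}:\mathrm{L}^2(X,m)\to[0,\infty]$ be a $2$-homogeneous nonlinear Dirichlet form. Then the following hold. 1. The space $D(\mathcal{E})$ is a vector space. The functional $$u\mapsto \|u\|_{\mathcal{E}}^2 := \|u\|_{\mathrm{L}^2(X,m)}^2+\mathcal{E}(u)$$ is the square of a norm on $D(\mathcal{E})$. Moreover, $(D(\mathcal{E}),\|\cdot\|_{\mathcal{E}})$ is a Banach space. 2. The pair $(D(\mathcal{E}),\|\cdot\|_{\mathcal{E}})$ is a Hilbert space if and only if $\mathcal{E}$ is a quadratic Dirichlet form. 3. Lipschitz functions $\phi:\mathbb{R}\to\mathbb{R}$ with $\phi(0)=0$ act on $D(\mathcal{E})$, that is, for every such $\phi$ and every $u\in D(\mathcal{E})$ one has $\phi\circ u\in D(\mathcal{E})$. Moreover, $D(\mathcal{E})\cap\mathrm{L}^\infty(X,m)$ is an algebra (under pointwise multiplication). 4. $(D(\mathcal{E}),\|\cdot\|_{\mathcal{E}})$ is a dual space (i.e. it is the dual of some Banach space).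
   Context: $(X,\mathcal{F},m)$ is a $\sigma$-finite measure space such that $\mathcal{F}$ is in bi-measurable correspondence with the Borel class on $\mathbb{R}$; $\mathrm{L}^2(X,m)$ is the real Hilbert space of square-integrable functions. For $\mathcal{E}:\mathrm{L}^2(X,m)\to[0,\infty]$, $D(\mathcal{E})=\{u:\mathcal{E}(u)\neq\infty\}$. $\mathcal{E}$ is $2$-homogeneous if $\mathcal{E}(\nu u)=\nu^2\mathcal{E}(u)$ for all $\nu\in\mathbb{R}$, $u\in\mathrm{L}^2(X,m)$ (convention $0\cdot\infty=0$). Subdifferential: for $u\in D(\mathcal{E})$, $\partial\mathcal{E}(u)=\{\xi\in\mathrm{L}^2(X,m): \mathcal{E}(z)-\mathcal{E}(u)\ge\int_X\xi\,(z-u)\,dm \ \forall z\in\mathrm{L}^2(X,m)\}$. Nonlinear Dirichlet form: a convex, lower semicontinuous (in $\mathrm{L}^2$) functional $\mathcal{E}:\mathrm{L}^2(X,m)\to[0,\infty]$ with dense domain $D(\mathcal{E})$, whose gradient flow semigroup $(T_t)_{t\ge0}$ on $\mathrm{L}^2(X,m)$, i.e. the unique solution of $\partial_tT_tu\in-\partial\mathcal{E}(T_tu)$ for $t>0$, $T_0u=u$, satisfies: (i) contraction in all $\mathrm{L}^p$: $\|T_tu-T_tv\|_{\mathrm{L}^p}\le\|u-v\|_{\mathrm{L}^p}$ for all $t\ge0$, $p\in[1,\infty]$, $u,v\in\mathrm{L}^2(X,m)$ (the right-hand side may be $+\infty$); (ii) order preservation: $u\ge v$ implies $T_tu\ge T_tv$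 for all $t\ge0$, $u,v\in\mathrm{L}^2(X,m)$. Quadratic Dirichlet form: a quadratic, lower semicontinuous functional $\mathcal{E}:\mathrm{L}^2(X,m)\to[0,\infty]$ whose domain $D(\mathcal{E})$ is a dense subspace of $\mathrm{L}^2(X,m)$, and such that $\mathcal{E}(0\vee u\wedge1)\le\mathcal{E}(u)$ for all $u\in D(\mathcal{E})$ ($\vee,\wedge$ denote maximum and minimum). "Quadratic" means that $\mathcal{E}(u)=a(u,u)$ on $D(\mathcal{E})$ for some symmetric bilinear form $a$ on $D(\mathcal{E})$. *)

theory Defs
  imports "HOL-Probability.Probability"
begin

section \<open>Real normed spaces with an explicit carrier\<close>

text \<open>
  The spaces below depend on a measure and on a functional, so they are not types and the
  classes \<open>real_normed_vector\<close>, \<open>banach\<close>, \<open>real_inner\<close> do not apply to them.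
\<close>

record 'v nvs =
  pts :: "'v set"
  add :: "'v \<Rightarrow> 'v \<Rightarrow> 'v"
  null :: "'v"
  scale :: "real \<Rightarrow> 'v \<Rightarrow> 'v"
  nrm :: "'v \<Rightarrow> real"

definition sub :: "'v nvs \<Rightarrow> 'v \<Rightarrow> 'v \<Rightarrow> 'v" where
  "sub V x y = add V x (scale V (-1) y)"

definition vector_space_nvs :: "'v nvs \<Rightarrow> bool" where
  "vector_space_nvs V \<longleftrightarrow>
     null V \<in> pts V \<and>
     (\<forall>x\<in>pts V. \<forall>y\<in>pts V. add V x y \<in> pts V) \<and>
     (\<forall>c. \<forall>x\<in>pts V. scale V c x \<in> pts V) \<and>
     (\<forall>x\<in>pts V. \<forall>y\<in>pts V. \<forall>z\<in>pts V. add V (add V x y) z = add V x (add V y z)) \<and>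
     (\<forall>x\<in>pts V. \<forall>y\<in>pts V. add V x y = add V y x) \<and>
     (\<forall>x\<in>pts V. add V (null V) x = x) \<and>
     (\<forall>x\<in>pts V. \<exists>y\<in>pts V. add V x y = null V) \<and>
     (\<forall>c. \<forall>x\<in>pts V. \<forall>y\<in>pts V. scale V c (add V x y) = add V (scale V c x) (scale V c y)) \<and>
     (\<forall>c d. \<forall>x\<in>pts V. scale V (c + d) x = add V (scale V c x) (scale V d x)) \<and>
     (\<forall>c d. \<forall>x\<in>pts V. scale V c (scale V d x) = scale V (c * d) x) \<and>
     (\<forall>x\<in>pts V. scale V 1 x = x)"

definition subspace_nvs :: "'v nvs \<Rightarrow> 'v set \<Rightarrow> bool" where
  "subspace_nvs V S \<longleftrightarrow>
     S \<subseteq> pts V \<and> null V \<in> S \<and>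
     (\<forall>x\<in>S. \<forall>y\<in>S. add V x y \<in> S) \<and> (\<forall>c. \<forall>x\<in>S. scale V c x \<in> S)"

definition normed_nvs :: "'v nvs \<Rightarrow> bool" where
  "normed_nvs V \<longleftrightarrow>
     vector_space_nvs V \<and>
     (\<forall>x\<in>pts V. 0 \<le> nrm V x) \<and>
     (\<forall>x\<in>pts V. nrm V x = 0 \<longleftrightarrow> x = null V) \<and>
     (\<forall>c. \<forall>x\<in>pts V. nrm V (scale V c x) = \<bar>c\<bar> * nrm V x) \<and>
     (\<forall>x\<in>pts V. \<forall>y\<in>pts V. nrm V (add V x y) \<le> nrm V x + nrm V y)"

definition converges_nvs :: "'v nvs \<Rightarrow> (nat \<Rightarrow> 'v) \<Rightarrow> 'v \<Rightarrow> bool" where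
  "converges_nvs V x l \<longleftrightarrow> (\<lambda>n. nrm V (sub V (x n) l)) \<longlonglongrightarrow> 0"

definition cauchy_nvs :: "'v nvs \<Rightarrow> (nat \<Rightarrow> 'v) \<Rightarrow> bool" where
  "cauchy_nvs V x \<longleftrightarrow> (\<forall>e>0. \<exists>N. \<forall>m\<ge>N. \<forall>n\<ge>N. nrm V (sub V (x m) (x n)) < e)"

definition banach_nvs :: "'v nvs \<Rightarrow> bool" where
  "banach_nvs V \<longleftrightarrow>
     normed_nvs V \<and>
     (\<forall>x. (\<forall>n. x n \<in> pts V) \<and> cauchy_nvs V x \<longrightarrow> (\<exists>l\<in>pts V. converges_nvs V x l))"

definition symmetric_bilinear_nvs :: "'v nvs \<Rightarrow> 'v set \<Rightarrow> ('v \<Rightarrow> 'v \<Rightarrow> real) \<Rightarrow> bool" where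
  "symmetric_bilinear_nvs V S a \<longleftrightarrow>
     (\<forall>x\<in>S. \<forall>y\<in>S. a x y = a y x) \<and>
     (\<forall>x\<in>S. \<forall>y\<in>S. \<forall>z\<in>S. a (add V x y) z = a x z + a y z) \<and>
     (\<forall>c. \<forall>x\<in>S. \<forall>y\<in>S. a (scale V c x) y = c * a x y)"

text \<open>Positive definiteness of the inner product follows from the properties of the norm.\<close>

definition hilbert_nvs :: "'v nvs \<Rightarrow> bool" where
  "hilbert_nvs V \<longleftrightarrow>
     banach_nvs V \<and>
     (\<exists>a. symmetric_bilinear_nvs V (pts V) a \<and> (\<forall>x\<in>pts V. (nrm V x)\<^sup>2 = a x x))"

text \<open>
  Functionals are set to \<open>0\<close> outside the carrier, so that equality of functionals is equality
  on the carrier.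
\<close>

definition dual_nvs :: "'v nvs \<Rightarrow> ('v \<Rightarrow> real) nvs" where
  "dual_nvs V =
     \<lparr>pts = {f. (\<forall>x. x \<notin> pts V \<longrightarrow> f x = 0) \<and>
                (\<forall>x\<in>pts V. \<forall>y\<in>pts V. f (add V x y) = f x + f y) \<and>
                (\<forall>c. \<forall>x\<in>pts V. f (scale V c x) = c * f x) \<and>
                (\<exists>C. \<forall>x\<in>pts V. \<bar>f x\<bar> \<le> C * nrm V x)},
      add = (\<lambda>f g x. f x + g x),
      null = (\<lambda>x. 0),
      scale = (\<lambda>c f x. c * f x),
      nrm = (\<lambda>f. SUP x\<in>{x \<in> pts V. nrm V x \<le> 1}. \<bar>f x\<bar>)\<rparr>"

definition isometric_iso_nvs :: "'v nvs \<Rightarrow> 'w nvs \<Rightarrow> ('v \<Rightarrow> 'w) \<Rightarrow> bool" where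
  "isometric_iso_nvs V W \<Phi> \<longleftrightarrow>
     bij_betw \<Phi> (pts V) (pts W) \<and>
     (\<forall>x\<in>pts V. \<forall>y\<in>pts V. \<Phi> (add V x y) = add W (\<Phi> x) (\<Phi> y)) \<and>
     (\<forall>c. \<forall>x\<in>pts V. \<Phi> (scale V c x) = scale W c (\<Phi> x)) \<and>
     (\<forall>x\<in>pts V. nrm W (\<Phi> x) = nrm V x)"

text \<open>
  The predual \<open>Y\<close> ranges over Banach spaces whose points are functions \<open>'v \<Rightarrow> real\<close>. This is no
  restriction: a Banach space whose dual is \<open>V\<close> embeds isometrically into its bidual, hence into
  the dual of \<open>V\<close>, whose points have this type.
\<close>

definition is_dual_space_nvs :: "'v nvs \<Rightarrow> bool" where
  "is_dual_space_nvs V \<longleftrightarrow>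
     (\<exists>(Y :: ('v \<Rightarrow> real) nvs) \<Phi>. banach_nvs Y \<and> isometric_iso_nvs V (dual_nvs Y) \<Phi>)"


section \<open>The space of square-integrable functions modulo null sets\<close>

definition square_integrable :: "'a measure \<Rightarrow> ('a \<Rightarrow> real) set" where
  "square_integrable M = {f \<in> borel_measurable M. integrable M (\<lambda>x. (f x)\<^sup>2)}"

text \<open>Note that \<open>L2_class M f\<close> is empty, hence not a point of the space, if \<open>f\<close> is measurable but
  not square-integrable.\<close>

definition L2_class :: "'a measure \<Rightarrow> ('a \<Rightarrow> real) \<Rightarrow> ('a \<Rightarrow> real) set" where
  "L2_class M f = {g \<in> square_integrable M. AE x in M. g x = f x}"

definition L2 :: "'a measure \<Rightarrow> ('a \<Rightarrow> real) set set" where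
  "L2 M = L2_class M ` square_integrable M"

definition rep :: "('a \<Rightarrow> real) set \<Rightarrow> 'a \<Rightarrow> real" where
  "rep u = (SOME f. f \<in> u)"

definition L2_inner :: "'a measure \<Rightarrow> ('a \<Rightarrow> real) set \<Rightarrow> ('a \<Rightarrow> real) set \<Rightarrow> real" where
  "L2_inner M u v = (\<integral>x. rep u x * rep v x \<partial>M)"

definition L2_space :: "'a measure \<Rightarrow> ('a \<Rightarrow> real) set nvs" where
  "L2_space M =
     \<lparr>pts = L2 M,
      add = (\<lambda>u v. L2_class M (\<lambda>x. rep u x + rep v x)),
      null = L2_class M (\<lambda>x. 0),
      scale = (\<lambda>c u. L2_class M (\<lambda>x. c * rep u x)),
      nrm = (\<lambda>u. sqrt (L2_inner M u u))\<rparr>"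

definition L2_comp :: "'a measure \<Rightarrow> (real \<Rightarrow> real) \<Rightarrow> ('a \<Rightarrow> real) set \<Rightarrow> ('a \<Rightarrow> real) set" where
  "L2_comp M \<phi> u = L2_class M (\<lambda>x. \<phi> (rep u x))"

definition L2_mult :: "'a measure \<Rightarrow> ('a \<Rightarrow> real) set \<Rightarrow> ('a \<Rightarrow> real) set \<Rightarrow> ('a \<Rightarrow> real) set" where
  "L2_mult M u v = L2_class M (\<lambda>x. rep u x * rep v x)"

text \<open>The extended \<open>L\<^sup>p\<close>-norm of a measurable function, for \<open>p \<in> [1,\<infinity>]\<close>.\<close>

definition Lp_norm :: "'a measure \<Rightarrow> ennreal \<Rightarrow> ('a \<Rightarrow> real) \<Rightarrow> ennreal" where
  "Lp_norm M p f =
     (if p = \<infinity> then esssup M (\<lambda>x. ennreal \<bar>f x\<bar>)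
      else (let I = (\<integral>\<^sup>+x. ennreal (\<bar>f x\<bar> powr enn2real p) \<partial>M)
            in if I = \<infinity> then \<infinity> else ennreal (enn2real I powr (1 / enn2real p))))"

definition Linf :: "'a measure \<Rightarrow> ('a \<Rightarrow> real) set set" where
  "Linf M = {u \<in> L2 M. Lp_norm M \<infinity> (rep u) < \<infinity>}"

lemma rep_L2:
  assumes "u \<in> L2 M"
  shows "rep u \<in> square_integrable M" and "L2_class M (rep u) = u"
proof -
  obtain f where f: "f \<in> square_integrable M" "u = L2_class M f"
    using assms by (auto simp: L2_def)
  then have "f \<in> u" by (simp add: L2_class_def)
  then have "rep u \<in> u" unfolding rep_def by (rule someI[where P = "\<lambda>g. g \<in> _"])
  then show "rep u \<in> square_integrable M"
    using f by (simp add: L2_class_def)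
  have "AE x in M. rep u x = f x"
    using \<open>rep u \<in> u\<close> f by (simp add: L2_class_def)
  then show "L2_class M (rep u) = u"
    unfolding f(2) L2_class_def by (auto elim: eventually_elim2)
qed

lemma rep_L2_class:
  assumes "f \<in> square_integrable M"
  shows "AE x in M. rep (L2_class M f) x = f x"
proof -
  have "f \<in> L2_class M f" using assms by (simp add: L2_class_def)
  then have "rep (L2_class M f) \<in> L2_class M f" unfolding rep_def by (rule someI[where P = "\<lambda>g. g \<in> _"])
  then show ?thesis by (simp add: L2_class_def)
qed


section \<open>Functionals on \<open>L\<^sup>2\<close>\<close>

text \<open>
  A functional \<open>E\<close> with values in \<open>[0,\<infinity>]\<close> is a function into \<open>ennreal\<close>; only its values on
  \<open>L2 M\<close> matter. In \<open>ennreal\<close>, \<open>0 * \<infinity> = 0\<close>.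
\<close>

definition domE :: "'a measure \<Rightarrow> (('a \<Rightarrow> real) set \<Rightarrow> ennreal) \<Rightarrow> ('a \<Rightarrow> real) set set" where
  "domE M E = {u \<in> L2 M. E u \<noteq> \<infinity>}"

definition two_homogeneous :: "'a measure \<Rightarrow> (('a \<Rightarrow> real) set \<Rightarrow> ennreal) \<Rightarrow> bool" where
  "two_homogeneous M E \<longleftrightarrow>
     (\<forall>\<nu>. \<forall>u\<in>L2 M. E (scale (L2_space M) \<nu> u) = ennreal (\<nu>\<^sup>2) * E u)"

definition convex_functional :: "'a measure \<Rightarrow> (('a \<Rightarrow> real) set \<Rightarrow> ennreal) \<Rightarrow> bool" where
  "convex_functional M E \<longleftrightarrow>
     (\<forall>u\<in>L2 M. \<forall>v\<in>L2 M. \<forall>t\<in>{0..1}.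
        E (add (L2_space M) (scale (L2_space M) (1 - t) u) (scale (L2_space M) t v))
          \<le> ennreal (1 - t) * E u + ennreal t * E v)"

definition lsc_functional :: "'a measure \<Rightarrow> (('a \<Rightarrow> real) set \<Rightarrow> ennreal) \<Rightarrow> bool" where
  "lsc_functional M E \<longleftrightarrow>
     (\<forall>u. \<forall>l\<in>L2 M. (\<forall>n. u n \<in> L2 M) \<and> converges_nvs (L2_space M) u l
        \<longrightarrow> E l \<le> liminf (\<lambda>n. E (u n)))"

definition dense_in_L2 :: "'a measure \<Rightarrow> ('a \<Rightarrow> real) set set \<Rightarrow> bool" where
  "dense_in_L2 M S \<longleftrightarrow>
     S \<subseteq> L2 M \<and> (\<forall>u\<in>L2 M. \<forall>e>0. \<exists>v\<in>S. nrm (L2_space M) (sub (L2_space M) u v) < e)"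

definition subdifferential ::
  "'a measure \<Rightarrow> (('a \<Rightarrow> real) set \<Rightarrow> ennreal) \<Rightarrow> ('a \<Rightarrow> real) set \<Rightarrow> ('a \<Rightarrow> real) set set" where
  "subdifferential M E u =
     {\<xi> \<in> L2 M. u \<in> domE M E \<and>
        (\<forall>z\<in>L2 M. enn2ereal (E z) - enn2ereal (E u) \<ge> ereal (L2_inner M \<xi> (sub (L2_space M) z u)))}"

text \<open>
  \<open>T t u\<close> solves the differential inclusion for every \<open>t > 0\<close> with the time derivative taken from
  the right, as a strong limit in \<open>L\<^sup>2\<close>, and is continuous on \<open>[0,\<infinity>)\<close>. The two-sided derivative
  of a gradient flow can fail to exist at some times, whereas the right one exists at every
  \<open>t > 0\<close> (Brezis). By monotonicity of the subdifferential these conditions determine \<open>T t u\<close> for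
  all \<open>t \<ge> 0\<close>, and the result is the same as for the locally absolutely continuous solution with
  the inclusion at almost every \<open>t > 0\<close>.
\<close>

definition gradient_flow ::
  "'a measure \<Rightarrow> (('a \<Rightarrow> real) set \<Rightarrow> ennreal) \<Rightarrow> (real \<Rightarrow> ('a \<Rightarrow> real) set \<Rightarrow> ('a \<Rightarrow> real) set) \<Rightarrow> bool" where
  "gradient_flow M E T \<longleftrightarrow>
     (let H = L2_space M in
      \<forall>u\<in>L2 M.
        T 0 u = u \<and>
        (\<forall>t\<ge>0. T t u \<in> L2 M \<and>
           ((\<lambda>s. nrm H (sub H (T s u) (T t u))) \<longlongrightarrow> 0) (at t within {0..})) \<and>
        (\<forall>t>0. \<exists>\<xi>\<in>subdifferential M E (T t u).
           ((\<lambda>h. nrm H (sub H (scale H (1 / h) (sub H (T (t + h) u) (T t u))) (scale H (-1) \<xi>)))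
              \<longlongrightarrow> 0) (at_right 0)))"

definition Lp_contractive ::
  "'a measure \<Rightarrow> (real \<Rightarrow> ('a \<Rightarrow> real) set \<Rightarrow> ('a \<Rightarrow> real) set) \<Rightarrow> bool" where
  "Lp_contractive M T \<longleftrightarrow>
     (\<forall>t\<ge>0. \<forall>p\<ge>1. \<forall>u\<in>L2 M. \<forall>v\<in>L2 M.
        Lp_norm M p (\<lambda>x. rep (T t u) x - rep (T t v) x) \<le> Lp_norm M p (\<lambda>x. rep u x - rep v x))"

definition order_preserving ::
  "'a measure \<Rightarrow> (real \<Rightarrow> ('a \<Rightarrow> real) set \<Rightarrow> ('a \<Rightarrow> real) set) \<Rightarrow> bool" where
  "order_preserving M T \<longleftrightarrow>
     (\<forall>t\<ge>0. \<forall>u\<in>L2 M. \<forall>v\<in>L2 M.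
        (AE x in M. rep u x \<ge> rep v x) \<longrightarrow> (AE x in M. rep (T t u) x \<ge> rep (T t v) x))"

definition nonlinear_dirichlet_form ::
  "'a measure \<Rightarrow> (('a \<Rightarrow> real) set \<Rightarrow> ennreal) \<Rightarrow> bool" where
  "nonlinear_dirichlet_form M E \<longleftrightarrow>
     convex_functional M E \<and> lsc_functional M E \<and> dense_in_L2 M (domE M E) \<and>
     (\<exists>T. gradient_flow M E T \<and> Lp_contractive M T \<and> order_preserving M T)"

definition quadratic_functional :: "'a measure \<Rightarrow> (('a \<Rightarrow> real) set \<Rightarrow> ennreal) \<Rightarrow> bool" where
  "quadratic_functional M E \<longleftrightarrow>
     (\<exists>a. symmetric_bilinear_nvs (L2_space M) (domE M E) a \<and>
          (\<forall>u\<in>domE M E. enn2real (E u) = a u u))"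

definition quadratic_dirichlet_form ::
  "'a measure \<Rightarrow> (('a \<Rightarrow> real) set \<Rightarrow> ennreal) \<Rightarrow> bool" where
  "quadratic_dirichlet_form M E \<longleftrightarrow>
     subspace_nvs (L2_space M) (domE M E) \<and> dense_in_L2 M (domE M E) \<and>
     quadratic_functional M E \<and> lsc_functional M E \<and>
     (\<forall>u\<in>domE M E. E (L2_comp M (\<lambda>s. min (max 0 s) 1) u) \<le> E u)"

definition energy_space ::
  "'a measure \<Rightarrow> (('a \<Rightarrow> real) set \<Rightarrow> ennreal) \<Rightarrow> ('a \<Rightarrow> real) set nvs" where
  "energy_space M E =
     (L2_space M)\<lparr>pts := domE M E,
                  nrm := (\<lambda>u. sqrt ((nrm (L2_space M) u)\<^sup>2 + enn2real (E u)))\<rparr>"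

definition borel_isomorphic_to_real :: "'a measure \<Rightarrow> bool" where
  "borel_isomorphic_to_real M \<longleftrightarrow>
     (\<exists>f. bij_betw f (space M) (UNIV :: real set) \<and>
          f \<in> M \<rightarrow>\<^sub>M borel \<and> the_inv_into (space M) f \<in> borel \<rightarrow>\<^sub>M M)"

end

theory Submission
  imports Defs
begin

text \<open>
  The proof has two independent parts, one about the norm and one about the flow.

  Convexity and homogeneity make \<open>\<surd>E\<close> a seminorm on a vector space (\<open>domE_add\<close>), so
  \<open>\<parallel>u\<parallel>\<^sub>E = (\<parallel>u\<parallel>\<^sup>2 + E u)\<^sup>1\<^sup>/\<^sup>2\<close> is a norm that dominates the norm of \<open>L\<^sup>2\<close>, and lower semicontinuity says that its
  balls are closed in \<open>L\<^sup>2\<close>. These two properties suffice for completeness and for the existence of a predual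
  (locale \<open>closed_ball_norm\<close>). A Cauchy sequence for \<open>\<parallel>\<cdot>\<parallel>\<^sub>E\<close> converges in \<open>L\<^sup>2\<close>, and the closed balls carry the
  estimates over to the limit. The predual is the closure of the functionals \<open>\<langle>y, \<cdot>\<rangle>\<close>, \<open>y \<in> L\<^sup>2\<close>, in the dual
  of \<open>D(E)\<close>. By the Riesz theorem a bounded functional \<open>F\<close> on it acts on them as \<open>\<langle>y, \<cdot>\<rangle> \<mapsto> \<langle>y, x\<rangle>\<close> for some
  \<open>x \<in> L\<^sup>2\<close>. If \<open>x\<close> were outside the ball of radius \<open>\<parallel>F\<parallel>\<close> of \<open>D(E)\<close>, then the direction \<open>y\<close> from the closest
  point of this ball to \<open>x\<close> would contradict \<open>\<bar>F \<langle>y, \<cdot>\<rangle>\<bar> \<le> \<parallel>F\<parallel> \<parallel>\<langle>y, \<cdot>\<rangle>\<parallel>\<close> (\<open>evaluation_onto\<close>).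

  The gradient flow satisfies the evolution variational inequality: the right derivative of
  \<open>\<parallel>T\<^sub>t y - x\<parallel>\<^sup>2 / 2\<close> is at most \<open>E x - E (T\<^sub>t y)\<close>. If the flow that starts at \<open>y\<close> never comes closer to \<open>x\<close>
  than \<open>y\<close> is, then \<open>E (T\<^sub>t y) \<le> E x\<close> at arbitrarily small times, and \<open>E y \<le> E x\<close> by lower semicontinuity
  (\<open>energy_le\<close>). Now let \<open>x = u\<close> and \<open>y = \<phi> \<circ> u\<close> with \<open>\<phi> 0 = 0\<close> and both \<open>\<phi>\<close> and \<open>id - \<phi>\<close> nondecreasing. It is
  enough to have \<open>\<integral> (T\<^sub>t y - y) (u - y) \<le> 0\<close>. The functions \<open>y\<close> and \<open>u - y\<close> are comonotone, so on a
  superlevel set of \<open>u - y\<close> the function \<open>y\<close> lies above some level \<open>r\<close> and off this set below it. The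
  \<open>L\<^sup>\<infinity>\<close> contraction keeps the image of \<open>min y r\<close> below \<open>r\<close>, the \<open>L\<^sup>1\<close> contraction controls what the rest of \<open>y\<close>
  contributes, and integration over all superlevel sets gives the inequality (\<open>comonotone_pairing_le\<close>).

  Hence \<open>E (\<phi> \<circ> u) \<le> E u\<close> (\<open>energy_comp_le\<close>). The squared norm and \<open>E\<close> differ by the \<open>L\<^sup>2\<close>
  inner product, so one comes from a bilinear form exactly when the other does. The unit contraction is such a
  \<open>\<phi>\<close>, so the energy has the Markov property that a quadratic Dirichlet form needs. A Lipschitz function with constant \<open>1\<close> that vanishes at \<open>0\<close> is \<open>2 \<phi> - id\<close> for such a \<open>\<phi>\<close>,
  so Lipschitz functions operate on the vector space \<open>D(E)\<close>; truncated squares and polarization then give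
  the algebra property.
\<close>


section \<open>Subspaces and dual spaces\<close>

lemma sub_update [simp]:
  "sub (V\<lparr>pts := S\<rparr>) = sub V" "sub (V\<lparr>nrm := p\<rparr>) = sub V"
  by (auto simp: sub_def fun_eq_iff)

lemma
  assumes "vector_space_nvs V"
  shows vector_space_null: "null V \<in> pts V"
    and vector_space_add: "x \<in> pts V \<Longrightarrow> y \<in> pts V \<Longrightarrow> add V x y \<in> pts V"
    and vector_space_scale: "x \<in> pts V \<Longrightarrow> scale V c x \<in> pts V"
    and vector_space_assoc: "x \<in> pts V \<Longrightarrow> y \<in> pts V \<Longrightarrow> z \<in> pts V \<Longrightarrow>
      add V (add V x y) z = add V x (add V y z)"
    and vector_space_commute: "x \<in> pts V \<Longrightarrow> y \<in> pts V \<Longrightarrow> add V x y = add V y x"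
    and vector_space_null_left: "x \<in> pts V \<Longrightarrow> add V (null V) x = x"
    and vector_space_inverse: "x \<in> pts V \<Longrightarrow> \<exists>y\<in>pts V. add V x y = null V"
    and vector_space_distrib: "x \<in> pts V \<Longrightarrow> y \<in> pts V \<Longrightarrow>
      scale V c (add V x y) = add V (scale V c x) (scale V c y)"
    and vector_space_distrib_left: "x \<in> pts V \<Longrightarrow>
      scale V (c + d) x = add V (scale V c x) (scale V d x)"
    and vector_space_scale_scale: "x \<in> pts V \<Longrightarrow> scale V c (scale V d x) = scale V (c * d) x"
    and vector_space_scale_1: "x \<in> pts V \<Longrightarrow> scale V 1 x = x"
  using assms[unfolded vector_space_nvs_def]
  by (meson, meson, meson, meson, meson, meson, meson, meson, meson, meson, meson)

lemma
  assumes "normed_nvs V"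
  shows normed_vector_space: "vector_space_nvs V"
    and normed_nonneg: "x \<in> pts V \<Longrightarrow> 0 \<le> nrm V x"
    and normed_zero: "x \<in> pts V \<Longrightarrow> nrm V x = 0 \<longleftrightarrow> x = null V"
    and normed_scale: "x \<in> pts V \<Longrightarrow> nrm V (scale V c x) = \<bar>c\<bar> * nrm V x"
    and normed_add: "x \<in> pts V \<Longrightarrow> y \<in> pts V \<Longrightarrow> nrm V (add V x y) \<le> nrm V x + nrm V y"
  using assms unfolding normed_nvs_def by simp_all

lemma vector_space_scale_0:
  assumes V: "vector_space_nvs V" and x: "x \<in> pts V"
  shows "scale V 0 x = null V"
proof -
  define z where "z = scale V 0 x"
  have z: "z \<in> pts V"
    unfolding z_def by (rule vector_space_scale[OF assms])
  have zz: "add V z z = z"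
    using vector_space_distrib_left[OF assms, of 0 0] by (simp add: z_def)
  obtain y where y: "y \<in> pts V" "add V z y = null V"
    using vector_space_inverse[OF V z] by blast
  have "null V = add V (add V z z) y"
    using y zz by simp
  also have "\<dots> = add V z (null V)"
    using vector_space_assoc[OF V z z y(1)] y by simp
  also have "\<dots> = z"
    using vector_space_commute[OF V z vector_space_null[OF V]] vector_space_null_left[OF V z] by simp
  finally show ?thesis by (simp add: z_def)
qed

lemma vector_space_sub_self:
  assumes V: "vector_space_nvs V" and x: "x \<in> pts V"
  shows "sub V x x = null V"
  using vector_space_distrib_left[OF assms, of 1 "-1"] vector_space_scale_1[OF assms]
    vector_space_scale_0[OF assms] by (simp add: sub_def)

lemma vector_space_subspace:
  assumes V: "vector_space_nvs V" and S: "subspace_nvs V S"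
  shows "vector_space_nvs (V\<lparr>pts := S\<rparr>)"
proof -
  have SV: "x \<in> pts V" if "x \<in> S" for x using S that by (auto simp: subspace_nvs_def)
  have S': "null V \<in> S" "\<And>x y. x \<in> S \<Longrightarrow> y \<in> S \<Longrightarrow> add V x y \<in> S"
    "\<And>c x. x \<in> S \<Longrightarrow> scale V c x \<in> S"
    using S by (simp_all add: subspace_nvs_def)
  have inv: "\<exists>y\<in>S. add V x y = null V" if "x \<in> S" for x
    using vector_space_sub_self[OF V SV[OF that]] S'(3)[OF that, of "-1"] unfolding sub_def by blast
  show ?thesis
    unfolding vector_space_nvs_def
    by (simp, intro conjI ballI allI S' inv vector_space_distrib[OF V] vector_space_distrib_left[OF V]
        vector_space_scale_scale[OF V] vector_space_scale_1[OF V] vector_space_null_left[OF V]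
        vector_space_assoc[OF V] vector_space_commute[OF V] SV)
qed

lemma vector_space_nrm_update [simp]:
  "vector_space_nvs (V\<lparr>nrm := p\<rparr>) = vector_space_nvs V"
  by (simp add: vector_space_nvs_def)

lemma normed_subspace:
  assumes V: "normed_nvs V" and S: "subspace_nvs V S"
  shows "normed_nvs (V\<lparr>pts := S\<rparr>)"
  using vector_space_subspace[of V S] assms
  unfolding normed_nvs_def subspace_nvs_def subset_iff by simp

lemma banach_closed_subspace:
  assumes V: "banach_nvs V" and S: "subspace_nvs V S"
    and closed: "\<And>x l. \<lbrakk>\<And>n. x n \<in> S; l \<in> pts V; converges_nvs V x l\<rbrakk> \<Longrightarrow> l \<in> S"
  shows "banach_nvs (V\<lparr>pts := S\<rparr>)"
  unfolding banach_nvs_def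
proof (intro conjI allI impI)
  show "normed_nvs (V\<lparr>pts := S\<rparr>)"
    using V S by (intro normed_subspace) (auto simp: banach_nvs_def)
  fix x assume x: "(\<forall>n. x n \<in> pts (V\<lparr>pts := S\<rparr>)) \<and> cauchy_nvs (V\<lparr>pts := S\<rparr>) x"
  then have xS: "x n \<in> S" for n by simp
  have "\<forall>n. x n \<in> pts V" using xS S by (auto simp: subspace_nvs_def)
  moreover have "cauchy_nvs V x" using x by (simp add: cauchy_nvs_def)
  ultimately obtain l where l: "l \<in> pts V" "converges_nvs V x l"
    using V unfolding banach_nvs_def by blast
  then have "l \<in> S" using closed xS by blast
  then show "\<exists>l\<in>pts (V\<lparr>pts := S\<rparr>). converges_nvs (V\<lparr>pts := S\<rparr>) x l"
    using l by (auto simp: converges_nvs_def)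
qed

lemma normed_nrm_sub:
  assumes V: "normed_nvs V" and x: "x \<in> pts V" and y: "y \<in> pts V"
  shows "nrm V (sub V x y) \<le> nrm V x + nrm V y" and "sub V x y \<in> pts V"
proof -
  note vs = normed_vector_space[OF V]
  have s: "scale V (-1) y \<in> pts V" by (rule vector_space_scale[OF vs y])
  show "sub V x y \<in> pts V"
    unfolding sub_def by (rule vector_space_add[OF vs x s])
  show "nrm V (sub V x y) \<le> nrm V x + nrm V y"
    using normed_add[OF V x s] normed_scale[OF V y, of "-1"] by (simp add: sub_def)
qed

lemma dual_simps [simp]:
  "add (dual_nvs V) = (\<lambda>f g x. f x + g x)" "null (dual_nvs V) = (\<lambda>x. 0)"
  "scale (dual_nvs V) = (\<lambda>c f x. c * f x)"
  "sub (dual_nvs V) f g = (\<lambda>x. f x - g x)"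
  by (auto simp: dual_nvs_def sub_def)

lemma dual_pts:
  "f \<in> pts (dual_nvs V) \<longleftrightarrow> (\<forall>x. x \<notin> pts V \<longrightarrow> f x = 0) \<and>
     (\<forall>x\<in>pts V. \<forall>y\<in>pts V. f (add V x y) = f x + f y) \<and>
     (\<forall>c. \<forall>x\<in>pts V. f (scale V c x) = c * f x) \<and>
     (\<exists>C. \<forall>x\<in>pts V. \<bar>f x\<bar> \<le> C * nrm V x)"
  by (simp add: dual_nvs_def)

lemma dual_norm_le:
  assumes V: "normed_nvs V" and C: "0 \<le> C"
    and le: "\<And>x. x \<in> pts V \<Longrightarrow> \<bar>f x\<bar> \<le> C * nrm V x"
  shows "nrm (dual_nvs V) f \<le> C"
proof -
  have "null V \<in> pts V" "nrm V (null V) = 0"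
    using vector_space_null[OF normed_vector_space[OF V]] normed_zero[OF V] by auto
  then have "{x \<in> pts V. nrm V x \<le> 1} \<noteq> {}" by force
  moreover have "\<bar>f x\<bar> \<le> C" if "x \<in> pts V" "nrm V x \<le> 1" for x
    using le[OF that(1)] mult_left_mono[OF that(2) C] by simp
  ultimately show ?thesis
    unfolding dual_nvs_def by (auto intro!: cSUP_least)
qed

lemma
  assumes V: "normed_nvs V" and f: "f \<in> pts (dual_nvs V)"
  shows dual_norm_nonneg: "0 \<le> nrm (dual_nvs V) f"
    and dual_bound: "x \<in> pts V \<Longrightarrow> \<bar>f x\<bar> \<le> nrm (dual_nvs V) f * nrm V x"
proof -
  have nul: "null V \<in> pts V" "nrm V (null V) = 0"
    using vector_space_null[OF normed_vector_space[OF V]] normed_zero[OF V] by auto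
  obtain C where C: "\<And>x. x \<in> pts V \<Longrightarrow> \<bar>f x\<bar> \<le> C * nrm V x"
    using f unfolding dual_pts by blast
  have "\<bar>f x\<bar> \<le> \<bar>C\<bar>" if "x \<in> pts V" "nrm V x \<le> 1" for x
  proof -
    have "0 \<le> nrm V x" using normed_nonneg[OF V] that by blast
    then have "C * nrm V x \<le> \<bar>C\<bar> * 1"
      using that by (intro mult_mono) auto
    then show ?thesis using C[OF that(1)] by simp
  qed
  then have bdd: "bdd_above ((\<lambda>x. \<bar>f x\<bar>) ` {x \<in> pts V. nrm V x \<le> 1})"
    by (auto intro!: bdd_aboveI)
  have le: "\<bar>f x\<bar> \<le> nrm (dual_nvs V) f" if "x \<in> pts V" "nrm V x \<le> 1" for x
    unfolding dual_nvs_def using that bdd by (auto intro!: cSUP_upper)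
  show "0 \<le> nrm (dual_nvs V) f"
    using le[of "null V"] nul by force
  assume x: "x \<in> pts V"
  show "\<bar>f x\<bar> \<le> nrm (dual_nvs V) f * nrm V x"
  proof (cases "nrm V x = 0")
    case True
    then show ?thesis using C[OF x] by simp
  next
    case False
    then have pos: "0 < nrm V x" using normed_nonneg[OF V x] by simp
    let ?y = "scale V (1 / nrm V x) x"
    have "?y \<in> pts V" by (rule vector_space_scale[OF normed_vector_space[OF V] x])
    moreover have "nrm V ?y = 1" using normed_scale[OF V x] pos by simp
    moreover have "f ?y = f x / nrm V x" using f x by (simp add: dual_pts)
    ultimately have "\<bar>f x\<bar> / nrm V x \<le> nrm (dual_nvs V) f"
      using le[of ?y] pos by (simp add: abs_divide)
    then show ?thesis using pos by (simp add: field_simps)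
  qed
qed

lemma dual_normed:
  assumes V: "normed_nvs V"
  shows "normed_nvs (dual_nvs V)"
proof -
  have add: "(\<lambda>x. f x + g x) \<in> pts (dual_nvs V)"
    if f: "f \<in> pts (dual_nvs V)" and g: "g \<in> pts (dual_nvs V)" for f g
  proof -
    have "\<bar>f x + g x\<bar> \<le> (nrm (dual_nvs V) f + nrm (dual_nvs V) g) * nrm V x"
      if "x \<in> pts V" for x
      using dual_bound[OF V f that] dual_bound[OF V g that] by (simp add: algebra_simps)
    then have "\<exists>C. \<forall>x\<in>pts V. \<bar>f x + g x\<bar> \<le> C * nrm V x" by blast
    then show ?thesis using f g by (simp add: dual_pts algebra_simps)
  qed
  have scale: "(\<lambda>x. c * f x) \<in> pts (dual_nvs V)" if f: "f \<in> pts (dual_nvs V)" for f c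
  proof -
    have "\<bar>c * f x\<bar> \<le> (\<bar>c\<bar> * nrm (dual_nvs V) f) * nrm V x" if "x \<in> pts V" for x
      using mult_left_mono[OF dual_bound[OF V f that], of "\<bar>c\<bar>"]
      by (simp add: abs_mult algebra_simps)
    then have "\<exists>C. \<forall>x\<in>pts V. \<bar>c * f x\<bar> \<le> C * nrm V x" by blast
    then show ?thesis using f by (simp add: dual_pts algebra_simps)
  qed
  have null: "(\<lambda>x. 0) \<in> pts (dual_nvs V)"
    by (auto simp: dual_pts intro!: exI[of _ 0])
  have vs: "vector_space_nvs (dual_nvs V)"
  proof -
    have "\<exists>g\<in>pts (dual_nvs V). (\<lambda>x. f x + g x) = (\<lambda>x. 0)" if "f \<in> pts (dual_nvs V)" for f
      using scale[OF that, of "-1"] by (intro bexI[of _ "\<lambda>x. -1 * f x"]) auto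
    then show ?thesis
      using add scale null unfolding vector_space_nvs_def by (simp add: algebra_simps)
  qed
  have zero: "nrm (dual_nvs V) f = 0 \<longleftrightarrow> f = (\<lambda>x. 0)" if f: "f \<in> pts (dual_nvs V)" for f
  proof
    assume n: "nrm (dual_nvs V) f = 0"
    show "f = (\<lambda>x. 0)"
    proof
      fix x show "f x = 0"
        using dual_bound[OF V f, of x] n f by (cases "x \<in> pts V") (auto simp: dual_pts)
    qed
  next
    assume "f = (\<lambda>x. 0)"
    then have "nrm (dual_nvs V) f \<le> 0" by (intro dual_norm_le[OF V]) auto
    then show "nrm (dual_nvs V) f = 0" using dual_norm_nonneg[OF V f] by simp
  qed
  have sc_le: "nrm (dual_nvs V) (\<lambda>x. c * f x) \<le> \<bar>c\<bar> * nrm (dual_nvs V) f"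
    if f: "f \<in> pts (dual_nvs V)" for f c
  proof (rule dual_norm_le[OF V])
    show "0 \<le> \<bar>c\<bar> * nrm (dual_nvs V) f" using dual_norm_nonneg[OF V f] by simp
    fix x assume "x \<in> pts V"
    then show "\<bar>c * f x\<bar> \<le> \<bar>c\<bar> * nrm (dual_nvs V) f * nrm V x"
      using mult_left_mono[OF dual_bound[OF V f, of x], of "\<bar>c\<bar>"]
      by (simp add: abs_mult mult.assoc)
  qed
  have sc: "nrm (dual_nvs V) (\<lambda>x. c * f x) = \<bar>c\<bar> * nrm (dual_nvs V) f"
    if f: "f \<in> pts (dual_nvs V)" for f c
  proof (cases "c = 0")
    case True
    then show ?thesis using zero[OF null] by simp
  next
    case False
    have "\<bar>c\<bar> * nrm (dual_nvs V) f \<le> \<bar>c\<bar> * (\<bar>1/c\<bar> * nrm (dual_nvs V) (\<lambda>x. c * f x))"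
      using sc_le[OF scale[OF f, of c], of "1/c"] False by (intro mult_left_mono) auto
    also have "\<dots> = nrm (dual_nvs V) (\<lambda>x. c * f x)" using False by simp
    finally show ?thesis using sc_le[OF f, of c] by simp
  qed
  have tri: "nrm (dual_nvs V) (\<lambda>x. f x + g x) \<le> nrm (dual_nvs V) f + nrm (dual_nvs V) g"
    if f: "f \<in> pts (dual_nvs V)" and g: "g \<in> pts (dual_nvs V)" for f g
  proof (rule dual_norm_le[OF V])
    show "0 \<le> nrm (dual_nvs V) f + nrm (dual_nvs V) g"
      using dual_norm_nonneg[OF V f] dual_norm_nonneg[OF V g] by simp
    fix x assume "x \<in> pts V"
    then show "\<bar>f x + g x\<bar> \<le> (nrm (dual_nvs V) f + nrm (dual_nvs V) g) * nrm V x"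
      using dual_bound[OF V f, of x] dual_bound[OF V g, of x] by (simp add: algebra_simps)
  qed
  show ?thesis
    unfolding normed_nvs_def
    using vs zero sc tri dual_norm_nonneg[OF V] by auto
qed

text \<open>The limit is taken pointwise. The Cauchy property makes the convergence uniform on bounded sets, so
  the limit is bounded and is attained in norm.\<close>

lemma dual_banach:
  assumes V: "normed_nvs V"
  shows "banach_nvs (dual_nvs V)"
  unfolding banach_nvs_def
proof (intro conjI allI impI)
  show D: "normed_nvs (dual_nvs V)" by (rule dual_normed[OF V])
  fix f assume "(\<forall>n. f n \<in> pts (dual_nvs V)) \<and> cauchy_nvs (dual_nvs V) f"
  then have f: "\<And>n. f n \<in> pts (dual_nvs V)"
    and cau: "\<And>e. e > 0 \<Longrightarrow> \<exists>N. \<forall>m\<ge>N. \<forall>n\<ge>N. nrm (dual_nvs V) (\<lambda>x. f m x - f n x) < e"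
    unfolding cauchy_nvs_def by auto
  have fd: "(\<lambda>x. f m x - f n x) \<in> pts (dual_nvs V)" for m n
    using normed_nrm_sub(2)[OF D f f, of m n] by simp
  have unif: "\<exists>N. \<forall>m\<ge>N. \<forall>n\<ge>N. \<forall>x\<in>pts V. \<bar>f m x - f n x\<bar> \<le> e * nrm V x" if "e > 0" for e
  proof -
    obtain N where N: "\<And>m n. m \<ge> N \<Longrightarrow> n \<ge> N \<Longrightarrow> nrm (dual_nvs V) (\<lambda>x. f m x - f n x) < e"
      using cau[OF \<open>e > 0\<close>] by blast
    have "\<bar>f m x - f n x\<bar> \<le> e * nrm V x" if "m \<ge> N" "n \<ge> N" "x \<in> pts V" for m n x
    proof -
      have "0 \<le> nrm V x" using normed_nonneg[OF V] that by blast
      then have "nrm (dual_nvs V) (\<lambda>x. f m x - f n x) * nrm V x \<le> e * nrm V x"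
        using N[OF that(1,2)] by (intro mult_right_mono) auto
      then show ?thesis using dual_bound[OF V fd that(3), of m n] by simp
    qed
    then show ?thesis by blast
  qed
  have "convergent (\<lambda>n. f n x)" for x
  proof (cases "x \<in> pts V")
    case False
    then have "\<And>n. f n x = 0" using f by (simp add: dual_pts)
    then show ?thesis by (simp add: convergent_const)
  next
    case True
    have "Cauchy (\<lambda>n. f n x)"
    proof (rule CauchyI)
      fix e :: real assume e: "e > 0"
      have n0: "0 \<le> nrm V x" by (rule normed_nonneg[OF V True])
      have "0 < e / (nrm V x + 1)" using e n0 by simp
      from unif[OF this] obtain N where "\<forall>m\<ge>N. \<forall>n\<ge>N. \<forall>y\<in>pts V.
          \<bar>f m y - f n y\<bar> \<le> e / (nrm V x + 1) * nrm V y" ..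
      then have "\<bar>f m x - f n x\<bar> \<le> e / (nrm V x + 1) * nrm V x" if "m \<ge> N" "n \<ge> N" for m n
        using that True by simp
      moreover have "e / (nrm V x + 1) * nrm V x < e" using e n0 by (simp add: divide_less_eq)
      ultimately show "\<exists>M. \<forall>m\<ge>M. \<forall>n\<ge>M. norm (f m x - f n x) < e"
        by (intro exI[of _ N]) (auto intro: le_less_trans)
    qed
    then show ?thesis by (simp add: Cauchy_convergent_iff)
  qed
  then obtain l where l: "\<And>x. (\<lambda>n. f n x) \<longlonglongrightarrow> l x"
    unfolding convergent_def by metis
  have close: "\<exists>N. \<forall>n\<ge>N. \<forall>x\<in>pts V. \<bar>f n x - l x\<bar> \<le> e * nrm V x" if "e > 0" for e
  proof -
    obtain N where N: "\<And>m n x. m \<ge> N \<Longrightarrow> n \<ge> N \<Longrightarrow> x \<in> pts V \<Longrightarrow> \<bar>f m x - f n x\<bar> \<le> e * nrm V x"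
      using unif[OF \<open>e > 0\<close>] by blast
    have "\<bar>f m x - l x\<bar> \<le> e * nrm V x" if "m \<ge> N" "x \<in> pts V" for m x
    proof (rule LIMSEQ_le_const2)
      show "(\<lambda>n. \<bar>f m x - f n x\<bar>) \<longlonglongrightarrow> \<bar>f m x - l x\<bar>"
        by (intro tendsto_intros l)
      show "\<exists>N. \<forall>n\<ge>N. \<bar>f m x - f n x\<bar> \<le> e * nrm V x"
        using N that by blast
    qed
    then show ?thesis by blast
  qed
  have lpts: "l \<in> pts (dual_nvs V)"
    unfolding dual_pts
  proof (intro conjI allI ballI impI)
    fix x assume "x \<notin> pts V"
    then have "\<And>n. f n x = 0" using f by (simp add: dual_pts)
    then show "l x = 0" using l[of x] by (simp add: LIMSEQ_const_iff)
  next
    fix x y assume xy: "x \<in> pts V" "y \<in> pts V"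
    have "f n (add V x y) = f n x + f n y" for n using f[of n] xy by (simp add: dual_pts)
    then show "l (add V x y) = l x + l y"
      using l[of "add V x y"] tendsto_add[OF l[of x] l[of y]] LIMSEQ_unique by auto
  next
    fix c x assume x: "x \<in> pts V"
    have "f n (scale V c x) = c * f n x" for n using f[of n] x by (simp add: dual_pts)
    then show "l (scale V c x) = c * l x"
      using l[of "scale V c x"] tendsto_mult_left[OF l[of x], of c] LIMSEQ_unique by auto
  next
    obtain N where N: "\<And>x. x \<in> pts V \<Longrightarrow> \<bar>f N x - l x\<bar> \<le> 1 * nrm V x"
      using close[of 1] by force
    have "\<bar>l x\<bar> \<le> (nrm (dual_nvs V) (f N) + 1) * nrm V x" if "x \<in> pts V" for x
      using N[OF that] dual_bound[OF V f that, of N] by (simp add: algebra_simps)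
    then show "\<exists>C. \<forall>x\<in>pts V. \<bar>l x\<bar> \<le> C * nrm V x" by blast
  qed
  have "converges_nvs (dual_nvs V) f l"
    unfolding converges_nvs_def
  proof (rule LIMSEQ_I)
    fix e :: real assume "e > 0"
    then obtain N where N: "\<And>n x. n \<ge> N \<Longrightarrow> x \<in> pts V \<Longrightarrow> \<bar>f n x - l x\<bar> \<le> e/2 * nrm V x"
      using close[of "e/2"] by auto
    have "norm (nrm (dual_nvs V) (sub (dual_nvs V) (f n) l) - 0) < e" if "n \<ge> N" for n
    proof -
      have "nrm (dual_nvs V) (sub (dual_nvs V) (f n) l) \<le> e/2"
        using N[OF that] \<open>e > 0\<close> by (intro dual_norm_le[OF V]) auto
      moreover have "0 \<le> nrm (dual_nvs V) (sub (dual_nvs V) (f n) l)"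
        using normed_nrm_sub(2)[OF D f lpts] by (rule dual_norm_nonneg[OF V])
      ultimately show ?thesis using \<open>e > 0\<close> by simp
    qed
    then show "\<exists>no. \<forall>n\<ge>no. norm (nrm (dual_nvs V) (sub (dual_nvs V) (f n) l) - 0) < e"
      by blast
  qed
  then show "\<exists>l\<in>pts (dual_nvs V). converges_nvs (dual_nvs V) f l"
    using lpts by blast
qed

section \<open>Inner product spaces with an explicit carrier\<close>

locale inner_nvs =
  fixes V :: "'v nvs" and ip :: "'v \<Rightarrow> 'v \<Rightarrow> real"
  assumes vs: "vector_space_nvs V"
    and bilinear: "symmetric_bilinear_nvs V (pts V) ip"
    and ip_nonneg: "x \<in> pts V \<Longrightarrow> 0 \<le> ip x x"
    and ip_definite: "x \<in> pts V \<Longrightarrow> ip x x = 0 \<Longrightarrow> x = null V"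
    and nrm_ip: "x \<in> pts V \<Longrightarrow> nrm V x = sqrt (ip x x)"
begin

lemma pts_null [simp]: "null V \<in> pts V"
  and pts_add [simp]: "x \<in> pts V \<Longrightarrow> y \<in> pts V \<Longrightarrow> add V x y \<in> pts V"
  and pts_scale [simp]: "x \<in> pts V \<Longrightarrow> scale V c x \<in> pts V"
  using vector_space_null[OF vs] vector_space_add[OF vs] vector_space_scale[OF vs] by auto

lemma pts_sub [simp]: "x \<in> pts V \<Longrightarrow> y \<in> pts V \<Longrightarrow> sub V x y \<in> pts V"
  by (simp add: sub_def)

lemma ip_commute: "x \<in> pts V \<Longrightarrow> y \<in> pts V \<Longrightarrow> ip x y = ip y x"
  using bilinear unfolding symmetric_bilinear_nvs_def by meson

lemma ip_add_left [simp]: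
  "x \<in> pts V \<Longrightarrow> y \<in> pts V \<Longrightarrow> z \<in> pts V \<Longrightarrow> ip (add V x y) z = ip x z + ip y z"
  using bilinear unfolding symmetric_bilinear_nvs_def by meson

lemma ip_scale_left [simp]:
  "x \<in> pts V \<Longrightarrow> z \<in> pts V \<Longrightarrow> ip (scale V c x) z = c * ip x z"
  using bilinear unfolding symmetric_bilinear_nvs_def by meson

lemma ip_add_right [simp]:
  "x \<in> pts V \<Longrightarrow> y \<in> pts V \<Longrightarrow> z \<in> pts V \<Longrightarrow> ip z (add V x y) = ip z x + ip z y"
  using ip_commute[of z] by simp

lemma ip_scale_right [simp]:
  "x \<in> pts V \<Longrightarrow> z \<in> pts V \<Longrightarrow> ip z (scale V c x) = c * ip z x"
  using ip_commute[of z] by simp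

lemma ip_sub_left [simp]:
  "x \<in> pts V \<Longrightarrow> y \<in> pts V \<Longrightarrow> z \<in> pts V \<Longrightarrow> ip (sub V x y) z = ip x z - ip y z"
  by (simp add: sub_def)

lemma ip_sub_right [simp]:
  "x \<in> pts V \<Longrightarrow> y \<in> pts V \<Longrightarrow> z \<in> pts V \<Longrightarrow> ip z (sub V x y) = ip z x - ip z y"
  by (simp add: sub_def)

lemma ip_null_left [simp]: "x \<in> pts V \<Longrightarrow> ip (null V) x = 0"
  using ip_scale_left[of x x 0] vector_space_scale_0[OF vs, of x] by simp

lemma ip_null_right [simp]: "x \<in> pts V \<Longrightarrow> ip x (null V) = 0"
  using ip_commute[of x "null V"] by simp

text \<open>Equations between vectors reduce to equations between real numbers by pairing both sides
  with an arbitrary vector.\<close>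

lemma vector_eqI:
  assumes x: "x \<in> pts V" and y: "y \<in> pts V" and eq: "\<And>z. z \<in> pts V \<Longrightarrow> ip x z = ip y z"
  shows "x = y"
proof -
  have "ip (sub V x y) (sub V x y) = 0"
    using eq[of "sub V x y"] x y by simp
  then have d: "sub V x y = null V" using x y by (intro ip_definite) auto
  have "x = add V x (sub V y y)"
    using vector_space_sub_self[OF vs y] vector_space_commute[OF vs x pts_null]
      vector_space_null_left[OF vs x] by simp
  also have "\<dots> = add V (sub V x y) y"
    using vector_space_assoc[OF vs x pts_scale[OF y, of "-1"] y]
      vector_space_commute[OF vs y pts_scale[OF y, of "-1"]]
    by (simp add: sub_def)
  also have "\<dots> = y" using d vector_space_null_left[OF vs y] by simp
  finally show ?thesis .
qed

lemma nrm_square [simp]: "x \<in> pts V \<Longrightarrow> (nrm V x)\<^sup>2 = ip x x"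
  by (simp add: nrm_ip ip_nonneg)

lemma nrm_nonneg [simp]: "x \<in> pts V \<Longrightarrow> 0 \<le> nrm V x"
  by (simp add: nrm_ip ip_nonneg)

lemma Cauchy_Schwarz:
  assumes x: "x \<in> pts V" and y: "y \<in> pts V"
  shows "\<bar>ip x y\<bar> \<le> nrm V x * nrm V y"
proof -
  have "(ip x y)\<^sup>2 \<le> ip x x * ip y y"
  proof (cases "ip x x = 0")
    case True
    then have "x = null V" by (rule ip_definite[OF x])
    then show ?thesis using y by simp
  next
    case False
    then have pos: "0 < ip x x" using ip_nonneg[OF x] by simp
    let ?s = "- ip x y / ip x x"
    have "0 \<le> ip (add V (scale V ?s x) y) (add V (scale V ?s x) y)"
      using x y by (intro ip_nonneg) auto
    also have "\<dots> = ip y y - (ip x y)\<^sup>2 / ip x x"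
      using x y ip_commute[OF y x] pos by (simp add: field_simps power2_eq_square)
    finally show ?thesis using pos by (simp add: field_simps)
  qed
  also have "\<dots> = (nrm V x * nrm V y)\<^sup>2" using x y by (simp add: power_mult_distrib)
  finally show ?thesis using x y by (metis abs_le_square_iff abs_of_nonneg mult_nonneg_nonneg nrm_nonneg)
qed

lemma nrm_add_le:
  assumes x: "x \<in> pts V" and y: "y \<in> pts V"
  shows "nrm V (add V x y) \<le> nrm V x + nrm V y"
proof (rule power2_le_imp_le)
  have "(nrm V (add V x y))\<^sup>2 = (nrm V x)\<^sup>2 + 2 * ip x y + (nrm V y)\<^sup>2"
    using x y ip_commute[OF y x] by simp
  also have "\<dots> \<le> (nrm V x + nrm V y)\<^sup>2"
    using Cauchy_Schwarz[OF x y] unfolding power2_sum by linarith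
  finally show "(nrm V (add V x y))\<^sup>2 \<le> (nrm V x + nrm V y)\<^sup>2" .
  show "0 \<le> nrm V x + nrm V y" using x y by simp
qed

lemma nrm_scale: "x \<in> pts V \<Longrightarrow> nrm V (scale V c x) = \<bar>c\<bar> * nrm V x"
  by (simp add: nrm_ip mult.assoc[symmetric] real_sqrt_mult real_sqrt_abs2)

lemma nrm_sub_commute: "x \<in> pts V \<Longrightarrow> y \<in> pts V \<Longrightarrow> nrm V (sub V x y) = nrm V (sub V y x)"
  by (simp add: nrm_ip)

lemma nrm_triangle_sub:
  assumes "x \<in> pts V" "y \<in> pts V" "z \<in> pts V"
  shows "nrm V (sub V x z) \<le> nrm V (sub V x y) + nrm V (sub V y z)"
proof -
  have "sub V x z = add V (sub V x y) (sub V y z)"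
    using assms by (intro vector_eqI) auto
  then show ?thesis using assms by (simp add: nrm_add_le)
qed

lemma nrm_diff_le:
  assumes "x \<in> pts V" "y \<in> pts V" "z \<in> pts V"
  shows "\<bar>nrm V (sub V x z) - nrm V (sub V y z)\<bar> \<le> nrm V (sub V x y)"
  using nrm_triangle_sub[of x y z] nrm_triangle_sub[of y x z] nrm_sub_commute[of x y] assms by simp

lemma sub_null: "x \<in> pts V \<Longrightarrow> sub V x (null V) = x"
  by (intro vector_eqI) auto

lemma normed: "normed_nvs V"
  unfolding normed_nvs_def
proof (intro conjI ballI allI vs)
  fix x assume x: "x \<in> pts V"
  show "nrm V x = 0 \<longleftrightarrow> x = null V"
    using ip_definite[OF x] x ip_nonneg[OF x] by (auto simp: nrm_ip)
qed (auto simp: nrm_scale nrm_add_le)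

lemma converges_nrm:
  assumes u: "\<And>n. u n \<in> pts V" and l: "l \<in> pts V" and c: "converges_nvs V u l" and y: "y \<in> pts V"
  shows "(\<lambda>n. nrm V (sub V (u n) y)) \<longlonglongrightarrow> nrm V (sub V l y)"
proof -
  have "(\<lambda>n. nrm V (sub V (u n) y) - nrm V (sub V l y)) \<longlonglongrightarrow> 0"
  proof (rule Lim_null_comparison)
    show "\<forall>\<^sub>F n in sequentially.
        norm (nrm V (sub V (u n) y) - nrm V (sub V l y)) \<le> nrm V (sub V (u n) l)"
      using nrm_diff_le[of "u _" l y] u l y by (intro always_eventually) simp
    show "(\<lambda>n. nrm V (sub V (u n) l)) \<longlonglongrightarrow> 0"
      using c unfolding converges_nvs_def .
  qed
  then show ?thesis by (simp add: LIM_zero_iff)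
qed

end

locale complete_inner_nvs = inner_nvs +
  assumes complete: "(\<And>n. u n \<in> pts V) \<Longrightarrow> cauchy_nvs V u \<Longrightarrow> \<exists>l\<in>pts V. converges_nvs V u l"
begin

text \<open>Minimizing sequences are Cauchy by the parallelogram law, and moving from the minimizer
  towards any other point of the convex set cannot decrease the distance to first order.\<close>

lemma closest_point:
  assumes C: "C \<subseteq> pts V" "C \<noteq> {}"
    and convex: "\<And>x y t. \<lbrakk>x \<in> C; y \<in> C; 0 \<le> t; t \<le> 1\<rbrakk> \<Longrightarrow> add V (scale V (1 - t) x) (scale V t y) \<in> C"
    and closed: "\<And>u l. \<lbrakk>\<And>n. u n \<in> C; l \<in> pts V; converges_nvs V u l\<rbrakk> \<Longrightarrow> l \<in> C"
    and x: "x \<in> pts V"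
  obtains p where "p \<in> C" "\<And>z. z \<in> C \<Longrightarrow> ip (sub V x p) (sub V z p) \<le> 0"
proof -
  define \<phi> where "\<phi> z = ip (sub V x z) (sub V x z)" for z
  define d where "d = Inf (\<phi> ` C)"
  have CV: "z \<in> pts V" if "z \<in> C" for z using C that by auto
  have bdd: "bdd_below (\<phi> ` C)"
    using CV x by (auto intro!: bdd_belowI[of _ 0] ip_nonneg simp: \<phi>_def simp del: ip_sub_left ip_sub_right)
  have d_le: "d \<le> \<phi> z" if "z \<in> C" for z
    unfolding d_def using bdd that by (intro cInf_lower) auto
  have "\<exists>z\<in>C. \<phi> z < d + 1 / real (Suc n)" for n
  proof -
    have "Inf (\<phi> ` C) < d + 1 / real (Suc n)" by (simp add: d_def)
    from cInf_lessD[OF _ this] show ?thesis using C by auto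
  qed
  then obtain u where u: "\<And>n. u n \<in> C" "\<And>n. \<phi> (u n) < d + 1 / real (Suc n)" by metis
  have par: "ip (sub V a b) (sub V a b) \<le> 2 * \<phi> a + 2 * \<phi> b - 4 * d" if a: "a \<in> C" and b: "b \<in> C" for a b
  proof -
    let ?m = "add V (scale V (1 - 1/2) a) (scale V (1/2) b)"
    have "ip (sub V a b) (sub V a b) = 2 * \<phi> a + 2 * \<phi> b - 4 * \<phi> ?m"
      using CV[OF a] CV[OF b] x ip_commute[of a b] ip_commute[of a x] ip_commute[of b x]
      by (simp add: \<phi>_def algebra_simps)
    moreover have "d \<le> \<phi> ?m" using convex[OF a b, of "1/2"] by (intro d_le) simp
    ultimately show ?thesis by linarith
  qed
  have cau: "cauchy_nvs V u"
    unfolding cauchy_nvs_def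
  proof (intro allI impI)
    fix e :: real assume e: "e > 0"
    obtain N where N: "4 / real (Suc N) < e\<^sup>2"
      using reals_Archimedean[of "e\<^sup>2/4"] e by (auto simp: field_simps)
    have "nrm V (sub V (u m) (u n)) < e" if "m \<ge> N" "n \<ge> N" for m n
    proof -
      have "1 / real (Suc m) \<le> 1 / real (Suc N)" "1 / real (Suc n) \<le> 1 / real (Suc N)"
        using that by (auto simp: field_simps)
      then have "ip (sub V (u m) (u n)) (sub V (u m) (u n)) < e\<^sup>2"
        using par[OF u(1) u(1), of m n] u(2)[of m] u(2)[of n] N by simp
      then have "(nrm V (sub V (u m) (u n)))\<^sup>2 < e\<^sup>2"
        using CV u(1) by (subst nrm_square) auto
      then show ?thesis using e by (simp add: power_less_imp_less_base)
    qed
    then show "\<exists>N. \<forall>m\<ge>N. \<forall>n\<ge>N. nrm V (sub V (u m) (u n)) < e" by blast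
  qed
  obtain p where p: "p \<in> pts V" "converges_nvs V u p"
    using complete[OF CV[OF u(1)] cau] by blast
  have pC: "p \<in> C" using closed[OF u(1) p] .
  have "(\<lambda>n. nrm V (sub V (u n) x)) \<longlonglongrightarrow> nrm V (sub V p x)"
    by (rule converges_nrm[OF CV[OF u(1)] p x])
  then have "(\<lambda>n. (nrm V (sub V (u n) x))\<^sup>2) \<longlonglongrightarrow> (nrm V (sub V p x))\<^sup>2"
    by (rule tendsto_power)
  moreover have "(nrm V (sub V z x))\<^sup>2 = \<phi> z" if "z \<in> pts V" for z
    using that x by (simp add: \<phi>_def ip_commute[of x z])
  ultimately have lim: "(\<lambda>n. \<phi> (u n)) \<longlonglongrightarrow> \<phi> p"
    using CV u(1) p(1) by simp
  have "(\<lambda>n. d + 1 / real (Suc n)) \<longlonglongrightarrow> d + 0"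
    by (intro tendsto_intros LIMSEQ_Suc[OF lim_1_over_n])
  then have pd: "\<phi> p \<le> d"
    using LIMSEQ_le[OF lim, of "\<lambda>n. d + 1 / real (Suc n)" d] u(2) less_imp_le by auto
  have "ip (sub V x p) (sub V z p) \<le> 0" if z: "z \<in> C" for z
  proof -
    let ?i = "ip (sub V x p) (sub V z p)" and ?q = "ip (sub V z p) (sub V z p)"
    have "2 * ?i \<le> t * ?q" if t: "0 < t" "t \<le> 1" for t
    proof -
      have "\<phi> p \<le> \<phi> (add V (scale V (1 - t) p) (scale V t z))"
        using pd d_le[OF convex[OF pC z, of t]] t by simp
      also have "\<dots> = \<phi> p + t * (t * ?q - 2 * ?i)"
        using CV[OF z] p x ip_commute[of p z] ip_commute[of p x] ip_commute[of z x]
        by (simp add: \<phi>_def algebra_simps)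
      finally have "0 \<le> t * (t * ?q - 2 * ?i)" by simp
      then show ?thesis using t by (simp add: zero_le_mult_iff)
    qed
    then have "\<forall>\<^sub>F t in at_right 0. 2 * ?i \<le> t * ?q"
      unfolding eventually_at_right_field by (intro exI[of _ 1]) auto
    moreover have "((\<lambda>t. t * ?q) \<longlongrightarrow> 0 * ?q) (at_right 0)"
      by (intro tendsto_intros)
    ultimately have "2 * ?i \<le> 0 * ?q"
      by (intro tendsto_lowerbound) auto
    then show ?thesis by simp
  qed
  with pC show ?thesis by (rule that)
qed

text \<open>If \<open>F\<close> is not zero, then the point of \<open>{F = 1}\<close> closest to the origin is orthogonal to the
  kernel of \<open>F\<close>.\<close>

lemma Riesz:
  assumes add: "\<And>x y. x \<in> pts V \<Longrightarrow> y \<in> pts V \<Longrightarrow> F (add V x y) = F x + F y"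
    and scale: "\<And>c x. x \<in> pts V \<Longrightarrow> F (scale V c x) = c * F x"
    and bound: "\<And>x. x \<in> pts V \<Longrightarrow> \<bar>F x\<bar> \<le> c * nrm V x"
  obtains u where "u \<in> pts V" "\<And>x. x \<in> pts V \<Longrightarrow> F x = ip u x"
proof (cases "\<exists>x\<in>pts V. F x \<noteq> 0")
  case False
  then show ?thesis using that[of "null V"] by auto
next
  case True
  then obtain a where a: "a \<in> pts V" "F a \<noteq> 0" by blast
  have Fsub: "F (sub V x y) = F x - F y" if "x \<in> pts V" "y \<in> pts V" for x y
    using that by (simp add: sub_def add scale)
  define C where "C = {x \<in> pts V. F x = 1}"
  obtain p where p: "p \<in> C" and min: "\<And>z. z \<in> C \<Longrightarrow> ip (sub V (null V) p) (sub V z p) \<le> 0"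
  proof (rule closest_point[of C "null V"])
    show "C \<subseteq> pts V" by (auto simp: C_def)
    show "C \<noteq> {}" using a by (auto simp: C_def scale intro!: exI[of _ "scale V (1 / F a) a"])
    show "add V (scale V (1 - t) x) (scale V t y) \<in> C" if "x \<in> C" "y \<in> C" for x y t
      using that by (auto simp: C_def add scale)
    show "l \<in> C" if u: "\<And>n. u n \<in> C" and l: "l \<in> pts V" and lim: "converges_nvs V u l" for u l
    proof -
      have "(\<lambda>n. c * nrm V (sub V (u n) l)) \<longlonglongrightarrow> 0"
        using lim unfolding converges_nvs_def by (rule tendsto_mult_right_zero)
      moreover have "\<bar>1 - F l\<bar> \<le> c * nrm V (sub V (u n) l)" for n
        using u[of n] l bound[of "sub V (u n) l"] by (simp add: C_def Fsub)
      ultimately have "\<bar>1 - F l\<bar> \<le> 0"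
        by (intro LIMSEQ_le_const) auto
      then show ?thesis using l by (simp add: C_def)
    qed
  qed auto
  then have pV: "p \<in> pts V" and Fp: "F p = 1" by (auto simp: C_def)
  have orth: "ip p k = 0" if k: "k \<in> pts V" "F k = 0" for k
  proof -
    have "0 \<le> s * ip p k" for s
    proof -
      have "add V p (scale V s k) \<in> C" using k pV Fp by (simp add: C_def add scale)
      from min[OF this] show ?thesis using pV k by simp
    qed
    from this[of 1] this[of "-1"] show ?thesis by simp
  qed
  have pp: "ip p p \<noteq> 0"
  proof
    assume "ip p p = 0"
    then have "p = null V" by (rule ip_definite[OF pV])
    then have "p = scale V 0 p" using vector_space_scale_0[OF vs pV] by simp
    then show False using Fp scale[OF pV, of 0] by simp
  qed
  show ?thesis
  proof (rule that[of "scale V (1 / ip p p) p"])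
    show "scale V (1 / ip p p) p \<in> pts V" using pV by simp
    fix x assume x: "x \<in> pts V"
    have "ip p (sub V x (scale V (F x) p)) = 0"
      using x pV Fp by (intro orth) (auto simp: Fsub scale)
    then have "ip p x = F x * ip p p" using x pV by simp
    then show "F x = ip (scale V (1 / ip p p) p) x"
      using x pV pp by simp
  qed
qed

end

section \<open>Norms with closed balls in a Hilbert space\<close>

text \<open>A norm on a subspace of a Hilbert space that dominates the ambient norm and is lower semicontinuous
  for it. Closed balls are then convex, bounded and closed in the ambient space, hence weakly compact;
  this compactness is behind the existence of a predual, and closest points in the balls give it directly.\<close>

locale closed_ball_norm = complete_inner_nvs V ip for V :: "'v nvs" and ip +
  fixes D :: "'v set" and p :: "'v \<Rightarrow> real"
  assumes subspace: "subspace_nvs V D"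
    and p_scale: "x \<in> D \<Longrightarrow> p (scale V c x) = \<bar>c\<bar> * p x"
    and p_add: "x \<in> D \<Longrightarrow> y \<in> D \<Longrightarrow> p (add V x y) \<le> p x + p y"
    and p_dominates: "x \<in> D \<Longrightarrow> nrm V x \<le> p x"
    and closed_ball: "\<lbrakk>\<And>n. u n \<in> D; \<And>n. p (u n) \<le> c; l \<in> pts V; converges_nvs V u l\<rbrakk>
      \<Longrightarrow> l \<in> D \<and> p l \<le> c"
begin

abbreviation W :: "'v nvs" where "W \<equiv> V\<lparr>pts := D, nrm := p\<rparr>"

lemma D_pts: "x \<in> D \<Longrightarrow> x \<in> pts V"
  and D_null: "null V \<in> D"
  and D_add: "x \<in> D \<Longrightarrow> y \<in> D \<Longrightarrow> add V x y \<in> D"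
  and D_scale: "x \<in> D \<Longrightarrow> scale V c x \<in> D"
  using subspace unfolding subspace_nvs_def by auto

lemma D_sub: "x \<in> D \<Longrightarrow> y \<in> D \<Longrightarrow> sub V x y \<in> D"
  unfolding sub_def by (intro D_add D_scale)

lemma p_nonneg: "x \<in> D \<Longrightarrow> 0 \<le> p x"
  using p_dominates[of x] nrm_nonneg[OF D_pts[of x]] by linarith

lemma p_null: "p (null V) = 0"
  using p_scale[OF D_null, of 0] vector_space_scale_0[OF vs, of "null V"] by simp

lemma W_normed: "normed_nvs W"
  unfolding normed_nvs_def
proof (intro conjI)
  show "vector_space_nvs W"
    using vector_space_subspace[OF vs subspace] by simp
  show "\<forall>x\<in>pts W. 0 \<le> nrm W x" using p_nonneg by simp
  show "\<forall>x\<in>pts W. (nrm W x = 0) = (x = null W)"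
  proof
    fix x assume "x \<in> pts W"
    then have x: "x \<in> D" by simp
    have "x = null V" if "p x = 0"
    proof -
      have "nrm V x = 0" using p_dominates[OF x] that nrm_nonneg[OF D_pts[OF x]] by simp
      then show ?thesis using normed_zero[OF normed D_pts[OF x]] by simp
    qed
    then show "(nrm W x = 0) = (x = null W)" using p_null by auto
  qed
qed (auto simp: p_scale p_add)

text \<open>An \<open>p\<close>-Cauchy sequence converges in the ambient space, and the limit of its tails stays in
  the small \<open>p\<close>-balls in which the differences lie.\<close>

lemma W_banach: "banach_nvs W"
  unfolding banach_nvs_def
proof (intro conjI allI impI W_normed)
  fix u assume "(\<forall>n. u n \<in> pts W) \<and> cauchy_nvs W u"
  then have u: "\<And>n. u n \<in> D"
    and cau: "\<forall>e>0. \<exists>N. \<forall>m\<ge>N. \<forall>n\<ge>N. p (sub V (u m) (u n)) < e"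
    by (auto simp: cauchy_nvs_def)
  have uV: "u n \<in> pts V" for n using u by (rule D_pts)
  have "cauchy_nvs V u"
    unfolding cauchy_nvs_def
  proof (intro allI impI)
    fix e :: real assume "e > 0"
    then obtain N where "\<And>m n. m \<ge> N \<Longrightarrow> n \<ge> N \<Longrightarrow> p (sub V (u m) (u n)) < e"
      using cau by blast
    then show "\<exists>N. \<forall>m\<ge>N. \<forall>n\<ge>N. nrm V (sub V (u m) (u n)) < e"
      using p_dominates[OF D_sub[OF u u]] le_less_trans by blast
  qed
  then obtain l where l: "l \<in> pts V" "converges_nvs V u l"
    using complete[of u] uV by blast
  have tail: "\<exists>N. \<forall>m\<ge>N. sub V (u m) l \<in> D \<and> p (sub V (u m) l) \<le> e" if "e > 0" for e
  proof -
    obtain N where N: "\<And>m n. m \<ge> N \<Longrightarrow> n \<ge> N \<Longrightarrow> p (sub V (u m) (u n)) < e"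
      using cau \<open>e > 0\<close> by blast
    have "sub V (u m) l \<in> D \<and> p (sub V (u m) l) \<le> e" if m: "m \<ge> N" for m
    proof (rule closed_ball)
      show "sub V (u m) (u (n + N)) \<in> D" for n using u by (intro D_sub)
      show "p (sub V (u m) (u (n + N))) \<le> e" for n using N[OF m, of "n + N"] by simp
      show "sub V (u m) l \<in> pts V" using uV l by simp
      have "sub V (sub V (u m) (u n)) (sub V (u m) l) = sub V l (u n)" for n
        using uV l by (intro vector_eqI) auto
      then have "nrm V (sub V (sub V (u m) (u n)) (sub V (u m) l)) = nrm V (sub V (u n) l)" for n
        using uV l nrm_sub_commute[of l "u n"] by simp
      then have "converges_nvs V (\<lambda>n. sub V (u m) (u n)) (sub V (u m) l)"
        using l by (simp add: converges_nvs_def)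
      then show "converges_nvs V (\<lambda>n. sub V (u m) (u (n + N))) (sub V (u m) l)"
        unfolding converges_nvs_def by (rule LIMSEQ_ignore_initial_segment)
    qed
    then show ?thesis by blast
  qed
  obtain N where N: "sub V (u N) l \<in> D" using tail[of 1] by auto
  have "l = sub V (u N) (sub V (u N) l)" using uV l by (intro vector_eqI) auto
  then have lD: "l \<in> D" using D_sub[OF u N, of N] by simp
  have "converges_nvs W u l"
    unfolding converges_nvs_def
  proof (rule LIMSEQ_I)
    fix e :: real assume "e > 0"
    then obtain N where "\<forall>m\<ge>N. sub V (u m) l \<in> D \<and> p (sub V (u m) l) \<le> e/2"
      using tail[of "e/2"] by auto
    then show "\<exists>N. \<forall>n\<ge>N. norm (nrm W (sub W (u n) l) - 0) < e"
      using \<open>e > 0\<close> p_nonneg by (intro exI[of _ N]) force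
  qed
  then show "\<exists>l\<in>pts W. converges_nvs W u l" using lD by auto
qed

definition functional :: "'v \<Rightarrow> 'v \<Rightarrow> real" where
  "functional y = (\<lambda>x. if x \<in> D then ip y x else 0)"

text \<open>A norm limit of the functionals \<open>functional y\<close> is a uniform limit on each ball of \<open>W\<close>, so it is weakly
  continuous there. The dual of \<open>W\<close> itself is in general too large for its dual to be \<open>W\<close> again.\<close>

definition predual :: "('v \<Rightarrow> real) nvs" where
  "predual = (dual_nvs W)\<lparr>pts := {f \<in> pts (dual_nvs W).
     \<forall>e>0. \<exists>y\<in>pts V. nrm (dual_nvs W) (sub (dual_nvs W) f (functional y)) \<le> e}\<rparr>"

lemma functional_dual:
  assumes y: "y \<in> pts V"
  shows "functional y \<in> pts (dual_nvs W)" and "nrm (dual_nvs W) (functional y) \<le> nrm V y"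
proof -
  have b: "\<bar>functional y x\<bar> \<le> nrm V y * p x" if "x \<in> D" for x
    using Cauchy_Schwarz[OF y D_pts[OF that]] mult_left_mono[OF p_dominates[OF that] nrm_nonneg[OF y]]
      that by (simp add: functional_def)
  show "functional y \<in> pts (dual_nvs W)"
    unfolding dual_pts
  proof (intro conjI allI ballI impI)
    show "\<exists>C. \<forall>x\<in>pts W. \<bar>functional y x\<bar> \<le> C * nrm W x"
      using b by (intro exI[of _ "nrm V y"]) simp
  qed (auto simp: functional_def D_pts D_add D_scale y)
  show "nrm (dual_nvs W) (functional y) \<le> nrm V y"
    by (rule dual_norm_le[OF W_normed]) (use b y in auto)
qed

lemma functional_add:
  "x \<in> pts V \<Longrightarrow> y \<in> pts V \<Longrightarrow> functional (add V x y) = (\<lambda>z. functional x z + functional y z)"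
  by (auto simp: functional_def D_pts)

lemma functional_scale:
  "x \<in> pts V \<Longrightarrow> functional (scale V c x) = (\<lambda>z. c * functional x z)"
  by (auto simp: functional_def D_pts)

lemma functional_predual: "y \<in> pts V \<Longrightarrow> functional y \<in> pts predual"
proof -
  assume y: "y \<in> pts V"
  have "nrm (dual_nvs W) (\<lambda>x. 0) = 0"
    using normed_zero[OF dual_normed[OF W_normed], of "\<lambda>x. 0"]
      vector_space_null[OF normed_vector_space[OF dual_normed[OF W_normed]]] by simp
  then show ?thesis
    using functional_dual(1)[OF y] y by (auto simp: predual_def intro!: bexI[of _ y])
qed

lemma predual_simps [simp]:
  "add predual = (\<lambda>f g x. f x + g x)" "null predual = (\<lambda>x. 0)"
  "scale predual = (\<lambda>c f x. c * f x)" "nrm predual = nrm (dual_nvs W)"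
  "sub predual f g = (\<lambda>x. f x - g x)"
  by (simp_all add: predual_def)

lemma predual_dual: "f \<in> pts predual \<Longrightarrow> f \<in> pts (dual_nvs W)"
  by (simp add: predual_def)

lemma predual_approx:
  assumes "f \<in> pts predual" "e > 0"
  obtains y where "y \<in> pts V" "nrm (dual_nvs W) (\<lambda>x. f x - functional y x) \<le> e"
  using assms by (auto simp: predual_def)

lemma predual_banach: "banach_nvs predual"
  unfolding predual_def
proof (rule banach_closed_subspace[OF dual_banach[OF W_normed]])
  let ?S = "{f \<in> pts (dual_nvs W).
     \<forall>e>0. \<exists>y\<in>pts V. nrm (dual_nvs W) (sub (dual_nvs W) f (functional y)) \<le> e}"
  note N = dual_normed[OF W_normed]
  note VS = normed_vector_space[OF N]
  have sub_in: "(\<lambda>x. f x - g x) \<in> pts (dual_nvs W)"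
    if "f \<in> pts (dual_nvs W)" "g \<in> pts (dual_nvs W)" for f g
    using normed_nrm_sub(2)[OF N that] by simp
  have add_in: "(\<lambda>x. f x + g x) \<in> pts (dual_nvs W)"
    if "f \<in> pts (dual_nvs W)" "g \<in> pts (dual_nvs W)" for f g
    using vector_space_add[OF VS that] by simp
  have tri: "nrm (dual_nvs W) (\<lambda>x. f x + g x) \<le> nrm (dual_nvs W) f + nrm (dual_nvs W) g"
    if "f \<in> pts (dual_nvs W)" "g \<in> pts (dual_nvs W)" for f g
    using normed_add[OF N that] by simp
  show "subspace_nvs (dual_nvs W) ?S"
    unfolding subspace_nvs_def
  proof (intro conjI ballI allI)
    show "null (dual_nvs W) \<in> ?S"
      using functional_predual[of "null V"] vector_space_null[OF VS]
      by (auto simp: predual_def functional_def D_pts if_distrib cong: if_cong)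
  next
    fix f g assume f: "f \<in> ?S" and g: "g \<in> ?S"
    have "\<exists>y\<in>pts V. nrm (dual_nvs W) (\<lambda>x. f x + g x - functional y x) \<le> e" if "e > 0" for e
    proof -
      obtain a where a: "a \<in> pts V" "nrm (dual_nvs W) (\<lambda>x. f x - functional a x) \<le> e/2"
        using f \<open>e > 0\<close> by (auto dest!: spec[of _ "e/2"])
      obtain b where b: "b \<in> pts V" "nrm (dual_nvs W) (\<lambda>x. g x - functional b x) \<le> e/2"
        using g \<open>e > 0\<close> by (auto dest!: spec[of _ "e/2"])
      have "(\<lambda>x. f x + g x - functional (add V a b) x) =
          (\<lambda>x. (f x - functional a x) + (g x - functional b x))"
        using a b by (auto simp: functional_add)
      then have "nrm (dual_nvs W) (\<lambda>x. f x + g x - functional (add V a b) x) \<le> e"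
        using tri[OF sub_in sub_in, of f "functional a" g "functional b"] f g a b functional_dual(1)
        by simp
      then show ?thesis using a b by (intro bexI[of _ "add V a b"]) auto
    qed
    then show "add (dual_nvs W) f g \<in> ?S" using f g add_in by simp
  next
    fix c f assume f: "f \<in> ?S"
    have "\<exists>y\<in>pts V. nrm (dual_nvs W) (\<lambda>x. c * f x - functional y x) \<le> e" if "e > 0" for e
    proof -
      have "e / (\<bar>c\<bar> + 1) > 0" using that by simp
      then obtain a where a: "a \<in> pts V"
        "nrm (dual_nvs W) (\<lambda>x. f x - functional a x) \<le> e / (\<bar>c\<bar> + 1)"
        using f by auto
      have "(\<lambda>x. c * f x - functional (scale V c a) x) =
          scale (dual_nvs W) c (\<lambda>x. f x - functional a x)"
        using a by (auto simp: functional_scale algebra_simps)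
      then have "nrm (dual_nvs W) (\<lambda>x. c * f x - functional (scale V c a) x) =
          \<bar>c\<bar> * nrm (dual_nvs W) (\<lambda>x. f x - functional a x)"
        using normed_scale[OF N sub_in[of f "functional a"], of c] f functional_dual(1)[OF a(1)] by simp
      also have "\<dots> \<le> (\<bar>c\<bar> + 1) * (e / (\<bar>c\<bar> + 1))"
        using a(2) dual_norm_nonneg[OF W_normed sub_in[of f "functional a"]] f functional_dual(1)[OF a(1)]
        by (intro mult_mono) auto
      also have "\<dots> = e" by simp
      finally show ?thesis using a by (intro bexI[of _ "scale V c a"]) auto
    qed
    moreover have "(\<lambda>x. c * f x) \<in> pts (dual_nvs W)"
      using vector_space_scale[OF VS, of f c] f by simp
    ultimately show "scale (dual_nvs W) c f \<in> ?S" by simp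
  qed auto
  fix f l assume f: "\<And>n. f n \<in> ?S" and l: "l \<in> pts (dual_nvs W)" and lim: "converges_nvs (dual_nvs W) f l"
  have "\<exists>y\<in>pts V. nrm (dual_nvs W) (\<lambda>x. l x - functional y x) \<le> e" if "e > 0" for e
  proof -
    obtain n where n: "nrm (dual_nvs W) (\<lambda>x. f n x - l x) < e/2"
      using order_tendstoD(2)[OF lim[unfolded converges_nvs_def], of "e/2"] \<open>e > 0\<close>
      by (auto simp: eventually_sequentially)
    obtain a where a: "a \<in> pts V" "nrm (dual_nvs W) (\<lambda>x. f n x - functional a x) \<le> e/2"
      using f[of n] \<open>e > 0\<close> by (auto dest!: spec[of _ "e/2"])
    have fn: "f n \<in> pts (dual_nvs W)" using f by simp
    have "(\<lambda>x. l x - functional a x) =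
        (\<lambda>x. (f n x - functional a x) - (f n x - l x))" by auto
    then have "nrm (dual_nvs W) (\<lambda>x. l x - functional a x) \<le> e"
      using normed_nrm_sub(1)[OF N sub_in[OF fn functional_dual(1)[OF a(1)]] sub_in[OF fn l]] a n by simp
    then show ?thesis using a by blast
  qed
  then show "l \<in> ?S" using l by simp
qed

definition evaluation :: "'v \<Rightarrow> ('v \<Rightarrow> real) \<Rightarrow> real" where
  "evaluation x = (\<lambda>f. if f \<in> pts predual then f x else 0)"

lemma evaluation_dual:
  assumes x: "x \<in> D"
  shows "evaluation x \<in> pts (dual_nvs predual)" and "nrm (dual_nvs predual) (evaluation x) \<le> p x"
proof -
  note PN = predual_banach[unfolded banach_nvs_def, THEN conjunct1]
  have b: "\<bar>evaluation x f\<bar> \<le> p x * nrm predual f" if "f \<in> pts predual" for f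
    using dual_bound[OF W_normed predual_dual[OF that], of x] x that
    by (simp add: evaluation_def mult.commute)
  show "evaluation x \<in> pts (dual_nvs predual)"
    unfolding dual_pts
  proof (intro conjI allI ballI impI)
    show "\<exists>C. \<forall>f\<in>pts predual. \<bar>evaluation x f\<bar> \<le> C * nrm predual f"
      using b by blast
  qed (use vector_space_add[OF normed_vector_space[OF PN]]
         vector_space_scale[OF normed_vector_space[OF PN]] in \<open>auto simp: evaluation_def\<close>)
  show "nrm (dual_nvs predual) (evaluation x) \<le> p x"
    by (rule dual_norm_le[OF PN]) (use b p_nonneg[OF x] in auto)
qed

text \<open>A bounded functional on the predual restricts to a bounded functional on the Hilbert space,
  which is represented by a vector. That vector lies in the ball of \<open>W\<close> whose radius is the norm of
  the functional, since otherwise a hyperplane would separate it from this closed convex ball.\<close>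

lemma evaluation_onto:
  assumes F: "F \<in> pts (dual_nvs predual)"
  obtains x where "x \<in> D" "p x \<le> nrm (dual_nvs predual) F" "F = evaluation x"
proof -
  note PN = predual_banach[unfolded banach_nvs_def, THEN conjunct1]
  define c where "c = nrm (dual_nvs predual) F"
  have c0: "0 \<le> c" unfolding c_def by (rule dual_norm_nonneg[OF PN F])
  have Fb: "\<bar>F f\<bar> \<le> c * nrm (dual_nvs W) f" if "f \<in> pts predual" for f
    using dual_bound[OF PN F that] by (simp add: c_def)
  have Fadd: "F (\<lambda>x. f x + g x) = F f + F g" if "f \<in> pts predual" "g \<in> pts predual" for f g
    using F that by (simp add: dual_pts)
  have Fscale: "F (\<lambda>x. a * f x) = a * F f" if "f \<in> pts predual" for f a
    using F that by (simp add: dual_pts)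
  obtain x where x: "x \<in> pts V" and Fx: "\<And>y. y \<in> pts V \<Longrightarrow> F (functional y) = ip x y"
  proof (rule Riesz[of "\<lambda>y. F (functional y)" c])
    show "\<bar>F (functional y)\<bar> \<le> c * nrm V y" if "y \<in> pts V" for y
      using Fb[OF functional_predual[OF that]] mult_left_mono[OF functional_dual(2)[OF that] c0]
      by simp
  qed (auto simp: functional_add functional_scale Fadd Fscale functional_predual)
  define B where "B = {z \<in> D. p z \<le> c}"
  have "x \<in> B"
  proof -
    obtain q where q: "q \<in> B" and sep: "\<And>z. z \<in> B \<Longrightarrow> ip (sub V x q) (sub V z q) \<le> 0"
    proof (rule closest_point[of B x])
      show "B \<subseteq> pts V" using D_pts by (auto simp: B_def)
      show "B \<noteq> {}" using D_null p_null c0 by (auto simp: B_def)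
      show "add V (scale V (1 - t) a) (scale V t b) \<in> B"
        if "a \<in> B" "b \<in> B" "0 \<le> t" "t \<le> 1" for a b t
      proof -
        have "p (add V (scale V (1 - t) a) (scale V t b)) \<le> (1 - t) * p a + t * p b"
          using that p_add[of "scale V (1 - t) a" "scale V t b"]
          by (simp add: B_def p_scale D_scale)
        also have "\<dots> \<le> (1 - t) * c + t * c"
          using that by (intro add_mono mult_left_mono) (auto simp: B_def)
        finally show ?thesis using that by (simp add: B_def D_add D_scale algebra_simps)
      qed
      show "l \<in> B" if "\<And>n. u n \<in> B" "l \<in> pts V" "converges_nvs V u l" for u l
        using closed_ball[of u c l] that by (simp add: B_def)
    qed (use x in auto)
    have qD: "q \<in> D" and qV: "q \<in> pts V" using q D_pts by (auto simp: B_def)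
    define y where "y = sub V x q"
    have y: "y \<in> pts V" using x qV by (simp add: y_def)
    \<comment> \<open>The hyperplane orthogonal to \<open>y\<close> through \<open>q\<close> supports \<open>B\<close>, so \<open>c \<parallel>functional y\<parallel> \<le> ip y q\<close>.\<close>
    have sup: "ip y z \<le> ip y q" if "z \<in> B" for z
      using sep[OF that] that qV D_pts y by (simp add: y_def[symmetric] B_def)
    have le: "c * \<bar>functional y z\<bar> \<le> ip y q" if "z \<in> D" "p z \<le> 1" for z
    proof -
      have "scale V c z \<in> B" "scale V (-c) z \<in> B"
        using that c0 mult_left_mono[OF that(2) c0] by (auto simp: B_def D_scale p_scale)
      from this[THEN sup] show ?thesis
        using that c0 y D_pts by (auto simp: functional_def abs_if)
    qed
    have q0: "0 \<le> ip y q" using le[OF D_null] p_null c0 by (simp add: functional_def D_null y)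
    have "c * nrm (dual_nvs W) (functional y) \<le> ip y q"
    proof (cases "c = 0")
      case True
      then show ?thesis using q0 by simp
    next
      case False
      then have "c > 0" using c0 by simp
      have "nrm (dual_nvs W) (functional y) \<le> ip y q / c"
        unfolding dual_nvs_def nvs.simps
      proof (rule cSUP_least)
        show "{z \<in> pts W. nrm W z \<le> 1} \<noteq> {}" using D_null p_null by auto
        show "\<bar>functional y z\<bar> \<le> ip y q / c" if "z \<in> {z \<in> pts W. nrm W z \<le> 1}" for z
          using le[of z] that \<open>c > 0\<close> by (simp add: field_simps)
      qed
      then show ?thesis using \<open>c > 0\<close> by (simp add: field_simps)
    qed
    moreover have "ip x y \<le> c * nrm (dual_nvs W) (functional y)"
      using Fb[OF functional_predual[OF y]] Fx[OF y] by simp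
    ultimately have "ip x y \<le> ip y q" by simp
    moreover have "ip x y = ip y q + ip y y"
      using x qV ip_commute[OF x qV] by (simp add: y_def)
    ultimately have "ip y y = 0" using ip_nonneg[OF y] by simp
    then have "sub V x q = null V" using ip_definite[OF y] by (simp add: y_def)
    then have "x = q"
      using vector_eqI[OF x qV] ip_sub_left[OF x qV] ip_null_left
      by (metis eq_iff_diff_eq_0)
    then show ?thesis using q by simp
  qed
  then have xD: "x \<in> D" and px: "p x \<le> c" by (auto simp: B_def)
  \<comment> \<open>Both sides are continuous in \<open>f\<close> and agree on the dense set of all \<open>functional y\<close>.\<close>
  have "F f = f x" if f: "f \<in> pts predual" for f
  proof -
    have "\<bar>F f - f x\<bar> \<le> (c + p x) * e" if "e > 0" for e
    proof -
      obtain y where y: "y \<in> pts V" and e: "nrm (dual_nvs W) (\<lambda>x. f x - functional y x) \<le> e"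
        using predual_approx[OF f \<open>e > 0\<close>] by blast
      let ?g = "\<lambda>x. f x - functional y x"
      have g: "?g \<in> pts predual"
        using normed_nrm_sub(2)[OF PN f functional_predual[OF y]] by simp
      have "F f = F (\<lambda>x. ?g x + functional y x)" by simp
      also have "\<dots> = F ?g + ip x y"
        using Fadd[OF g functional_predual[OF y]] Fx[OF y] by simp
      finally have "F f - f x = F ?g - ?g x"
        using xD x y ip_commute[OF x y] by (simp add: functional_def)
      moreover have "\<bar>F ?g\<bar> \<le> c * e"
        using Fb[OF g] mult_left_mono[OF e c0] by simp
      moreover have "\<bar>?g x\<bar> \<le> e * p x"
        using dual_bound[OF W_normed predual_dual[OF g], of x] xD
          mult_right_mono[OF e p_nonneg[OF xD]] by simp
      ultimately show ?thesis by (simp add: algebra_simps)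
    qed
    then have "\<forall>\<^sub>F e in at_right 0. \<bar>F f - f x\<bar> \<le> (c + p x) * e"
      unfolding eventually_at_right_field by (intro exI[of _ 1]) auto
    moreover have "((\<lambda>e. (c + p x) * e) \<longlongrightarrow> (c + p x) * 0) (at_right 0)"
      by (intro tendsto_intros)
    ultimately have "\<bar>F f - f x\<bar> \<le> (c + p x) * 0"
      by (intro tendsto_lowerbound) auto
    then show ?thesis by simp
  qed
  moreover have "F f = 0" if "f \<notin> pts predual" for f using F that by (simp add: dual_pts)
  ultimately have "F = evaluation x" by (auto simp: evaluation_def)
  then show ?thesis using that xD px by (simp add: c_def)
qed

lemma evaluation_inj:
  assumes x: "x \<in> D" and y: "y \<in> D" and eq: "evaluation x = evaluation y"
  shows "x = y"
proof (rule vector_eqI[OF D_pts[OF x] D_pts[OF y]])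
  fix z assume z: "z \<in> pts V"
  have "functional z x = functional z y"
    using fun_cong[OF eq, of "functional z"] functional_predual[OF z] by (simp add: evaluation_def)
  then show "ip x z = ip y z"
    using x y z D_pts ip_commute[of z x] ip_commute[of z y] by (simp add: functional_def)
qed

theorem W_dual_space: "is_dual_space_nvs W"
  unfolding is_dual_space_nvs_def
proof (intro exI[of _ predual] exI[of _ evaluation] conjI predual_banach)
  show "isometric_iso_nvs W (dual_nvs predual) evaluation"
    unfolding isometric_iso_nvs_def
  proof (intro conjI ballI allI)
    have "evaluation ` D = pts (dual_nvs predual)"
      using evaluation_dual(1) evaluation_onto by blast
    then show "bij_betw evaluation (pts W) (pts (dual_nvs predual))"
      using evaluation_inj by (auto simp: bij_betw_def inj_on_def)
  next
    fix x y assume "x \<in> pts W" "y \<in> pts W"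
    then have "f (add V x y) = f x + f y" if "f \<in> pts predual" for f
      using predual_dual[OF that] by (simp add: dual_pts)
    then show "evaluation (add W x y) = add (dual_nvs predual) (evaluation x) (evaluation y)"
      by (auto simp: evaluation_def)
  next
    fix c x assume "x \<in> pts W"
    then have "f (scale V c x) = c * f x" if "f \<in> pts predual" for f
      using predual_dual[OF that] by (simp add: dual_pts)
    then show "evaluation (scale W c x) = scale (dual_nvs predual) c (evaluation x)"
      by (auto simp: evaluation_def)
  next
    fix x assume "x \<in> pts W"
    then have x: "x \<in> D" by simp
    obtain y where y: "y \<in> D" "p y \<le> nrm (dual_nvs predual) (evaluation x)" "evaluation x = evaluation y"
      using evaluation_onto[OF evaluation_dual(1)[OF x]] by blast
    then have "y = x" using evaluation_inj[OF x y(1)] by simp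
    then show "nrm (dual_nvs predual) (evaluation x) = nrm W x"
      using y(2) evaluation_dual(2)[OF x] by simp
  qed
qed

end

section \<open>The Hilbert space of square-integrable functions\<close>

lemma sqi_measurable [measurable_dest]: "f \<in> square_integrable M \<Longrightarrow> f \<in> borel_measurable M"
  by (simp add: square_integrable_def)

lemma sqi_dominated:
  assumes f: "f \<in> square_integrable M" and g: "g \<in> borel_measurable M"
    and le: "AE x in M. \<bar>g x\<bar> \<le> \<bar>f x\<bar>"
  shows "g \<in> square_integrable M"
proof -
  have "integrable M (\<lambda>x. (g x)\<^sup>2)"
  proof (rule Bochner_Integration.integrable_bound)
    show "integrable M (\<lambda>x. (f x)\<^sup>2)" using f by (simp add: square_integrable_def)
    show "AE x in M. norm ((g x)\<^sup>2) \<le> norm ((f x)\<^sup>2)"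
      using le by eventually_elim (simp add: abs_le_square_iff)
  qed (use g in measurable)
  then show ?thesis using g by (simp add: square_integrable_def)
qed

lemma sqi_integrable_mult:
  assumes f: "f \<in> square_integrable M" and g: "g \<in> square_integrable M"
  shows "integrable M (\<lambda>x. f x * g x)"
proof (rule Bochner_Integration.integrable_bound)
  show "integrable M (\<lambda>x. (f x)\<^sup>2 + (g x)\<^sup>2)"
    using f g by (simp add: square_integrable_def)
  have "\<bar>a * b\<bar> \<le> a\<^sup>2 + b\<^sup>2" for a b :: real
  proof -
    have "2 * (\<bar>a\<bar> * \<bar>b\<bar>) \<le> a\<^sup>2 + b\<^sup>2"
      using sum_squares_bound[of "\<bar>a\<bar>" "\<bar>b\<bar>"] by simp
    moreover have "0 \<le> \<bar>a\<bar> * \<bar>b\<bar>" by simp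
    ultimately show ?thesis unfolding abs_mult by linarith
  qed
  then show "AE x in M. norm (f x * g x) \<le> norm ((f x)\<^sup>2 + (g x)\<^sup>2)"
    by (intro AE_I2) (simp del: abs_mult)
qed (use f g in measurable)

lemma sqi_add:
  assumes f: "f \<in> square_integrable M" and g: "g \<in> square_integrable M"
  shows "(\<lambda>x. f x + g x) \<in> square_integrable M"
proof -
  have "integrable M (\<lambda>x. (f x)\<^sup>2 + (g x)\<^sup>2 + 2 * (f x * g x))"
    using f g sqi_integrable_mult[OF f g] by (simp add: square_integrable_def)
  moreover have "(f x)\<^sup>2 + (g x)\<^sup>2 + 2 * (f x * g x) = (f x + g x)\<^sup>2" for x
    by (simp add: power2_eq_square algebra_simps)
  ultimately show ?thesis using f g by (auto simp: square_integrable_def)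
qed

lemma sqi_scale: "f \<in> square_integrable M \<Longrightarrow> (\<lambda>x. c * f x) \<in> square_integrable M"
  by (auto simp: square_integrable_def power_mult_distrib)

lemma sqi_zero [simp]: "(\<lambda>x. 0) \<in> square_integrable M"
  by (simp add: square_integrable_def)

lemma sqi_diff:
  "f \<in> square_integrable M \<Longrightarrow> g \<in> square_integrable M \<Longrightarrow> (\<lambda>x. f x - g x) \<in> square_integrable M"
  using sqi_add[of f M "\<lambda>x. -1 * g x"] sqi_scale[of g M "-1"] by simp

lemma sqi_max_min:
  assumes f: "f \<in> square_integrable M"
  shows "(\<lambda>x. max (f x) 0) \<in> square_integrable M"
    and "c \<ge> 0 \<Longrightarrow> (\<lambda>x. min (f x) c) \<in> square_integrable M"
  using f by (auto intro!: sqi_dominated[OF f] AE_I2)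

lemma L2_class_in [simp]: "f \<in> square_integrable M \<Longrightarrow> L2_class M f \<in> L2 M"
  by (simp add: L2_def)

lemma L2_cases:
  assumes "u \<in> L2 M"
  obtains f where "f \<in> square_integrable M" "u = L2_class M f"
  using assms by (auto simp: L2_def)

lemma L2_class_cong:
  assumes "AE x in M. f x = g x"
  shows "L2_class M f = L2_class M g"
  unfolding L2_class_def using assms by (auto elim: eventually_elim2)

lemma L2_space_simps [simp]:
  "pts (L2_space M) = L2 M" "null (L2_space M) = L2_class M (\<lambda>x. 0)"
  "nrm (L2_space M) u = sqrt (L2_inner M u u)"
  by (simp_all add: L2_space_def)

lemma add_class:
  assumes "f \<in> square_integrable M" "g \<in> square_integrable M"
  shows "add (L2_space M) (L2_class M f) (L2_class M g) = L2_class M (\<lambda>x. f x + g x)"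
  unfolding L2_space_def nvs.simps
  using rep_L2_class[OF assms(1)] rep_L2_class[OF assms(2)]
  by (intro L2_class_cong) (auto elim: eventually_elim2)

lemma scale_class:
  assumes "f \<in> square_integrable M"
  shows "scale (L2_space M) c (L2_class M f) = L2_class M (\<lambda>x. c * f x)"
  unfolding L2_space_def nvs.simps
  using rep_L2_class[OF assms] by (intro L2_class_cong) auto

lemma sub_class:
  assumes "f \<in> square_integrable M" "g \<in> square_integrable M"
  shows "sub (L2_space M) (L2_class M f) (L2_class M g) = L2_class M (\<lambda>x. f x - g x)"
  using add_class[OF assms(1) sqi_scale[OF assms(2)], of "-1"] scale_class[OF assms(2), of "-1"]
  by (simp add: sub_def)

lemma inner_class:
  assumes "f \<in> square_integrable M" "g \<in> square_integrable M"
  shows "L2_inner M (L2_class M f) (L2_class M g) = (\<integral>x. f x * g x \<partial>M)"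
proof -
  have [measurable]: "rep (L2_class M f) \<in> borel_measurable M" "rep (L2_class M g) \<in> borel_measurable M"
    "f \<in> borel_measurable M" "g \<in> borel_measurable M"
    using rep_L2(1)[OF L2_class_in] assms by (auto intro!: sqi_measurable)
  show ?thesis
    unfolding L2_inner_def using rep_L2_class[OF assms(1)] rep_L2_class[OF assms(2)]
    by (intro integral_cong_AE) (measurable, auto elim: eventually_elim2)
qed

lemma vector_space_L2: "vector_space_nvs (L2_space M)"
  unfolding vector_space_nvs_def
proof (intro conjI ballI allI)
  fix x assume "x \<in> pts (L2_space M)"
  then obtain f where f: "f \<in> square_integrable M" "x = L2_class M f" by (auto elim: L2_cases)
  show "\<exists>y\<in>pts (L2_space M). add (L2_space M) x y = null (L2_space M)"
    using add_class[OF f(1) sqi_scale[OF f(1)], of "-1"] sqi_scale[OF f(1), of "-1"] f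
    by (intro bexI[of _ "L2_class M (\<lambda>x. - f x)"]) auto
qed (auto elim!: L2_cases simp: add_class scale_class sqi_add sqi_scale algebra_simps)

lemma inner_nvs_L2: "inner_nvs (L2_space M) (L2_inner M)"
proof
  show "vector_space_nvs (L2_space M)" by (rule vector_space_L2)
  show "symmetric_bilinear_nvs (L2_space M) (pts (L2_space M)) (L2_inner M)"
    unfolding symmetric_bilinear_nvs_def
  proof (rule conjI)
    show "\<forall>u\<in>pts (L2_space M). \<forall>v\<in>pts (L2_space M). L2_inner M u v = L2_inner M v u"
      by (simp add: L2_inner_def mult.commute)
  qed (auto elim!: L2_cases simp: add_class scale_class inner_class sqi_add sqi_scale
        sqi_integrable_mult distrib_right mult.assoc)
next
  fix x assume "x \<in> pts (L2_space M)"
  then obtain f where f: "f \<in> square_integrable M" "x = L2_class M f" by (auto elim: L2_cases)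
  show "0 \<le> L2_inner M x x" using f by (simp add: inner_class)
  assume "L2_inner M x x = 0"
  then have "(\<integral>y. f y * f y \<partial>M) = 0" using f by (simp add: inner_class)
  then have "AE y in M. f y * f y = 0"
    using sqi_integrable_mult[OF f(1) f(1)] by (subst (asm) integral_nonneg_eq_0_iff_AE) auto
  then show "x = null (L2_space M)" using f by (auto intro!: L2_class_cong)
qed simp

text \<open>A subsequence whose increments \<open>d\<^sub>k\<close> satisfy \<open>\<integral> d\<^sub>k\<^sup>2 \<le> 8\<^sup>-\<^sup>k\<close> converges almost everywhere,
  because \<open>\<Sum> 4\<^sup>k d\<^sub>k\<^sup>2\<close> is integrable and so \<open>d\<^sub>k = O(2\<^sup>-\<^sup>k)\<close> at almost every point. By Fatou's
  lemma its limit is the limit of the whole sequence in \<open>L\<^sup>2\<close>.\<close>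

lemma square_integrable_complete:
  fixes f :: "nat \<Rightarrow> 'a \<Rightarrow> real"
  assumes f: "\<And>n. f n \<in> square_integrable M"
    and cau: "\<And>e. e > 0 \<Longrightarrow> \<exists>N. \<forall>m\<ge>N. \<forall>n\<ge>N. (\<integral>x. (f m x - f n x)\<^sup>2 \<partial>M) < e"
  obtains g where "g \<in> square_integrable M" "(\<lambda>n. \<integral>x. (f n x - g x)\<^sup>2 \<partial>M) \<longlonglongrightarrow> 0"
proof -
  have [measurable]: "f n \<in> borel_measurable M" for n using f by (rule sqi_measurable)
  have int: "integrable M (\<lambda>x. (f m x - f n x)\<^sup>2)" for m n
    using sqi_diff[OF f f, of m n] by (simp add: square_integrable_def)
  have nn: "(\<integral>\<^sup>+x. ennreal ((f m x - f n x)\<^sup>2) \<partial>M) = ennreal (\<integral>x. (f m x - f n x)\<^sup>2 \<partial>M)" for m n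
    by (rule nn_integral_eq_integral[OF int]) simp
  have "\<exists>N. \<forall>m\<ge>N. \<forall>n\<ge>N. (\<integral>x. (f m x - f n x)\<^sup>2 \<partial>M) < (1/8)^k" for k :: nat
    by (rule cau) simp
  then obtain N where N: "\<And>k m n. m \<ge> N k \<Longrightarrow> n \<ge> N k \<Longrightarrow> (\<integral>x. (f m x - f n x)\<^sup>2 \<partial>M) < (1/8)^k"
    by metis
  \<comment> \<open>Partial sums make the indices nondecreasing while keeping \<open>r k \<ge> N k\<close>.\<close>
  define r where "r k = (\<Sum>j\<le>k. N j)" for k
  have rN: "N j \<le> r k" if "j \<le> k" for j k
    unfolding r_def using that by (intro member_le_sum) auto
  define d where "d k x = f (r (Suc k)) x - f (r k) x" for k x
  have [measurable]: "d k \<in> borel_measurable M" for k unfolding d_def by measurable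
  have "(\<integral>\<^sup>+x. (\<Sum>k. ennreal (4^k * (d k x)\<^sup>2)) \<partial>M) = (\<Sum>k. \<integral>\<^sup>+x. ennreal (4^k * (d k x)\<^sup>2) \<partial>M)"
    by (intro nn_integral_suminf) measurable
  also have "\<dots> \<le> (\<Sum>k. ennreal ((1/2)^k))"
  proof (intro suminf_le allI)
    fix k
    have "(\<integral>\<^sup>+x. ennreal (4^k * (d k x)\<^sup>2) \<partial>M) = ennreal (4^k) * (\<integral>\<^sup>+x. ennreal ((d k x)\<^sup>2) \<partial>M)"
      by (simp add: ennreal_mult nn_integral_cmult)
    also have "\<dots> = ennreal (4^k * (\<integral>x. (d k x)\<^sup>2 \<partial>M))"
      unfolding d_def nn by (simp add: ennreal_mult)
    also have "\<dots> \<le> ennreal (4^k * (1/8)^k)"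
      using N[of k "r (Suc k)" "r k"] rN[of k k] rN[of k "Suc k"]
      by (intro ennreal_leI mult_left_mono) (auto simp: d_def)
    also have "4^k * (1/8)^k = ((1/2)^k :: real)"
      by (simp add: power_mult_distrib[symmetric])
    finally show "(\<integral>\<^sup>+x. ennreal (4^k * (d k x)\<^sup>2) \<partial>M) \<le> ennreal ((1/2)^k)" .
  qed auto
  also have "\<dots> = ennreal (\<Sum>k. (1/2)^k)"
    by (intro suminf_ennreal2) auto
  also have "\<dots> < \<infinity>" by simp
  finally have "AE x in M. (\<Sum>k. ennreal (4^k * (d k x)\<^sup>2)) \<noteq> \<infinity>"
    by (intro nn_integral_noteq_infinite) auto
  then have conv: "AE x in M. convergent (\<lambda>k. f (r k) x)"
  proof eventually_elim
    case (elim x)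
    define S where "S = (\<Sum>k. ennreal (4^k * (d k x)\<^sup>2))"
    obtain C where C: "S = ennreal C" "0 \<le> C"
      using elim unfolding S_def[symmetric] by (cases S) auto
    have "4^k * (d k x)\<^sup>2 \<le> C" for k
    proof -
      have "sum (\<lambda>k. ennreal (4^k * (d k x)\<^sup>2)) {k} \<le> S"
        unfolding S_def by (intro sum_le_suminf summableI) auto
      then have "ennreal (4^k * (d k x)\<^sup>2) \<le> ennreal C" unfolding C(1) by simp
      then show ?thesis using C(2) by (subst (asm) ennreal_le_iff) auto
    qed
    then have le: "\<bar>d k x\<bar> \<le> sqrt C * (1/2)^k" for k
    proof -
      have "(2^k)\<^sup>2 = (4^k :: real)"
        unfolding power2_eq_square power_mult_distrib[symmetric] by simp
      then have "(2^k * \<bar>d k x\<bar>)\<^sup>2 \<le> C"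
        using \<open>4^k * (d k x)\<^sup>2 \<le> C\<close> unfolding power_mult_distrib power2_abs by simp
      then have "2^k * \<bar>d k x\<bar> \<le> sqrt C" by (rule real_le_rsqrt)
      then show ?thesis by (simp add: field_simps)
    qed
    have "summable (\<lambda>k. d k x)"
    proof (rule summable_comparison_test')
      show "summable (\<lambda>k. sqrt C * (1/2)^k)" by (intro summable_mult summable_geometric) simp
      show "norm (d k x) \<le> sqrt C * (1/2)^k" for k using le by simp
    qed
    then have "convergent (\<lambda>n. f (r 0) x + (\<Sum>k<n. d k x))"
      by (intro convergent_add convergent_const) (simp add: summable_iff_convergent)
    moreover have "f (r 0) x + (\<Sum>k<n. d k x) = f (r n) x" for n
      by (induction n) (auto simp: d_def)
    ultimately show ?case by simp
  qed
  define g where "g x = lim (\<lambda>k. f (r k) x)" for x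
  have [measurable]: "g \<in> borel_measurable M"
    unfolding g_def by (rule borel_measurable_lim_metric) measurable
  \<comment> \<open>The bound holds for all \<open>m \<ge> N k\<close>, so it gives convergence of the whole sequence.\<close>
  have fatou: "(\<integral>\<^sup>+x. ennreal ((f m x - g x)\<^sup>2) \<partial>M) \<le> ennreal ((1/8)^k)" if m: "m \<ge> N k" for m k
  proof -
    have "AE x in M. ennreal ((f m x - g x)\<^sup>2) = liminf (\<lambda>j. ennreal ((f m x - f (r j) x)\<^sup>2))"
      using conv
    proof eventually_elim
      case (elim x)
      then have "(\<lambda>j. f (r j) x) \<longlonglongrightarrow> g x" by (simp add: g_def convergent_LIMSEQ_iff)
      then have "(\<lambda>j. ennreal ((f m x - f (r j) x)\<^sup>2)) \<longlonglongrightarrow> ennreal ((f m x - g x)\<^sup>2)"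
        by (intro tendsto_intros tendsto_ennrealI)
      then show ?case by (intro lim_imp_Liminf[symmetric]) auto
    qed
    then have "(\<integral>\<^sup>+x. ennreal ((f m x - g x)\<^sup>2) \<partial>M)
        = (\<integral>\<^sup>+x. liminf (\<lambda>j. ennreal ((f m x - f (r j) x)\<^sup>2)) \<partial>M)"
      by (rule nn_integral_cong_AE)
    also have "\<dots> \<le> liminf (\<lambda>j. \<integral>\<^sup>+x. ennreal ((f m x - f (r j) x)\<^sup>2) \<partial>M)"
      by (rule nn_integral_liminf) measurable
    also have "\<dots> \<le> ennreal ((1/8)^k)"
    proof (rule Liminf_le)
      show "\<forall>\<^sub>F j in sequentially. (\<integral>\<^sup>+x. ennreal ((f m x - f (r j) x)\<^sup>2) \<partial>M) \<le> ennreal ((1/8)^k)"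
        unfolding eventually_sequentially nn
        using N[OF m rN] by (intro exI[of _ k]) (auto intro!: ennreal_leI less_imp_le)
    qed simp
    finally show ?thesis .
  qed
  have diff: "(\<lambda>x. f m x - g x) \<in> square_integrable M" if "m \<ge> N k" for m k
  proof -
    have "integrable M (\<lambda>x. (f m x - g x)\<^sup>2)"
      using fatou[OF that] by (intro integrableI_nonneg) (auto intro: le_less_trans)
    then show ?thesis by (simp add: square_integrable_def)
  qed
  have g: "g \<in> square_integrable M"
    using sqi_diff[OF f[of "N 0"] diff[of 0 "N 0"]] by simp
  have "(\<lambda>n. \<integral>x. (f n x - g x)\<^sup>2 \<partial>M) \<longlonglongrightarrow> 0"
  proof (rule LIMSEQ_I)
    fix e :: real assume "e > 0"
    then obtain k where k: "(1/8)^k < e"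
      using real_arch_pow_inv[of e "1/8"] by auto
    have "norm ((\<integral>x. (f n x - g x)\<^sup>2 \<partial>M) - 0) < e" if "n \<ge> N k" for n
    proof -
      have "ennreal (\<integral>x. (f n x - g x)\<^sup>2 \<partial>M) \<le> ennreal ((1/8)^k)"
        using fatou[OF that] diff[OF that]
        by (subst nn_integral_eq_integral[symmetric]) (auto simp: square_integrable_def)
      then show ?thesis using k by simp
    qed
    then show "\<exists>no. \<forall>n\<ge>no. norm ((\<integral>x. (f n x - g x)\<^sup>2 \<partial>M) - 0) < e" by blast
  qed
  with g show ?thesis by (rule that)
qed

interpretation L2: complete_inner_nvs "L2_space M" "L2_inner M" for M
proof -
  interpret inner_nvs "L2_space M" "L2_inner M" by (rule inner_nvs_L2)
  show "complete_inner_nvs (L2_space M) (L2_inner M)"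
  proof
    fix u assume "\<And>n. u n \<in> pts (L2_space M)" and cau: "cauchy_nvs (L2_space M) u"
    then have u: "u n \<in> L2 M" for n by simp
    define f where "f n = rep (u n)" for n
    have f: "f n \<in> square_integrable M" and uf: "u n = L2_class M (f n)" for n
      using rep_L2[OF u] by (simp_all add: f_def)
    have sq: "nrm (L2_space M) (sub (L2_space M) (u m) (L2_class M g)) = sqrt (\<integral>x. (f m x - g x)\<^sup>2 \<partial>M)"
      if "g \<in> square_integrable M" for m g
      using f that by (simp add: uf sub_class inner_class sqi_diff power2_eq_square)
    have "\<exists>N. \<forall>m\<ge>N. \<forall>n\<ge>N. (\<integral>x. (f m x - f n x)\<^sup>2 \<partial>M) < e" if "e > 0" for e
    proof -
      obtain N where "\<forall>m\<ge>N. \<forall>n\<ge>N. nrm (L2_space M) (sub (L2_space M) (u m) (u n)) < sqrt e"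
        using cau \<open>e > 0\<close> unfolding cauchy_nvs_def by (meson real_sqrt_gt_0_iff)
      then show ?thesis using sq[OF f] uf by (intro exI[of _ N]) simp
    qed
    from square_integrable_complete[of f, OF f this]
    obtain g where g: "g \<in> square_integrable M" "(\<lambda>n. \<integral>x. (f n x - g x)\<^sup>2 \<partial>M) \<longlonglongrightarrow> 0" .
    have "converges_nvs (L2_space M) u (L2_class M g)"
      unfolding converges_nvs_def sq[OF g(1)] using tendsto_real_sqrt[OF g(2)] by simp
    then show "\<exists>l\<in>pts (L2_space M). converges_nvs (L2_space M) u l"
      using g by auto
  qed
qed

section \<open>Order preserving contractions and comonotone functions\<close>

text \<open>The properties of a single map \<open>T\<^sub>t\<close> that are needed. The map acts on functions rather than on classes,
  so each property is stated up to null sets.\<close>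

locale contraction_map = sigma_finite_measure M for M :: "'a measure" +
  fixes S :: "('a \<Rightarrow> real) \<Rightarrow> 'a \<Rightarrow> real"
  assumes S_sqi: "f \<in> square_integrable M \<Longrightarrow> S f \<in> square_integrable M"
    and S_mono: "\<lbrakk>f \<in> square_integrable M; g \<in> square_integrable M; AE x in M. f x \<le> g x\<rbrakk>
      \<Longrightarrow> AE x in M. S f x \<le> S g x"
    and S_L1: "\<lbrakk>f \<in> square_integrable M; g \<in> square_integrable M\<rbrakk>
      \<Longrightarrow> (\<integral>\<^sup>+x. ennreal \<bar>S f x - S g x\<bar> \<partial>M) \<le> (\<integral>\<^sup>+x. ennreal \<bar>f x - g x\<bar> \<partial>M)"
    and S_Linf: "\<lbrakk>f \<in> square_integrable M; g \<in> square_integrable M; AE x in M. \<bar>f x - g x\<bar> \<le> K\<rbrakk>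
      \<Longrightarrow> AE x in M. \<bar>S f x - S g x\<bar> \<le> K"
    and S_zero: "AE x in M. S (\<lambda>x. 0) x = 0"
begin

text \<open>Cut \<open>f\<^sup>+\<close> at height \<open>r\<close>. The image of the truncated function is at most \<open>r\<close>, and the truncation
  changes the image by no more, in \<open>L\<^sup>1\<close>, than the part of \<open>f\<close> above \<open>r\<close>, which lives on \<open>A\<close>.\<close>

lemma level_set_bound:
  assumes f: "f \<in> square_integrable M" and A [measurable]: "A \<in> sets M" and r: "0 \<le> r"
    and ge: "\<And>x. x \<in> A \<Longrightarrow> r \<le> f x" and le: "\<And>x. x \<in> space M - A \<Longrightarrow> f x \<le> r"
  shows "(\<integral>\<^sup>+x. ennreal (S f x) * indicator A x \<partial>M) \<le> (\<integral>\<^sup>+x. ennreal (f x) * indicator A x \<partial>M)"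
proof -
  define p where "p x = max (f x) 0" for x
  define g where "g x = min (p x) r" for x
  have p: "p \<in> square_integrable M" unfolding p_def by (rule sqi_max_min[OF f])
  have g: "g \<in> square_integrable M" unfolding g_def by (rule sqi_max_min(2)[OF p r])
  have [measurable]: "f \<in> borel_measurable M" "S p \<in> borel_measurable M" "S g \<in> borel_measurable M"
    using f p g by (auto intro!: sqi_measurable S_sqi)
  have "AE x in M. S f x \<le> S p x" by (rule S_mono[OF f p]) (simp add: p_def)
  moreover have "AE x in M. \<bar>S g x - S (\<lambda>x. 0) x\<bar> \<le> r"
    by (rule S_Linf[OF g sqi_zero]) (use r in \<open>auto simp: g_def p_def\<close>)
  ultimately have "AE x in M. ennreal (S f x) \<le> ennreal \<bar>S p x - S g x\<bar> + ennreal r"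
    using S_zero
  proof eventually_elim
    case (elim x)
    then have "S f x \<le> \<bar>S p x - S g x\<bar> + r" by simp
    then show ?case using r by (simp add: ennreal_leI flip: ennreal_plus)
  qed
  then have "(\<integral>\<^sup>+x. ennreal (S f x) * indicator A x \<partial>M)
      \<le> (\<integral>\<^sup>+x. ennreal \<bar>S p x - S g x\<bar> + ennreal r * indicator A x \<partial>M)"
    by (intro nn_integral_mono_AE) (auto elim!: eventually_mono split: split_indicator)
  also have "\<dots> = (\<integral>\<^sup>+x. ennreal \<bar>S p x - S g x\<bar> \<partial>M) + (\<integral>\<^sup>+x. ennreal r * indicator A x \<partial>M)"
    by (intro nn_integral_add) measurable
  also have "\<dots> \<le> (\<integral>\<^sup>+x. ennreal \<bar>p x - g x\<bar> \<partial>M) + (\<integral>\<^sup>+x. ennreal r * indicator A x \<partial>M)"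
    by (intro add_right_mono S_L1 p g)
  also have "(\<integral>\<^sup>+x. ennreal \<bar>p x - g x\<bar> \<partial>M) = (\<integral>\<^sup>+x. ennreal (f x - r) * indicator A x \<partial>M)"
  proof (rule nn_integral_cong)
    fix x assume x: "x \<in> space M"
    show "ennreal \<bar>p x - g x\<bar> = ennreal (f x - r) * indicator A x"
      using ge[of x] le[of x] x r by (cases "x \<in> A") (auto simp: p_def g_def)
  qed
  also have "\<dots> + (\<integral>\<^sup>+x. ennreal r * indicator A x \<partial>M)
      = (\<integral>\<^sup>+x. ennreal (f x - r) * indicator A x + ennreal r * indicator A x \<partial>M)"
    by (intro nn_integral_add[symmetric]) measurable
  also have "\<dots> = (\<integral>\<^sup>+x. ennreal (f x) * indicator A x \<partial>M)"
    using ge r by (intro nn_integral_cong) (auto split: split_indicator simp flip: ennreal_plus)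
  finally show ?thesis .
qed

text \<open>Integrate the previous bound over the superlevel sets \<open>{w > s}\<close>, \<open>s > 0\<close>. Comonotonicity makes
  them the sets where \<open>f\<close> is large.\<close>

lemma positive_pairing_le:
  assumes f: "f \<in> square_integrable M" and w: "w \<in> square_integrable M"
    and mono: "\<And>x y. w x < w y \<Longrightarrow> f x \<le> f y" and pos: "\<And>x. 0 < w x \<Longrightarrow> 0 \<le> f x"
  shows "(\<integral>\<^sup>+x. ennreal (S f x) * ennreal (w x) \<partial>M) \<le> (\<integral>\<^sup>+x. ennreal (f x) * ennreal (w x) \<partial>M)"
proof -
  interpret P: pair_sigma_finite lborel M ..
  have [measurable]: "f \<in> borel_measurable M" "w \<in> borel_measurable M" "S f \<in> borel_measurable M"
    using f w by (auto intro!: sqi_measurable S_sqi)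
  have layer: "(\<integral>\<^sup>+x. ennreal (h x) * ennreal (w x) \<partial>M)
      = (\<integral>\<^sup>+s. (\<integral>\<^sup>+x. ennreal (h x) * indicator {x \<in> space M. 0 < s \<and> s < w x} x \<partial>M) \<partial>lborel)"
    if [measurable]: "h \<in> borel_measurable M" for h
  proof -
    have "(\<integral>\<^sup>+s. ennreal (h x) * indicator {x \<in> space M. 0 < s \<and> s < w x} x \<partial>lborel)
        = ennreal (h x) * ennreal (w x)" if "x \<in> space M" for x
    proof -
      have "(\<integral>\<^sup>+s. ennreal (h x) * indicator {x \<in> space M. 0 < s \<and> s < w x} x \<partial>lborel)
          = (\<integral>\<^sup>+s. ennreal (h x) * indicator {0<..<w x} s \<partial>lborel)"
        using that by (intro nn_integral_cong) (auto split: split_indicator)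
      also have "\<dots> = ennreal (h x) * emeasure lborel {0<..<w x}"
        by (rule nn_integral_cmult_indicator) simp
      also have "emeasure lborel {0<..<w x} = ennreal (w x)"
        by (cases "0 \<le> w x") (auto simp: ennreal_neg)
      finally show ?thesis .
    qed
    then have "(\<integral>\<^sup>+x. ennreal (h x) * ennreal (w x) \<partial>M)
        = (\<integral>\<^sup>+x. (\<integral>\<^sup>+s. ennreal (h x) * indicator {x \<in> space M. 0 < s \<and> s < w x} x \<partial>lborel) \<partial>M)"
      by (intro nn_integral_cong) simp
    also have "\<dots> = (\<integral>\<^sup>+s. (\<integral>\<^sup>+x. ennreal (h x) * indicator {x \<in> space M. 0 < s \<and> s < w x} x \<partial>M) \<partial>lborel)"
      by (rule P.Fubini') measurable
    finally show ?thesis .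
  qed
  show ?thesis
    unfolding layer[OF \<open>S f \<in> borel_measurable M\<close>] layer[OF \<open>f \<in> borel_measurable M\<close>]
  proof (rule nn_integral_mono)
    fix s :: real
    define A where "A = {x \<in> space M. 0 < s \<and> s < w x}"
    have A [measurable]: "A \<in> sets M" unfolding A_def by measurable
    have "(\<integral>\<^sup>+x. ennreal (S f x) * indicator A x \<partial>M) \<le> (\<integral>\<^sup>+x. ennreal (f x) * indicator A x \<partial>M)"
    proof (cases "A = {}")
      case True
      then show ?thesis by simp
    next
      case False
      then have s: "0 < s" by (auto simp: A_def)
      have nonneg: "0 \<le> f x" if "x \<in> A" for x using that s pos[of x] by (auto simp: A_def)
      \<comment> \<open>The level that separates the values of \<open>f\<close> on \<open>A\<close> from those off \<open>A\<close> is the infimum over \<open>A\<close>.\<close>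
      have bdd: "bdd_below (f ` A)" using nonneg by (auto intro!: bdd_belowI[of _ 0])
      show ?thesis
      proof (rule level_set_bound[OF f A, of "Inf (f ` A)"])
        show "0 \<le> Inf (f ` A)" using False nonneg by (intro cInf_greatest) auto
        show "Inf (f ` A) \<le> f x" if "x \<in> A" for x using that bdd by (intro cInf_lower) auto
        show "f x \<le> Inf (f ` A)" if "x \<in> space M - A" for x
        proof (rule cInf_greatest)
          fix y assume "y \<in> f ` A"
          then obtain z where "z \<in> A" "y = f z" by auto
          then show "f x \<le> y" using that s mono[of x z] by (auto simp: A_def)
        qed (use False in auto)
      qed
    qed
    then show "(\<integral>\<^sup>+x. ennreal (S f x) * indicator {x \<in> space M. 0 < s \<and> s < w x} x \<partial>M)
        \<le> (\<integral>\<^sup>+x. ennreal (f x) * indicator {x \<in> space M. 0 < s \<and> s < w x} x \<partial>M)"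
      unfolding A_def .
  qed
qed

text \<open>Applied to the reflected map, an estimate for positive parts becomes one for negative parts.\<close>

lemma contraction_map_reflect: "contraction_map M (\<lambda>f x. - S (\<lambda>y. - f y) x)"
proof
  have neg: "(\<lambda>y. - f y) \<in> square_integrable M" if "f \<in> square_integrable M" for f
    using sqi_scale[OF that, of "-1"] by simp
  fix f g K
  assume f: "f \<in> square_integrable M"
  show "(\<lambda>x. - S (\<lambda>y. - f y) x) \<in> square_integrable M"
    using neg[OF S_sqi[OF neg[OF f]]] .
  assume g: "g \<in> square_integrable M"
  show "(\<integral>\<^sup>+x. ennreal \<bar>- S (\<lambda>y. - f y) x - - S (\<lambda>y. - g y) x\<bar> \<partial>M) \<le> (\<integral>\<^sup>+x. ennreal \<bar>f x - g x\<bar> \<partial>M)"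
    using S_L1[OF neg[OF g] neg[OF f]] by (simp add: abs_minus_commute)
  show "AE x in M. - S (\<lambda>y. - f y) x \<le> - S (\<lambda>y. - g y) x" if "AE x in M. f x \<le> g x"
    using S_mono[OF neg[OF g] neg[OF f]] that by simp
  show "AE x in M. \<bar>- S (\<lambda>y. - f y) x - - S (\<lambda>y. - g y) x\<bar> \<le> K" if "AE x in M. \<bar>f x - g x\<bar> \<le> K"
    using S_Linf[OF neg[OF g] neg[OF f], of K] that by (simp add: abs_minus_commute)
next
  show "AE x in M. - S (\<lambda>y. - 0) x = 0" using S_zero by simp
qed

text \<open>The product \<open>f w\<close> is the sum of the products of the positive and of the negative parts, whereas for
  \<open>S f\<close> this sum is only an upper bound of \<open>S f \<cdot> w\<close>; the two parts are compared separately.\<close>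

lemma comonotone_pairing_le:
  assumes f: "f \<in> square_integrable M" and w: "w \<in> square_integrable M"
    and mono: "\<And>x y. w x < w y \<Longrightarrow> f x \<le> f y"
    and pos: "\<And>x. 0 < w x \<Longrightarrow> 0 \<le> f x" and neg: "\<And>x. w x < 0 \<Longrightarrow> f x \<le> 0"
  shows "(\<integral>x. S f x * w x \<partial>M) \<le> (\<integral>x. f x * w x \<partial>M)"
proof -
  interpret R: contraction_map M "\<lambda>f x. - S (\<lambda>y. - f y) x" by (rule contraction_map_reflect)
  define parts where "parts h x = max (h x) 0 * max (w x) 0 + max (- h x) 0 * max (- w x) 0" for h x
  have parts_nn: "(\<integral>\<^sup>+x. ennreal (parts h x) \<partial>M)
      = (\<integral>\<^sup>+x. ennreal (h x) * ennreal (w x) \<partial>M) + (\<integral>\<^sup>+x. ennreal (- h x) * ennreal (- w x) \<partial>M)"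
    if "h \<in> square_integrable M" for h
  proof -
    have [measurable]: "h \<in> borel_measurable M" "w \<in> borel_measurable M"
      using that w by (auto intro: sqi_measurable)
    have m: "ennreal (max a 0 * max b 0) = ennreal a * ennreal b" for a b :: real
      by (auto simp: max_def ennreal_mult ennreal_neg)
    show ?thesis
      unfolding parts_def
      by (subst ennreal_plus) (auto simp: m nn_integral_add)
  qed
  have parts_int: "integrable M (parts h)" if "h \<in> square_integrable M" for h
  proof -
    have n: "(\<lambda>x. - k x) \<in> square_integrable M" if "k \<in> square_integrable M" for k
      using sqi_scale[OF that, of "-1"] by simp
    show ?thesis
      unfolding parts_def
      using that w by (intro Bochner_Integration.integrable_add sqi_integrable_mult sqi_max_min n)
  qed
  have parts_nonneg: "0 \<le> parts h x" for h x by (simp add: parts_def)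
  have Sf: "S f \<in> square_integrable M" by (rule S_sqi[OF f])
  have mf: "(\<lambda>x. - f x) \<in> square_integrable M" "(\<lambda>x. - w x) \<in> square_integrable M"
    using sqi_scale[OF f, of "-1"] sqi_scale[OF w, of "-1"] by auto
  have "(\<integral>\<^sup>+x. ennreal (parts (S f) x) \<partial>M) \<le> (\<integral>\<^sup>+x. ennreal (parts f x) \<partial>M)"
    unfolding parts_nn[OF Sf] parts_nn[OF f]
  proof (rule add_mono)
    show "(\<integral>\<^sup>+x. ennreal (S f x) * ennreal (w x) \<partial>M) \<le> (\<integral>\<^sup>+x. ennreal (f x) * ennreal (w x) \<partial>M)"
      by (rule positive_pairing_le[OF f w mono pos])
    show "(\<integral>\<^sup>+x. ennreal (- S f x) * ennreal (- w x) \<partial>M) \<le> (\<integral>\<^sup>+x. ennreal (- f x) * ennreal (- w x) \<partial>M)"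
      using R.positive_pairing_le[OF mf] mono neg by simp
  qed
  then have "(\<integral>x. parts (S f) x \<partial>M) \<le> (\<integral>x. parts f x \<partial>M)"
    using parts_int[OF Sf] parts_int[OF f] parts_nonneg
    by (simp add: nn_integral_eq_integral integral_nonneg_AE)
  moreover have "(\<integral>x. S f x * w x \<partial>M) \<le> (\<integral>x. parts (S f) x \<partial>M)"
  proof (rule integral_mono[OF sqi_integrable_mult[OF Sf w] parts_int[OF Sf]])
    fix x
    have "a * b \<le> max a 0 * max b 0 + max (- a) 0 * max (- b) 0" for a b :: real
      by (auto simp: max_def mult_nonneg_nonpos mult_nonpos_nonneg)
    then show "S f x * w x \<le> parts (S f) x" by (simp add: parts_def)
  qed
  moreover have "parts f x = f x * w x" for x
    using pos[of x] neg[of x] by (cases "w x" "0 :: real" rule: linorder_cases) (auto simp: parts_def max_def)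
  ultimately show ?thesis by simp
qed

end

section \<open>The energy along the gradient flow\<close>

text \<open>The flow is known to be differentiable only from the right. If \<open>g\<close> rose above a line of slope
  \<open>k > 0\<close> through a point of its graph, then the right derivative at the last time where it is not above the
  line would be at least \<open>k\<close>.\<close>

lemma right_derivative_nonpos_imp_le:
  fixes g :: "real \<Rightarrow> real"
  assumes ab: "a \<le> b" and cont: "continuous_on {a..b} g"
    and deriv: "\<And>t. a < t \<Longrightarrow> t < b \<Longrightarrow> \<exists>D\<le>0. (g has_real_derivative D) (at_right t)"
  shows "g b \<le> g a"
proof (cases "a = b")
  case False
  then have "a < b" using ab by simp
  have le: "g b \<le> g s" if s: "a < s" "s \<le> b" for s
  proof (rule field_le_epsilon)
    fix e :: real assume "0 < e"
    define k where "k = e / (b - a)"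
    have k: "0 < k" "k * (b - s) \<le> e"
      using \<open>0 < e\<close> \<open>a < b\<close> s by (auto simp: k_def field_simps)
    define h where "h t = g t - g s - k * (t - s)" for t
    have hc: "continuous_on {s..b} h"
      unfolding h_def using s by (intro continuous_intros continuous_on_subset[OF cont]) auto
    define A where "A = {t \<in> {s..b}. h t \<le> 0}"
    have "closed A"
      using continuous_closed_preimage[OF hc closed_atLeastAtMost closed_atMost[of 0]]
      by (simp add: A_def vimage_def Int_def)
    moreover have "s \<in> A" using s by (simp add: A_def h_def)
    moreover have bdd: "bdd_above A" by (auto simp: A_def intro!: bdd_aboveI[of _ b])
    ultimately have c: "Sup A \<in> A" by (intro closed_contains_Sup) auto
    have "Sup A = b"
    proof (rule ccontr)
      assume "Sup A \<noteq> b"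
      then have cb: "Sup A < b" "s \<le> Sup A" using c by (auto simp: A_def)
      obtain D where D: "D \<le> 0" "(g has_real_derivative D) (at_right (Sup A))"
        using deriv[of "Sup A"] cb s by auto
      have "(h has_real_derivative D - k) (at_right (Sup A))"
        unfolding h_def by (auto intro!: derivative_eq_intros D(2))
      then have "((\<lambda>y. (h y - h (Sup A)) / (y - Sup A)) \<longlongrightarrow> D - k) (at_right (Sup A))"
        by (simp add: has_field_derivative_iff)
      then have "\<forall>\<^sub>F y in at_right (Sup A). (h y - h (Sup A)) / (y - Sup A) < 0"
        using D(1) k(1) by (intro order_tendstoD(2)) auto
      moreover have "\<forall>\<^sub>F y in at_right (Sup A). y < b"
        using cb by (intro eventually_at_rightI[of _ b]) auto
      ultimately have "\<forall>\<^sub>F y in at_right (Sup A). Sup A < y \<and> y < b \<and> h y \<le> 0"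
        using eventually_at_right_less
      proof eventually_elim
        case (elim y)
        then have "h y < h (Sup A)" by (simp add: divide_less_0_iff)
        then show ?case using elim c by (auto simp: A_def)
      qed
      then obtain y where y: "Sup A < y" "y < b" "h y \<le> 0"
        using eventually_happens[of _ "at_right (Sup A)"] by auto
      then have "y \<in> A" using cb by (auto simp: A_def)
      then show False using cSup_upper[OF _ bdd] y by fastforce
    qed
    then have "h b \<le> 0" using c by (simp add: A_def)
    then show "g b \<le> g s + e" using k(2) by (simp add: h_def)
  qed
  show ?thesis
  proof (rule tendsto_lowerbound)
    show "(g \<longlongrightarrow> g a) (at a within {a..b})"
      using cont \<open>a < b\<close> by (simp add: continuous_on_def)
    show "\<forall>\<^sub>F s in at a within {a..b}. g b \<le> g s"
      using le by (auto simp: eventually_at_filter intro!: always_eventually)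
    show "at a within {a..b} \<noteq> bot"
      using \<open>a < b\<close> by (simp add: at_within_Icc_at_right)
  qed
qed simp

context inner_nvs
begin

text \<open>The increment of \<open>\<parallel>\<gamma> - x\<parallel>\<^sup>2 / 2\<close> over \<open>[t, t + h]\<close>, divided by \<open>h\<close>, is \<open>\<langle>d\<^sub>h, \<gamma> t - x\<rangle> + h \<parallel>d\<^sub>h\<parallel>\<^sup>2 / 2\<close>,
  where \<open>d\<^sub>h\<close> is the difference quotient of the curve.\<close>

lemma half_square_right_derivative:
  assumes \<gamma>: "\<And>s. 0 \<le> s \<Longrightarrow> \<gamma> s \<in> pts V" and t: "0 \<le> t" and x: "x \<in> pts V" and \<eta>: "\<eta> \<in> pts V"
    and lim: "((\<lambda>h. nrm V (sub V (scale V (1 / h) (sub V (\<gamma> (t + h)) (\<gamma> t))) \<eta>)) \<longlongrightarrow> 0) (at_right 0)"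
  shows "((\<lambda>s. (nrm V (sub V (\<gamma> s) x))\<^sup>2 / 2) has_real_derivative ip \<eta> (sub V (\<gamma> t) x)) (at_right t)"
proof -
  define d where "d h = scale V (1 / h) (sub V (\<gamma> (t + h)) (\<gamma> t))" for h
  define z where "z = sub V (\<gamma> t) x"
  have z: "z \<in> pts V" using \<gamma>[OF t] x by (simp add: z_def)
  have d: "d h \<in> pts V" if "0 < h" for h using \<gamma>[OF t] \<gamma>[of "t + h"] t that by (simp add: d_def)
  have lim': "((\<lambda>h. nrm V (sub V (d h) \<eta>)) \<longlongrightarrow> 0) (at_right 0)"
    using lim by (simp add: d_def)
  have pos: "\<forall>\<^sub>F h in at_right 0. 0 < (h :: real)" by (rule eventually_at_right_less)
  have "((\<lambda>h. ip (d h) z - ip \<eta> z) \<longlongrightarrow> 0) (at_right 0)"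
  proof (rule Lim_null_comparison)
    show "\<forall>\<^sub>F h in at_right 0. norm (ip (d h) z - ip \<eta> z) \<le> nrm V (sub V (d h) \<eta>) * nrm V z"
      using pos
    proof eventually_elim
      case (elim h)
      then show ?case using Cauchy_Schwarz[of "sub V (d h) \<eta>" z] d[of h] z \<eta> by simp
    qed
    show "((\<lambda>h. nrm V (sub V (d h) \<eta>) * nrm V z) \<longlongrightarrow> 0) (at_right 0)"
      by (rule tendsto_mult_left_zero[OF lim'])
  qed
  then have l1: "((\<lambda>h. ip (d h) z) \<longlongrightarrow> ip \<eta> z) (at_right 0)" by (simp add: LIM_zero_iff)
  have "((\<lambda>h. nrm V (d h) - nrm V \<eta>) \<longlongrightarrow> 0) (at_right 0)"
  proof (rule Lim_null_comparison[OF _ lim'])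
    show "\<forall>\<^sub>F h in at_right 0. norm (nrm V (d h) - nrm V \<eta>) \<le> nrm V (sub V (d h) \<eta>)"
      using pos
    proof eventually_elim
      case (elim h)
      then show ?case using nrm_diff_le[of "d h" \<eta> "null V"] d[of h] \<eta> by (simp add: sub_null)
    qed
  qed
  then have l2: "((\<lambda>h. nrm V (d h)) \<longlongrightarrow> nrm V \<eta>) (at_right 0)" by (simp add: LIM_zero_iff)
  have "((\<lambda>h. ip (d h) z + h / 2 * (nrm V (d h))\<^sup>2) \<longlongrightarrow> ip \<eta> z + 0 / 2 * (nrm V \<eta>)\<^sup>2) (at_right 0)"
    by (intro tendsto_intros l1 l2) simp
  moreover have "\<forall>\<^sub>F h in at_right 0. ip (d h) z + h / 2 * (nrm V (d h))\<^sup>2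
      = ((nrm V (sub V (\<gamma> (h + t)) x))\<^sup>2 / 2 - (nrm V (sub V (\<gamma> t) x))\<^sup>2 / 2) / (h + t - t)"
    using pos
  proof eventually_elim
    case (elim h)
    have a: "\<gamma> (t + h) \<in> pts V" and b: "\<gamma> t \<in> pts V" using \<gamma> t elim by auto
    have "sub V (\<gamma> (t + h)) x = add V z (scale V h (d h))"
      using a b x elim by (intro vector_eqI) (auto simp: z_def d_def)
    then have "(nrm V (sub V (\<gamma> (t + h)) x))\<^sup>2 = ip z z + 2 * h * ip (d h) z + h\<^sup>2 * ip (d h) (d h)"
      using z d[OF elim] ip_commute[OF z d[OF elim]] nrm_square[of "add V z (scale V h (d h))"]
      by (simp add: algebra_simps) (simp add: power2_eq_square)
    moreover have "(nrm V (sub V (\<gamma> t) x))\<^sup>2 = ip z z" using z by (simp add: z_def[symmetric])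
    ultimately show ?case
      unfolding add.commute[of h t] nrm_square[OF d[OF elim]]
      using elim by (simp add: power2_eq_square add_divide_distrib)
  qed
  ultimately have "((\<lambda>h. ((nrm V (sub V (\<gamma> (h + t)) x))\<^sup>2 / 2 - (nrm V (sub V (\<gamma> t) x))\<^sup>2 / 2) / (h + t - t))
      \<longlongrightarrow> ip \<eta> z) (at_right 0)"
    by (simp add: tendsto_cong)
  then have "((\<lambda>s. ((nrm V (sub V (\<gamma> s) x))\<^sup>2 / 2 - (nrm V (sub V (\<gamma> t) x))\<^sup>2 / 2) / (s - t))
      \<longlongrightarrow> ip \<eta> z) (at_right t)"
    by (subst filterlim_at_right_to_0)
  then show ?thesis by (simp add: has_field_derivative_iff z_def)
qed

lemma half_square_continuous:
  fixes \<gamma> :: "real \<Rightarrow> 'v"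
  assumes \<gamma>: "\<And>s. 0 \<le> s \<Longrightarrow> \<gamma> s \<in> pts V" and x: "x \<in> pts V"
    and lim: "\<And>t. 0 \<le> t \<Longrightarrow> ((\<lambda>s. nrm V (sub V (\<gamma> s) (\<gamma> t))) \<longlongrightarrow> 0) (at t within {0..})"
  shows "continuous_on {0..} (\<lambda>s. (nrm V (sub V (\<gamma> s) x))\<^sup>2 / 2)"
proof -
  have "continuous_on {0..} (\<lambda>s. nrm V (sub V (\<gamma> s) x))"
    unfolding continuous_on_def
  proof
    fix t :: real assume "t \<in> {0..}"
    then have t: "0 \<le> t" by simp
    have "((\<lambda>s. nrm V (sub V (\<gamma> s) x) - nrm V (sub V (\<gamma> t) x)) \<longlongrightarrow> 0) (at t within {0..})"
    proof (rule Lim_null_comparison[OF _ lim[OF t]])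
      show "\<forall>\<^sub>F s in at t within {0..}. norm (nrm V (sub V (\<gamma> s) x) - nrm V (sub V (\<gamma> t) x))
          \<le> nrm V (sub V (\<gamma> s) (\<gamma> t))"
        using nrm_diff_le[OF \<gamma> \<gamma>[OF t] x] by (auto simp: eventually_at_filter intro!: always_eventually)
    qed
    then show "((\<lambda>s. nrm V (sub V (\<gamma> s) x)) \<longlongrightarrow> nrm V (sub V (\<gamma> t) x)) (at t within {0..})"
      by (simp add: LIM_zero_iff)
  qed
  then show ?thesis by (intro continuous_intros) auto
qed

end

locale lsc_gradient_flow =
  fixes M :: "'a measure" and E :: "('a \<Rightarrow> real) set \<Rightarrow> ennreal" and T
  assumes flow: "gradient_flow M E T" and lsc: "lsc_functional M E"
begin

lemma T_0: "u \<in> L2 M \<Longrightarrow> T 0 u = u"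
  and T_L2: "u \<in> L2 M \<Longrightarrow> 0 \<le> t \<Longrightarrow> T t u \<in> L2 M"
  and T_continuous: "u \<in> L2 M \<Longrightarrow> 0 \<le> t \<Longrightarrow>
    ((\<lambda>s. nrm (L2_space M) (sub (L2_space M) (T s u) (T t u))) \<longlongrightarrow> 0) (at t within {0..})"
  using flow by (simp_all add: gradient_flow_def Let_def)

lemma distance_continuous:
  assumes "u \<in> L2 M" "x \<in> L2 M"
  shows "continuous_on {0..} (\<lambda>s. (nrm (L2_space M) (sub (L2_space M) (T s u) x))\<^sup>2 / 2)"
  using assms T_L2 T_continuous by (intro L2.half_square_continuous) auto

text \<open>The right derivative is \<open>\<langle>\<xi>, x - T\<^sub>t u\<rangle>\<close> for a subgradient \<open>\<xi>\<close> of \<open>E\<close> at \<open>T\<^sub>t u\<close>, and the subgradient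
  inequality, tested with \<open>x\<close>, bounds it by \<open>E x - E (T\<^sub>t u)\<close>. This is the evolution variational inequality.\<close>

lemma distance_derivative:
  assumes u: "u \<in> L2 M" and x: "x \<in> domE M E" and t: "0 < t"
  obtains D where
    "((\<lambda>s. (nrm (L2_space M) (sub (L2_space M) (T s u) x))\<^sup>2 / 2) has_real_derivative D) (at_right t)"
    "E x \<le> E (T t u) \<Longrightarrow> D \<le> 0" "E x < E (T t u) \<Longrightarrow> D < 0"
proof -
  have xL: "x \<in> L2 M" and Ex: "E x \<noteq> \<infinity>" using x by (auto simp: domE_def)
  have Tu: "T t u \<in> L2 M" using T_L2[OF u] t by simp
  obtain \<xi> where \<xi>: "\<xi> \<in> subdifferential M E (T t u)" and lim:
    "((\<lambda>h. nrm (L2_space M) (sub (L2_space M) (scale (L2_space M) (1 / h) (sub (L2_space M)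
        (T (t + h) u) (T t u))) (scale (L2_space M) (-1) \<xi>))) \<longlongrightarrow> 0) (at_right 0)"
    using flow u t unfolding gradient_flow_def Let_def by blast
  have \<xi>L: "\<xi> \<in> L2 M" and ETu: "E (T t u) \<noteq> \<infinity>"
    and sub: "ereal (L2_inner M \<xi> (sub (L2_space M) x (T t u))) \<le> enn2ereal (E x) - enn2ereal (E (T t u))"
    using \<xi> xL by (auto simp: subdifferential_def domE_def)
  let ?D = "L2_inner M (scale (L2_space M) (-1) \<xi>) (sub (L2_space M) (T t u) x)"
  have D: "?D = L2_inner M \<xi> (sub (L2_space M) x (T t u))"
    using L2.ip_scale_left[of \<xi> M "sub (L2_space M) (T t u) x" "-1"] L2.ip_sub_right[of _ M _ \<xi>]
      L2.pts_sub[of "T t u" M x] \<xi>L xL Tu by simp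
  obtain a b where ab: "0 \<le> a" "0 \<le> b" "E x = ennreal a" "E (T t u) = ennreal b"
    using Ex ETu by (cases "E x"; cases "E (T t u)") auto
  have Dab: "?D \<le> a - b"
    using sub unfolding D ab using ab(1,2) by (simp add: enn2ereal_ennreal)
  show ?thesis
  proof (rule that[of ?D])
    show "((\<lambda>s. (nrm (L2_space M) (sub (L2_space M) (T s u) x))\<^sup>2 / 2) has_real_derivative ?D) (at_right t)"
      using T_L2[OF u] xL \<xi>L L2.pts_scale[of \<xi>] t
      by (intro L2.half_square_right_derivative[OF _ _ _ _ lim]) auto
  qed (use Dab ab in \<open>auto simp: ennreal_less_iff\<close>)
qed

text \<open>If the flow started at \<open>y\<close> cannot come closer to \<open>x\<close>, then by the evolution variational
  inequality it takes energies at most \<open>E x\<close> at arbitrarily small times.\<close>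

lemma energy_le:
  assumes y: "y \<in> L2 M" and x: "x \<in> domE M E"
    and obtuse: "\<And>t. 0 < t \<Longrightarrow> L2_inner M (sub (L2_space M) (T t y) y) (sub (L2_space M) x y) \<le> 0"
  shows "E y \<le> E x"
proof -
  let ?H = "L2_space M"
  have xL: "x \<in> L2 M" using x by (auto simp: domE_def)
  define g where "g s = (nrm ?H (sub ?H (T s y) x))\<^sup>2 / 2" for s
  have cont: "continuous_on {0..} g"
    unfolding g_def by (rule distance_continuous[OF y xL])
  \<comment> \<open>Expand \<open>\<parallel>(T\<^sub>t y - y) - (x - y)\<parallel>\<^sup>2\<close>; the mixed term has the right sign.\<close>
  have g0: "g 0 \<le> g t" if t: "0 < t" for t
  proof -
    have Ty: "T t y \<in> L2 M" using T_L2[OF y] t by simp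
    let ?d = "sub ?H (T t y) y" and ?e = "sub ?H x y"
    have de: "?d \<in> pts ?H" "?e \<in> pts ?H" using L2.pts_sub[of _ M y] Ty y xL by auto
    have "sub ?H (T t y) x = sub ?H ?d ?e"
      using Ty y xL by (intro L2.vector_eqI[of _ M]) (simp_all add: L2.pts_sub[of _ M, simplified])
    then have "(nrm ?H (sub ?H (T t y) x))\<^sup>2 = L2_inner M ?d ?d - 2 * L2_inner M ?d ?e + L2_inner M ?e ?e"
      using de L2.nrm_square[of "sub ?H ?d ?e" M] L2.pts_sub[OF de] L2.ip_commute[OF de]
      by (simp del: L2_space_simps add: L2.ip_sub_left[OF de] L2.ip_sub_right[OF de])
    moreover have "(nrm ?H (sub ?H (T 0 y) x))\<^sup>2 = L2_inner M ?e ?e"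
      using T_0[OF y] L2.nrm_sub_commute[of x M y] L2.nrm_square[OF de(2)] xL y by simp
    moreover have "0 \<le> L2_inner M ?d ?d" using L2.ip_nonneg[OF de(1)] .
    ultimately show ?thesis using obtuse[OF t] by (simp add: g_def)
  qed
  have "\<exists>t>0. t < 1 / real (Suc n) \<and> E (T t y) \<le> E x" for n
  proof (rule ccontr)
    assume "\<not> ?thesis"
    then have larger: "E x < E (T t y)" if "0 < t" "t < 1 / real (Suc n)" for t
      using that by (auto simp: not_le)
    \<comment> \<open>The distance is nonincreasing up to \<open>s\<close> and decreases strictly right after \<open>s\<close>.\<close>
    define s where "s = 1 / real (Suc n) / 2"
    have s: "0 < s" "s < 1 / real (Suc n)" by (auto simp: s_def field_simps)
    have "g s \<le> g 0"
    proof (rule right_derivative_nonpos_imp_le[of 0 s g])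
      show "continuous_on {0..s} g" using cont by (rule continuous_on_subset) auto
      show "\<exists>D\<le>0. (g has_real_derivative D) (at_right t)" if "0 < t" "t < s" for t
      proof -
        have "E x < E (T t y)" using larger[of t] that s by simp
        then show ?thesis
          using distance_derivative[OF y x that(1)] less_imp_le unfolding g_def by metis
      qed
    qed (use s in simp)
    obtain D where D: "(g has_real_derivative D) (at_right s)" "D < 0"
      using distance_derivative[OF y x s(1)] larger[OF s] unfolding g_def by metis
    then have "((\<lambda>r. (g r - g s) / (r - s)) \<longlongrightarrow> D) (at_right s)"
      by (simp add: has_field_derivative_iff)
    then have "\<forall>\<^sub>F r in at_right s. (g r - g s) / (r - s) < 0"
      using D(2) by (rule order_tendstoD(2))
    then have "\<forall>\<^sub>F r in at_right s. s < r \<and> g r < g s"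
      using eventually_at_right_less by eventually_elim (simp add: divide_less_0_iff)
    then obtain r where "s < r" "g r < g s"
      using eventually_happens[of _ "at_right s"] by auto
    then show False using g0[of r] \<open>g s \<le> g 0\<close> s by simp
  qed
  then obtain \<tau> where \<tau>: "\<And>n. 0 < \<tau> n" "\<And>n. \<tau> n < 1 / real (Suc n)" "\<And>n. E (T (\<tau> n) y) \<le> E x"
    by metis
  have "\<tau> \<longlonglongrightarrow> 0"
  proof (rule tendsto_sandwich[of "\<lambda>_. 0" \<tau> _ "\<lambda>n. 1 / real (Suc n)"])
    show "(\<lambda>n. 1 / real (Suc n)) \<longlonglongrightarrow> 0" by (rule LIMSEQ_Suc[OF lim_1_over_n])
    show "\<forall>\<^sub>F n in sequentially. 0 \<le> \<tau> n" using \<tau>(1) less_imp_le by (intro always_eventually) blast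
    show "\<forall>\<^sub>F n in sequentially. \<tau> n \<le> 1 / real (Suc n)" using \<tau>(2) less_imp_le by (intro always_eventually) blast
  qed simp
  then have "filterlim \<tau> (at 0 within {0..}) sequentially"
    unfolding filterlim_at using \<tau>(1) less_imp_le by (auto intro!: always_eventually simp: less_imp_neq[symmetric])
  from filterlim_compose[OF T_continuous[OF y order_refl] this]
  have "converges_nvs ?H (\<lambda>n. T (\<tau> n) y) y"
    by (simp add: converges_nvs_def T_0[OF y])
  then have "E y \<le> liminf (\<lambda>n. E (T (\<tau> n) y))"
    using lsc[unfolded lsc_functional_def, rule_format, of y "\<lambda>n. T (\<tau> n) y"]
      y T_L2[OF y less_imp_le[OF \<tau>(1)]] by simp
  also have "\<dots> \<le> E x" using \<tau>(3) by (intro Liminf_le always_eventually allI) auto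
  finally show ?thesis .
qed

end

section \<open>Contractions operate on the energy\<close>

lemma Lp_norm_1: "Lp_norm M 1 f = (\<integral>\<^sup>+x. ennreal \<bar>f x\<bar> \<partial>M)"
proof -
  have "\<bar>a\<bar> powr 1 = \<bar>a\<bar>" for a :: real by simp
  then have "Lp_norm M 1 f = (let I = (\<integral>\<^sup>+x. ennreal \<bar>f x\<bar> \<partial>M) in
     if I = \<infinity> then \<infinity> else ennreal (enn2real I powr (1 / 1)))"
    unfolding Lp_norm_def enn2real_1 by simp
  also have "\<dots> = (\<integral>\<^sup>+x. ennreal \<bar>f x\<bar> \<partial>M)"
    by (cases "(\<integral>\<^sup>+x. ennreal \<bar>f x\<bar> \<partial>M)") (simp_all add: Let_def)
  finally show ?thesis .
qed

lemma Lp_norm_infinity_le: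
  assumes "f \<in> borel_measurable M" "AE x in M. \<bar>f x\<bar> \<le> K"
  shows "Lp_norm M \<infinity> f \<le> ennreal K"
  unfolding Lp_norm_def using assms by (auto intro!: esssup_I ennreal_leI)

lemma AE_le_Lp_norm_infinity:
  assumes "Lp_norm M \<infinity> f \<le> ennreal K" "0 \<le> K"
  shows "AE x in M. \<bar>f x\<bar> \<le> K"
proof -
  have "AE x in M. ennreal \<bar>f x\<bar> \<le> ennreal K"
    using esssup_AE[of "\<lambda>x. ennreal \<bar>f x\<bar>" M] assms(1) by (auto simp: Lp_norm_def elim!: eventually_mono)
  then show ?thesis using assms(2) by simp
qed

locale dirichlet_flow = lsc_gradient_flow M E T + sigma_finite_measure M
  for M :: "'a measure" and E T +
  assumes E_zero: "E (L2_class M (\<lambda>x. 0)) = 0"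
    and contractive: "Lp_contractive M T"
    and order: "order_preserving M T"
begin

text \<open>The origin minimizes \<open>E\<close>, so the distance to the origin is nonincreasing along the flow.\<close>

lemma T_zero:
  assumes t: "0 < t"
  shows "T t (L2_class M (\<lambda>x. 0)) = L2_class M (\<lambda>x. 0)"
proof -
  let ?H = "L2_space M" and ?z = "L2_class M (\<lambda>x. 0)"
  have z: "?z \<in> L2 M" "?z \<in> domE M E" by (simp_all add: domE_def E_zero)
  define g where "g s = (nrm ?H (sub ?H (T s ?z) ?z))\<^sup>2 / 2" for s
  have "g t \<le> g 0"
  proof (rule right_derivative_nonpos_imp_le[of 0 t g])
    show "continuous_on {0..t} g"
      unfolding g_def using distance_continuous[OF z(1) z(1)] by (rule continuous_on_subset) auto
    show "\<exists>D\<le>0. (g has_real_derivative D) (at_right s)" if s: "0 < s" "s < t" for s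
      using distance_derivative[OF z s(1)] E_zero unfolding g_def by (metis zero_le)
  qed (use t in simp)
  also have "g 0 = 0"
    using T_0[OF z(1)] vector_space_sub_self[OF vector_space_L2, of ?z M] by (simp add: g_def inner_class)
  finally have "(nrm ?H (sub ?H (T t ?z) ?z))\<^sup>2 \<le> 0" by (simp add: g_def)
  moreover have Tz: "T t ?z \<in> L2 M" using T_L2[OF z(1)] t by simp
  ultimately have "nrm ?H (T t ?z) = 0"
    using L2.sub_null[of "T t ?z" M] by simp
  then show ?thesis
    using normed_zero[OF L2.normed, of "T t ?z" M] Tz by simp
qed

lemma T_contraction_map:
  assumes t: "0 < t"
  shows "contraction_map M (\<lambda>f. rep (T t (L2_class M f)))"
proof
  fix f g :: "'a \<Rightarrow> real" and K
  assume f: "f \<in> square_integrable M"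
  have Tf: "T t (L2_class M f) \<in> L2 M" using T_L2 f t by simp
  show Sf: "rep (T t (L2_class M f)) \<in> square_integrable M" by (rule rep_L2(1)[OF Tf])
  assume g: "g \<in> square_integrable M"
  have Tg: "T t (L2_class M g) \<in> L2 M" using T_L2 g t by simp
  note reps = rep_L2_class[OF f] rep_L2_class[OF g]
  have [measurable]: "f \<in> borel_measurable M" "g \<in> borel_measurable M"
    "rep (L2_class M f) \<in> borel_measurable M" "rep (L2_class M g) \<in> borel_measurable M"
    using f g rep_L2(1)[OF L2_class_in[OF f]] rep_L2(1)[OF L2_class_in[OF g]]
    by (auto intro: sqi_measurable)
  show "AE x in M. rep (T t (L2_class M f)) x \<le> rep (T t (L2_class M g)) x" if "AE x in M. f x \<le> g x"
  proof -
    have "AE x in M. rep (L2_class M f) x \<le> rep (L2_class M g) x"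
      using that reps by eventually_elim simp
    then show ?thesis
      using order f g t unfolding order_preserving_def by simp
  qed
  have contr: "Lp_norm M p (\<lambda>x. rep (T t (L2_class M f)) x - rep (T t (L2_class M g)) x)
      \<le> Lp_norm M p (\<lambda>x. rep (L2_class M f) x - rep (L2_class M g) x)" if "1 \<le> p" for p
    using contractive f g t that unfolding Lp_contractive_def by simp
  show "(\<integral>\<^sup>+x. ennreal \<bar>rep (T t (L2_class M f)) x - rep (T t (L2_class M g)) x\<bar> \<partial>M)
      \<le> (\<integral>\<^sup>+x. ennreal \<bar>f x - g x\<bar> \<partial>M)"
  proof -
    have "(\<integral>\<^sup>+x. ennreal \<bar>rep (L2_class M f) x - rep (L2_class M g) x\<bar> \<partial>M) = (\<integral>\<^sup>+x. ennreal \<bar>f x - g x\<bar> \<partial>M)"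
      using reps by (intro nn_integral_cong_AE) (auto elim!: eventually_elim2)
    then show ?thesis using contr[of 1] by (simp add: Lp_norm_1)
  qed
  show "AE x in M. \<bar>rep (T t (L2_class M f)) x - rep (T t (L2_class M g)) x\<bar> \<le> K"
    if K: "AE x in M. \<bar>f x - g x\<bar> \<le> K"
  proof (cases "0 \<le> K")
    case True
    have "AE x in M. \<bar>rep (L2_class M f) x - rep (L2_class M g) x\<bar> \<le> K"
      using K reps by eventually_elim simp
    then have "Lp_norm M \<infinity> (\<lambda>x. rep (L2_class M f) x - rep (L2_class M g) x) \<le> ennreal K"
      by (intro Lp_norm_infinity_le) measurable
    then show ?thesis
      using contr[of \<infinity>] True by (intro AE_le_Lp_norm_infinity) auto
  next
    case False
    then have "AE x in M. False" using K by (auto elim!: eventually_mono)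
    then show ?thesis by (rule eventually_mono) simp
  qed
next
  show "AE x in M. rep (T t (L2_class M (\<lambda>x. 0))) x = 0"
    using rep_L2_class[OF sqi_zero] by (simp add: T_zero[OF t])
qed

text \<open>The functions \<open>\<phi> \<circ> u\<close> and \<open>u - \<phi> \<circ> u\<close> are comonotone, so the flow that starts at \<open>\<phi> \<circ> u\<close>
  moves at an obtuse angle to the direction towards \<open>u\<close>.\<close>

theorem energy_comp_le:
  assumes u: "u \<in> domE M E" and mono: "mono \<phi>" and mono': "mono (\<lambda>s. s - \<phi> s)" and zero: "\<phi> 0 = 0"
  shows "L2_comp M \<phi> u \<in> domE M E" and "E (L2_comp M \<phi> u) \<le> E u"
proof -
  have uL: "u \<in> L2 M" using u by (simp add: domE_def)
  have ru: "rep u \<in> square_integrable M" by (rule rep_L2(1)[OF uL])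
  define f where "f x = \<phi> (rep u x)" for x
  define w where "w x = rep u x - f x" for x
  have le: "\<bar>\<phi> s\<bar> \<le> \<bar>s\<bar>" for s
    using monoD[OF mono, of 0 s] monoD[OF mono, of s 0] monoD[OF mono', of 0 s] monoD[OF mono', of s 0] zero
    by (cases "0 \<le> s") auto
  have [measurable]: "\<phi> \<in> borel_measurable borel" by (rule borel_measurable_mono[OF mono])
  have [measurable]: "rep u \<in> borel_measurable M" using ru by (rule sqi_measurable)
  have f: "f \<in> square_integrable M"
    unfolding f_def by (rule sqi_dominated[OF ru]) (auto simp: le)
  have w: "w \<in> square_integrable M" unfolding w_def by (rule sqi_diff[OF ru f])
  let ?y = "L2_class M f" and ?H = "L2_space M"
  have y: "L2_comp M \<phi> u = ?y" by (simp add: L2_comp_def f_def[abs_def])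
  have E_le: "E ?y \<le> E u"
  proof (rule energy_le[OF L2_class_in[OF f] u])
    fix t :: real assume t: "0 < t"
    interpret S: contraction_map M "\<lambda>f. rep (T t (L2_class M f))" by (rule T_contraction_map[OF t])
    let ?s = "rep (T t ?y)"
    have s: "?s \<in> square_integrable M" by (rule S.S_sqi[OF f])
    have Ty: "T t ?y = L2_class M ?s" using rep_L2(2)[OF T_L2[OF L2_class_in[OF f]]] t by simp
    have comonotone: "f x \<le> f z" if "w x < w z" for x z
    proof -
      have "rep u x \<le> rep u z"
        using that monoD[OF mono', of "rep u z" "rep u x"] by (fastforce simp: w_def f_def)
      then show ?thesis unfolding f_def by (rule monoD[OF mono])
    qed
    have pos: "0 \<le> f x" if "0 < w x" for x
      using that monoD[OF mono', of "rep u x" 0] monoD[OF mono, of 0 "rep u x"] zero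
      by (cases "0 \<le> rep u x") (auto simp: w_def f_def)
    have neg: "f x \<le> 0" if "w x < 0" for x
      using that monoD[OF mono', of 0 "rep u x"] monoD[OF mono, of "rep u x" 0] zero
      by (cases "0 \<le> rep u x") (auto simp: w_def f_def)
    have "L2_inner M (sub ?H (T t ?y) ?y) (sub ?H u ?y)
        = L2_inner M (sub ?H (L2_class M ?s) ?y) (sub ?H (L2_class M (rep u)) ?y)"
      using Ty rep_L2(2)[OF uL] by simp
    also have "\<dots> = (\<integral>x. (?s x - f x) * w x \<partial>M)"
      using s f ru by (simp add: sub_class inner_class sqi_diff w_def)
    also have "\<dots> = (\<integral>x. ?s x * w x \<partial>M) - (\<integral>x. f x * w x \<partial>M)"
      using sqi_integrable_mult[OF s w] sqi_integrable_mult[OF f w] by (simp add: left_diff_distrib)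
    also have "\<dots> \<le> 0"
      using S.comonotone_pairing_le[OF f w comonotone pos neg] by simp
    finally show "L2_inner M (sub ?H (T t ?y) ?y) (sub ?H u ?y) \<le> 0" .
  qed
  then show "E (L2_comp M \<phi> u) \<le> E u" by (simp add: y)
  show "L2_comp M \<phi> u \<in> domE M E"
    using E_le u f by (auto simp: domE_def y top_unique)
qed

end

section \<open>The energy seminorm\<close>

locale homogeneous_energy =
  fixes M :: "'a measure" and E :: "('a \<Rightarrow> real) set \<Rightarrow> ennreal"
  assumes convex: "convex_functional M E" and homogeneous: "two_homogeneous M E"
    and lsc: "lsc_functional M E"
begin

definition energy_root :: "('a \<Rightarrow> real) set \<Rightarrow> real" where "energy_root u = sqrt (enn2real (E u))"

lemma energy_root_nonneg: "0 \<le> energy_root u" and energy_root_square: "(energy_root u)\<^sup>2 = enn2real (E u)"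
  by (simp_all add: energy_root_def)

lemma domE_L2: "u \<in> domE M E \<Longrightarrow> u \<in> L2 M"
  by (simp add: domE_def)

lemma E_energy_root: "u \<in> domE M E \<Longrightarrow> E u = ennreal ((energy_root u)\<^sup>2)"
  by (auto simp: domE_def energy_root_square ennreal_enn2real_if)

lemma E_scale: "u \<in> L2 M \<Longrightarrow> E (scale (L2_space M) c u) = ennreal (c\<^sup>2) * E u"
  using homogeneous by (simp add: two_homogeneous_def)

lemma E_null: "E (L2_class M (\<lambda>x. 0)) = 0"
  using E_scale[of "L2_class M (\<lambda>x. 0)" 0] by (simp add: scale_class)

lemma domE_scale:
  assumes u: "u \<in> domE M E"
  shows "scale (L2_space M) c u \<in> domE M E" and "energy_root (scale (L2_space M) c u) = \<bar>c\<bar> * energy_root u"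
proof -
  have s: "E (scale (L2_space M) c u) = ennreal (c\<^sup>2 * (energy_root u)\<^sup>2)"
    using E_scale[OF domE_L2[OF u]] E_energy_root[OF u] by (simp add: ennreal_mult)
  then show "scale (L2_space M) c u \<in> domE M E"
    using L2.pts_scale[of u M c] domE_L2[OF u] by (simp add: domE_def)
  show "energy_root (scale (L2_space M) c u) = \<bar>c\<bar> * energy_root u"
    using energy_root_nonneg[of u] by (simp add: energy_root_def[of "scale _ _ _"] s real_sqrt_mult)
qed

text \<open>By convexity and homogeneity \<open>E (u + v) \<le> E u / (1 - t) + E v / t\<close> for \<open>0 < t < 1\<close>. The choice
  of \<open>t\<close> proportional to \<open>\<surd>E v\<close> gives the triangle inequality for \<open>\<surd>E\<close>; adding \<open>d > 0\<close> to both seminorms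
  covers the case where one of them vanishes.\<close>

lemma domE_add:
  assumes u: "u \<in> domE M E" and v: "v \<in> domE M E"
  shows "add (L2_space M) u v \<in> domE M E" and "energy_root (add (L2_space M) u v) \<le> energy_root u + energy_root v"
proof -
  let ?H = "L2_space M"
  have uL: "u \<in> L2 M" and vL: "v \<in> L2 M" using u v by (auto simp: domE_L2)
  have bound: "E (add ?H u v) \<le> ennreal ((energy_root u + energy_root v + 2 * d)\<^sup>2)" if d: "0 < d" for d
  proof -
    define a where "a = energy_root u + d"
    define b where "b = energy_root v + d"
    define t where "t = b / (a + b)"
    have ab: "0 < a" "0 < b" using d energy_root_nonneg[of u] energy_root_nonneg[of v] by (auto simp: a_def b_def)
    have t: "0 < t" "t < 1" and t1: "1 - t = a / (a + b)" using ab by (auto simp: t_def field_simps)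
    let ?u = "scale ?H (1 / (1 - t)) u" and ?v = "scale ?H (1 / t) v"
    have uv: "?u \<in> L2 M" "?v \<in> L2 M" using L2.pts_scale[of _ M] uL vL by auto
    have "add ?H u v = add ?H (scale ?H (1 - t) ?u) (scale ?H t ?v)"
      using vector_space_scale_scale[OF vector_space_L2, of _ M] vector_space_scale_1[OF vector_space_L2, of _ M]
        uL vL t by simp
    then have "E (add ?H u v) \<le> ennreal (1 - t) * E ?u + ennreal t * E ?v"
      using convex uv t unfolding convex_functional_def by simp
    also have "\<dots> = ennreal ((1 - t) * ((1 / (1 - t))\<^sup>2 * (energy_root u)\<^sup>2) + t * ((1 / t)\<^sup>2 * (energy_root v)\<^sup>2))"
    proof -
      have "ennreal r * E (scale ?H c w) = ennreal (r * (c\<^sup>2 * (energy_root w)\<^sup>2))"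
        if "w \<in> domE M E" "0 \<le> r" for r c w
        unfolding E_scale[OF domE_L2[OF that(1)]] E_energy_root[OF that(1)] using that(2)
        by (simp add: ennreal_mult[symmetric])
      then show ?thesis using u v t by (simp add: ennreal_plus[symmetric] del: ennreal_plus)
    qed
    also have "\<dots> \<le> ennreal ((a + b)\<^sup>2)"
    proof (rule ennreal_leI)
      have cancel: "s * ((1 / s)\<^sup>2 * x) = x / s" if "0 < s" for s x :: real
        using that by (simp add: power2_eq_square field_simps)
      have "(1 - t) * ((1 / (1 - t))\<^sup>2 * (energy_root u)\<^sup>2) = (energy_root u)\<^sup>2 * (a + b) / a"
        unfolding t1 using cancel[of "a / (a + b)" "(energy_root u)\<^sup>2"] ab by simp
      also have "\<dots> \<le> a\<^sup>2 * (a + b) / a"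
        using ab d energy_root_nonneg[of u] by (intro divide_right_mono mult_right_mono power_mono) (auto simp: a_def)
      also have "\<dots> = a * (a + b)" using ab by (simp add: power2_eq_square)
      finally have 1: "(1 - t) * ((1 / (1 - t))\<^sup>2 * (energy_root u)\<^sup>2) \<le> a * (a + b)" .
      have "t * ((1 / t)\<^sup>2 * (energy_root v)\<^sup>2) = (energy_root v)\<^sup>2 * (a + b) / b"
        using cancel[of t "(energy_root v)\<^sup>2"] t by (simp add: t_def)
      also have "\<dots> \<le> b\<^sup>2 * (a + b) / b"
        using ab d energy_root_nonneg[of v] by (intro divide_right_mono mult_right_mono power_mono) (auto simp: b_def)
      also have "\<dots> = b * (a + b)" using ab by (simp add: power2_eq_square)
      finally show "(1 - t) * ((1 / (1 - t))\<^sup>2 * (energy_root u)\<^sup>2) + t * ((1 / t)\<^sup>2 * (energy_root v)\<^sup>2) \<le> (a + b)\<^sup>2"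
        using 1 by (simp add: power2_eq_square algebra_simps)
    qed
    also have "a + b = energy_root u + energy_root v + 2 * d" by (simp add: a_def b_def)
    finally show ?thesis .
  qed
  have "E (add ?H u v) \<noteq> \<infinity>" using bound[of 1] by (auto simp: top_unique)
  then show dom: "add ?H u v \<in> domE M E"
    using L2.pts_add[of u M v] uL vL by (simp add: domE_def)
  show "energy_root (add ?H u v) \<le> energy_root u + energy_root v"
  proof (rule field_le_epsilon)
    fix d :: real assume d: "0 < d"
    show "energy_root (add ?H u v) \<le> energy_root u + energy_root v + d"
    proof (rule power2_le_imp_le)
      show "(energy_root (add ?H u v))\<^sup>2 \<le> (energy_root u + energy_root v + d)\<^sup>2"
        using bound[of "d/2"] d unfolding E_energy_root[OF dom] by simp
      show "0 \<le> energy_root u + energy_root v + d" using d energy_root_nonneg[of u] energy_root_nonneg[of v] by linarith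
    qed
  qed
qed

lemma domE_subspace: "subspace_nvs (L2_space M) (domE M E)"
  unfolding subspace_nvs_def
  using domE_add(1) domE_scale(1) by (auto simp: domE_L2) (simp add: domE_def E_null)

definition energy_norm :: "('a \<Rightarrow> real) set \<Rightarrow> real" where
  "energy_norm u = sqrt ((nrm (L2_space M) u)\<^sup>2 + enn2real (E u))"

lemma energy_space_eq: "energy_space M E = (L2_space M)\<lparr>pts := domE M E, nrm := energy_norm\<rparr>"
  unfolding energy_space_def energy_norm_def[abs_def] ..

text \<open>On a ball \<open>E (u\<^sub>n) \<le> c\<^sup>2 - \<parallel>u\<^sub>n\<parallel>\<^sup>2\<close>, and under convergence in \<open>L\<^sup>2\<close> the right-hand side converges while the
  left-hand side is lower semicontinuous.\<close>

sublocale energy: closed_ball_norm "L2_space M" "L2_inner M" "domE M E" energy_norm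
proof
  let ?H = "L2_space M"
  have en: "energy_norm u = sqrt ((nrm ?H u)\<^sup>2 + (energy_root u)\<^sup>2)" for u
    by (simp add: energy_norm_def energy_root_square)
  show "subspace_nvs ?H (domE M E)" by (rule domE_subspace)
  fix x assume x: "x \<in> domE M E"
  have xL: "x \<in> pts ?H" using x by (simp add: domE_L2)
  show "energy_norm (scale ?H c x) = \<bar>c\<bar> * energy_norm x" for c
  proof -
    have "(nrm ?H (scale ?H c x))\<^sup>2 + (energy_root (scale ?H c x))\<^sup>2 = c\<^sup>2 * ((nrm ?H x)\<^sup>2 + (energy_root x)\<^sup>2)"
      unfolding L2.nrm_scale[OF xL] domE_scale(2)[OF x] by (simp add: power_mult_distrib algebra_simps)
    then show ?thesis unfolding en by (simp add: real_sqrt_mult)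
  qed
  show "nrm ?H x \<le> energy_norm x"
    unfolding en by (rule real_le_rsqrt) simp
  fix y assume y: "y \<in> domE M E"
  have yL: "y \<in> pts ?H" using y by (simp add: domE_L2)
  have "energy_norm (add ?H x y) \<le> sqrt ((nrm ?H x + nrm ?H y)\<^sup>2 + (energy_root x + energy_root y)\<^sup>2)"
    unfolding en using L2.nrm_add_le[OF xL yL] domE_add(2)[OF x y] L2.nrm_nonneg[OF L2.pts_add[OF xL yL]]
    by (intro real_sqrt_le_mono add_mono power_mono energy_root_nonneg)
  also have "\<dots> \<le> energy_norm x + energy_norm y"
    unfolding en by (rule real_sqrt_sum_squares_triangle_ineq)
  finally show "energy_norm (add ?H x y) \<le> energy_norm x + energy_norm y" .
next
  let ?H = "L2_space M"
  fix u c l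
  assume u: "\<And>n. u n \<in> domE M E" and c: "\<And>n. energy_norm (u n) \<le> c"
    and l: "l \<in> pts ?H" and lim: "converges_nvs ?H u l"
  have uL: "u n \<in> pts ?H" for n using u by (simp add: domE_L2)
  have "(\<lambda>n. nrm ?H (sub ?H (u n) (null ?H))) \<longlonglongrightarrow> nrm ?H (sub ?H l (null ?H))"
    by (rule L2.converges_nrm[OF uL l lim L2.pts_null])
  then have "(\<lambda>n. nrm ?H (u n)) \<longlonglongrightarrow> nrm ?H l"
    unfolding L2.sub_null[OF uL] L2.sub_null[OF l] .
  then have diff: "(\<lambda>n. c\<^sup>2 - (nrm ?H (u n))\<^sup>2) \<longlonglongrightarrow> c\<^sup>2 - (nrm ?H l)\<^sup>2"
    by (intro tendsto_intros)
  have le: "enn2real (E (u n)) \<le> c\<^sup>2 - (nrm ?H (u n))\<^sup>2" for n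
  proof -
    have "(energy_norm (u n))\<^sup>2 \<le> c\<^sup>2"
      using c[of n] by (intro power_mono) (simp_all add: energy_norm_def)
    then show ?thesis by (simp add: energy_norm_def del: L2_space_simps)
  qed
  have nn: "0 \<le> c\<^sup>2 - (nrm ?H l)\<^sup>2"
    using le order_trans[OF enn2real_nonneg] by (intro LIMSEQ_le_const[OF diff]) blast
  have "E l \<le> liminf (\<lambda>n. E (u n))"
    using lsc[unfolded lsc_functional_def, rule_format, of l u] lim l uL by simp
  also have "\<dots> \<le> liminf (\<lambda>n. ennreal (c\<^sup>2 - (nrm ?H (u n))\<^sup>2))"
  proof (intro Liminf_mono always_eventually allI)
    fix n show "E (u n) \<le> ennreal (c\<^sup>2 - (nrm ?H (u n))\<^sup>2)"
      using ennreal_leI[OF le[of n]] u[of n] by (simp add: domE_def less_top del: L2_space_simps)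
  qed
  also have "\<dots> = ennreal (c\<^sup>2 - (nrm ?H l)\<^sup>2)"
    using diff by (intro lim_imp_Liminf tendsto_ennrealI) auto
  finally have El: "E l \<le> ennreal (c\<^sup>2 - (nrm ?H l)\<^sup>2)" .
  then have dom: "l \<in> domE M E" using l by (auto simp: domE_def top_unique)
  have "(nrm ?H l)\<^sup>2 + enn2real (E l) \<le> c\<^sup>2"
    using enn2real_mono[OF El] nn by simp
  moreover have "0 \<le> c" using c[of 0] order_trans[of 0 "energy_norm (u 0)" c] by (simp add: energy_norm_def)
  ultimately have "energy_norm l \<le> c"
    unfolding energy_norm_def by (intro real_le_lsqrt) auto
  with dom show "l \<in> domE M E \<and> energy_norm l \<le> c" ..
qed

end

section \<open>Lipschitz functions and bounded functions of finite energy\<close>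

lemma Linf_iff:
  assumes u: "u \<in> L2 M"
  shows "u \<in> Linf M \<longleftrightarrow> (\<exists>K\<ge>0. AE x in M. \<bar>rep u x\<bar> \<le> K)"
proof
  have [measurable]: "rep u \<in> borel_measurable M" using rep_L2(1)[OF u] by (rule sqi_measurable)
  assume "u \<in> Linf M"
  then have "Lp_norm M \<infinity> (rep u) < \<infinity>" by (simp add: Linf_def)
  then obtain K where "0 \<le> K" "Lp_norm M \<infinity> (rep u) = ennreal K"
    by (cases "Lp_norm M \<infinity> (rep u)") auto
  then show "\<exists>K\<ge>0. AE x in M. \<bar>rep u x\<bar> \<le> K"
    using AE_le_Lp_norm_infinity[of M "rep u" K] by auto
next
  have [measurable]: "rep u \<in> borel_measurable M" using rep_L2(1)[OF u] by (rule sqi_measurable)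
  assume "\<exists>K\<ge>0. AE x in M. \<bar>rep u x\<bar> \<le> K"
  then obtain K where "AE x in M. \<bar>rep u x\<bar> \<le> K" by blast
  then have "Lp_norm M \<infinity> (rep u) \<le> ennreal K" by (intro Lp_norm_infinity_le) measurable
  also have "\<dots> < \<infinity>" by simp
  finally show "u \<in> Linf M" using u by (simp add: Linf_def)
qed

lemma class_Linf:
  assumes f: "f \<in> square_integrable M" and K: "AE x in M. \<bar>f x\<bar> \<le> K" "0 \<le> K"
  shows "L2_class M f \<in> Linf M"
proof -
  have "AE x in M. \<bar>rep (L2_class M f) x\<bar> \<le> K"
    using rep_L2_class[OF f] K(1) by eventually_elim simp
  then show ?thesis using f K(2) by (auto simp: Linf_iff)
qed

text \<open>Squaring is not Lipschitz, but after a truncation at height \<open>R\<close> it is.\<close>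

lemma Lipschitz_square_clip:
  fixes R :: real
  assumes R: "0 \<le> R"
  shows "(2 * R)-lipschitz_on UNIV (\<lambda>s. (max (- R) (min s R))\<^sup>2)"
proof (rule lipschitz_onI)
  fix s t :: real
  define a where "a = max (- R) (min s R)"
  define b where "b = max (- R) (min t R)"
  have "\<bar>a + b\<bar> \<le> 2 * R" "\<bar>a - b\<bar> \<le> \<bar>s - t\<bar>" using R by (auto simp: a_def b_def max_def min_def)
  then have "\<bar>a + b\<bar> * \<bar>a - b\<bar> \<le> 2 * R * \<bar>s - t\<bar>" using R by (intro mult_mono) auto
  moreover have "a\<^sup>2 - b\<^sup>2 = (a + b) * (a - b)" by (simp add: power2_eq_square algebra_simps)
  ultimately show "dist ((max (- R) (min s R))\<^sup>2) ((max (- R) (min t R))\<^sup>2) \<le> 2 * R * dist s t"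
    unfolding dist_real_def a_def[symmetric] b_def[symmetric] by (simp only: abs_mult)
qed (use R in simp)

locale homogeneous_dirichlet_form = homogeneous_energy M E + dirichlet_flow M E T
  for M :: "'a measure" and E T
begin

text \<open>If \<open>\<phi>\<close> has Lipschitz constant \<open>c\<close>, then \<open>p = (id + \<phi> / c) / 2\<close> and \<open>id - p\<close> are nondecreasing, and
  \<open>\<phi> = c (2 p - id)\<close> is a linear combination of functions that operate.\<close>

theorem Lipschitz_operates:
  assumes lip: "C-lipschitz_on UNIV \<phi>" and zero: "\<phi> 0 = 0" and u: "u \<in> domE M E"
  shows "L2_comp M \<phi> u \<in> domE M E"
proof -
  define c where "c = max C 1"
  define \<psi> where "\<psi> s = \<phi> s / c" for s
  define p where "p s = (s + \<psi> s) / 2" for s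
  have c: "0 < c" by (simp add: c_def)
  have lip': "\<bar>\<psi> s - \<psi> t\<bar> \<le> \<bar>s - t\<bar>" for s t
  proof -
    have "\<bar>\<phi> s - \<phi> t\<bar> \<le> C * \<bar>s - t\<bar>"
      using lipschitz_onD[OF lip, of s t] by (simp add: dist_real_def)
    also have "\<dots> \<le> c * \<bar>s - t\<bar>" by (intro mult_right_mono) (auto simp: c_def)
    finally show ?thesis
      using c by (simp add: \<psi>_def diff_divide_distrib[symmetric] abs_divide divide_le_eq mult.commute)
  qed
  have "mono p"
  proof (rule monoI)
    fix s t :: real assume "s \<le> t"
    then show "p s \<le> p t" using lip'[of s t] by (auto simp: p_def abs_le_iff)
  qed
  moreover have "mono (\<lambda>s. s - p s)"
  proof (rule monoI)
    fix s t :: real assume "s \<le> t"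
    then have "\<psi> t - \<psi> s \<le> t - s" using lip'[of s t] by (auto simp: abs_le_iff)
    then show "s - p s \<le> t - p t" by (simp add: p_def field_simps)
  qed
  ultimately have pu: "L2_comp M p u \<in> domE M E"
    using energy_comp_le(1)[OF u, of p] zero by (simp add: p_def \<psi>_def)
  let ?H = "L2_space M"
  let ?v = "scale ?H c (sub ?H (scale ?H 2 (L2_comp M p u)) u)"
  have v: "?v \<in> domE M E"
    by (intro energy.D_scale energy.D_sub pu u)
  have ru: "rep u \<in> square_integrable M" "L2_class M (rep u) = u"
    using rep_L2[OF domE_L2[OF u]] by auto
  have [measurable]: "p \<in> borel_measurable borel" by (rule borel_measurable_mono[OF \<open>mono p\<close>])
  have [measurable]: "rep u \<in> borel_measurable M" using ru(1) by (rule sqi_measurable)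
  have "\<bar>p s\<bar> \<le> \<bar>s\<bar>" for s
  proof -
    have "\<psi> 0 = 0" using zero by (simp add: \<psi>_def)
    then have "\<bar>s + \<psi> s\<bar> \<le> \<bar>s\<bar> + \<bar>s\<bar>"
      using lip'[of s 0] abs_triangle_ineq[of s "\<psi> s"] by simp
    then show ?thesis by (simp add: p_def)
  qed
  then have prs: "(\<lambda>x. p (rep u x)) \<in> square_integrable M"
    by (intro sqi_dominated[OF ru(1)]) auto
  have "?v = scale ?H c (sub ?H (scale ?H 2 (L2_class M (\<lambda>x. p (rep u x)))) (L2_class M (rep u)))"
    by (simp only: L2_comp_def ru(2))
  also have "\<dots> = L2_class M (\<lambda>x. c * (2 * p (rep u x) - rep u x))"
    using prs ru(1) by (simp add: scale_class sub_class sqi_scale sqi_diff)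
  also have "(\<lambda>x. c * (2 * p (rep u x) - rep u x)) = (\<lambda>x. \<phi> (rep u x))"
    using c by (auto simp: p_def \<psi>_def field_simps)
  finally show ?thesis using v by (simp add: L2_comp_def)
qed

lemma Linf_subspace: "subspace_nvs (L2_space M) (domE M E \<inter> Linf M)"
  unfolding subspace_nvs_def
proof (intro conjI ballI allI)
  show "domE M E \<inter> Linf M \<subseteq> pts (L2_space M)" by (auto simp: domE_L2)
  show "null (L2_space M) \<in> domE M E \<inter> Linf M"
    using energy.D_null class_Linf[OF sqi_zero, of 0 M] by simp
next
  fix u v assume "u \<in> domE M E \<inter> Linf M" "v \<in> domE M E \<inter> Linf M"
  then have uv: "u \<in> domE M E" "v \<in> domE M E" "u \<in> Linf M" "v \<in> Linf M" by auto
  note L = uv(1,2)[THEN domE_L2]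
  obtain K where K: "0 \<le> K" "AE x in M. \<bar>rep u x\<bar> \<le> K" using uv(3) Linf_iff[OF L(1)] by auto
  obtain K' where K': "0 \<le> K'" "AE x in M. \<bar>rep v x\<bar> \<le> K'" using uv(4) Linf_iff[OF L(2)] by auto
  have "AE x in M. \<bar>rep u x + rep v x\<bar> \<le> K + K'" using K(2) K'(2) by eventually_elim simp
  then have "L2_class M (\<lambda>x. rep u x + rep v x) \<in> Linf M"
    using K(1) K'(1) rep_L2(1)[OF L(1)] rep_L2(1)[OF L(2)] by (intro class_Linf[of _ _ "K + K'"] sqi_add) auto
  then show "add (L2_space M) u v \<in> domE M E \<inter> Linf M"
    using energy.D_add[OF uv(1,2)] by (simp add: L2_space_def)
next
  fix c u assume "u \<in> domE M E \<inter> Linf M"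
  then have u: "u \<in> domE M E" "u \<in> Linf M" by auto
  note L = u(1)[THEN domE_L2]
  obtain K where K: "0 \<le> K" "AE x in M. \<bar>rep u x\<bar> \<le> K" using u(2) Linf_iff[OF L] by auto
  have "AE x in M. \<bar>c * rep u x\<bar> \<le> \<bar>c\<bar> * K"
    using K(2) by eventually_elim (simp add: abs_mult mult_left_mono)
  then have "L2_class M (\<lambda>x. c * rep u x) \<in> Linf M"
    using K(1) rep_L2(1)[OF L] by (intro class_Linf[of _ _ "\<bar>c\<bar> * K"] sqi_scale) auto
  then show "scale (L2_space M) c u \<in> domE M E \<inter> Linf M"
    using energy.D_scale[OF u(1)] by (simp add: L2_space_def)
qed

text \<open>Polarization reduces products to squares, and on bounded functions the square agrees with a
  Lipschitz function.\<close>

theorem Linf_algebra: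
  assumes u: "u \<in> domE M E \<inter> Linf M" and v: "v \<in> domE M E \<inter> Linf M"
  shows "L2_mult M u v \<in> domE M E \<inter> Linf M"
proof -
  have uv: "u \<in> domE M E" "v \<in> domE M E" "u \<in> Linf M" "v \<in> Linf M" using u v by auto
  note L = uv(1,2)[THEN domE_L2]
  let ?H = "L2_space M" and ?f = "rep u" and ?g = "rep v"
  have f: "?f \<in> square_integrable M" and g: "?g \<in> square_integrable M"
    using rep_L2(1) L by auto
  have [measurable]: "?f \<in> borel_measurable M" "?g \<in> borel_measurable M"
    using f g by (auto intro: sqi_measurable)
  obtain K where K: "0 \<le> K" "AE x in M. \<bar>?f x\<bar> \<le> K" using uv(3) Linf_iff[OF L(1)] by auto
  obtain K' where K': "0 \<le> K'" "AE x in M. \<bar>?g x\<bar> \<le> K'" using uv(4) Linf_iff[OF L(2)] by auto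
  \<comment> \<open>The height \<open>K + K'\<close> bounds \<open>u\<close>, \<open>v\<close> and \<open>u + v\<close>, so \<open>q\<close> squares all three.\<close>
  define q where "q s = (max (- (K + K')) (min s (K + K')))\<^sup>2" for s :: real
  have q: "q s = s\<^sup>2" if "\<bar>s\<bar> \<le> K + K'" for s using that by (auto simp: q_def max_def min_def)
  have q_le: "\<bar>q s\<bar> \<le> \<bar>(K + K') * s\<bar>" for s
  proof -
    define m where "m = max (- (K + K')) (min s (K + K'))"
    have m: "\<bar>m\<bar> \<le> K + K'" "\<bar>m\<bar> \<le> \<bar>s\<bar>"
      using K(1) K'(1) by (auto simp: m_def max_def min_def)
    have "\<bar>m\<bar> * \<bar>m\<bar> \<le> (K + K') * \<bar>s\<bar>"
      by (rule mult_mono[OF m]) (use K(1) K'(1) in simp_all)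
    then show ?thesis
      using K(1) K'(1) unfolding q_def m_def[symmetric] power2_eq_square abs_mult by simp
  qed
  have [measurable]: "q \<in> borel_measurable borel" unfolding q_def by measurable
  have q_dom: "L2_comp M q w \<in> domE M E" if "w \<in> domE M E" for w
    using Lipschitz_operates[OF Lipschitz_square_clip[of "K + K'"] _ that] K(1) K'(1)
    by (simp add: q_def[abs_def])
  have q_sqi: "(\<lambda>x. q (h x)) \<in> square_integrable M" if "h \<in> square_integrable M" for h
    using sqi_dominated[OF sqi_scale[OF that], of "\<lambda>x. q (h x)" "K + K'"] q_le that sqi_measurable[OF that]
    by simp
  let ?s = "add ?H u v"
  have s: "?s \<in> domE M E" by (rule energy.D_add[OF uv(1,2)])
  have rs: "AE x in M. rep ?s x = ?f x + ?g x"
    using rep_L2_class[OF sqi_add[OF f g]] by (simp add: L2_space_def)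
  let ?w = "scale ?H (1/2) (sub ?H (sub ?H (L2_comp M q ?s) (L2_comp M q u)) (L2_comp M q v))"
  have w: "?w \<in> domE M E"
    by (intro energy.D_scale energy.D_sub q_dom s uv)
  have "?w = L2_class M (\<lambda>x. 1/2 * (q (rep ?s x) - q (?f x) - q (?g x)))"
    using q_sqi[OF f] q_sqi[OF g] q_sqi[OF rep_L2(1)[OF domE_L2[OF s]]]
    unfolding L2_comp_def by (simp add: sub_class scale_class sqi_diff)
  also have "\<dots> = L2_class M (\<lambda>x. ?f x * ?g x)"
  proof (rule L2_class_cong)
    show "AE x in M. 1/2 * (q (rep ?s x) - q (?f x) - q (?g x)) = ?f x * ?g x"
      using rs K(2) K'(2)
    proof eventually_elim
      case (elim x)
      then have "q (rep ?s x) = (?f x + ?g x)\<^sup>2" "q (?f x) = (?f x)\<^sup>2" "q (?g x) = (?g x)\<^sup>2"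
        using q[of "?f x + ?g x"] q[of "?f x"] q[of "?g x"] K(1) K'(1) by auto
      then show ?case by (simp add: power2_sum)
    qed
  qed
  finally have "L2_mult M u v \<in> domE M E" using w by (simp add: L2_mult_def)
  moreover have "L2_mult M u v \<in> Linf M"
    unfolding L2_mult_def
  proof (rule class_Linf)
    show "AE x in M. \<bar>?f x * ?g x\<bar> \<le> K * K'"
      using K(2) K'(2) by eventually_elim (simp add: abs_mult mult_mono K(1))
    show "(\<lambda>x. ?f x * ?g x) \<in> square_integrable M"
    proof (rule sqi_dominated[OF sqi_scale[OF g]])
      show "AE x in M. \<bar>?f x * ?g x\<bar> \<le> \<bar>K * ?g x\<bar>"
        using K(2) by eventually_elim (simp add: abs_mult mult_right_mono K(1))
    qed measurable
  qed (use K(1) K'(1) in simp)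
  ultimately show ?thesis by simp
qed

section \<open>Hilbert spaces and quadratic forms\<close>

text \<open>The \<open>L\<^sup>2\<close> inner product is bilinear, so \<open>\<parallel>u\<parallel>\<^sup>2 + E u\<close> comes from a bilinear form if and only if
  \<open>E\<close> does. The unit contraction is one of the functions that do not increase the energy.\<close>

theorem hilbert_iff_quadratic:
  assumes dense: "dense_in_L2 M (domE M E)"
  shows "hilbert_nvs (energy_space M E) \<longleftrightarrow> quadratic_dirichlet_form M E"
proof -
  let ?H = "L2_space M"
  have ops: "pts (energy_space M E) = domE M E" "add (energy_space M E) = add ?H"
    "scale (energy_space M E) = scale ?H"
    "\<And>u. u \<in> domE M E \<Longrightarrow> (nrm (energy_space M E) u)\<^sup>2 = L2_inner M u u + enn2real (E u)"
    using L2.nrm_square[of _ M] L2.ip_nonneg[of _ M]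
    by (simp_all add: energy_space_eq energy_norm_def domE_L2)
  have bil: "symmetric_bilinear_nvs (energy_space M E) (domE M E) a = symmetric_bilinear_nvs ?H (domE M E) a" for a
    by (simp add: symmetric_bilinear_nvs_def ops)
  have inner: "symmetric_bilinear_nvs ?H (domE M E) (L2_inner M)"
    using L2.ip_commute[of _ M] L2.ip_add_left[of _ M] L2.ip_scale_left[of _ M] domE_L2
    by (simp add: symmetric_bilinear_nvs_def)
  have comb: "symmetric_bilinear_nvs ?H (domE M E) (\<lambda>u v. a u v + r * b u v)"
    if "symmetric_bilinear_nvs ?H (domE M E) a" "symmetric_bilinear_nvs ?H (domE M E) b" for a b r
    using that unfolding symmetric_bilinear_nvs_def by (simp add: algebra_simps)
  have markov: "E (L2_comp M (\<lambda>s. min (max 0 s) 1) u) \<le> E u" if "u \<in> domE M E" for u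
    by (rule energy_comp_le(2)[OF that]) (auto intro!: monoI simp: min_def max_def)
  have banach: "banach_nvs (energy_space M E)"
    unfolding energy_space_eq by (rule energy.W_banach)
  show ?thesis
  proof
    assume "hilbert_nvs (energy_space M E)"
    then obtain a where a: "symmetric_bilinear_nvs ?H (domE M E) a"
      "\<And>u. u \<in> domE M E \<Longrightarrow> L2_inner M u u + enn2real (E u) = a u u"
      unfolding hilbert_nvs_def ops(1) bil using ops(4) by metis
    have "quadratic_functional M E"
      unfolding quadratic_functional_def
    proof (intro exI conjI ballI)
      show "symmetric_bilinear_nvs ?H (domE M E) (\<lambda>u v. a u v + (-1) * L2_inner M u v)"
        by (rule comb[OF a(1) inner])
      show "enn2real (E u) = a u u + (-1) * L2_inner M u u" if "u \<in> domE M E" for u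
        using a(2)[OF that] by simp
    qed
    then show "quadratic_dirichlet_form M E"
      using domE_subspace dense lsc markov by (simp add: quadratic_dirichlet_form_def)
  next
    assume "quadratic_dirichlet_form M E"
    then obtain a where a: "symmetric_bilinear_nvs ?H (domE M E) a"
      "\<And>u. u \<in> domE M E \<Longrightarrow> enn2real (E u) = a u u"
      unfolding quadratic_dirichlet_form_def quadratic_functional_def by blast
    have "symmetric_bilinear_nvs (energy_space M E) (pts (energy_space M E)) (\<lambda>u v. L2_inner M u v + 1 * a u v)"
      unfolding ops(1) bil by (rule comb[OF inner a(1)])
    then show "hilbert_nvs (energy_space M E)"
      unfolding hilbert_nvs_def using banach ops(1,4) a(2)
      by (intro conjI exI[of _ "\<lambda>u v. L2_inner M u v + 1 * a u v"]) auto
  qed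
qed

end

theorem theorem4p1:
  fixes M :: "'a measure" and E :: "('a \<Rightarrow> real) set \<Rightarrow> ennreal"
  assumes "sigma_finite_measure M"
    and "borel_isomorphic_to_real M"
    and "nonlinear_dirichlet_form M E"
    and "two_homogeneous M E"
  shows "(subspace_nvs (L2_space M) (domE M E) \<and>
          normed_nvs (energy_space M E) \<and>
          banach_nvs (energy_space M E)) \<and>
         (hilbert_nvs (energy_space M E) \<longleftrightarrow> quadratic_dirichlet_form M E) \<and>
         ((\<forall>\<phi> :: real \<Rightarrow> real. (\<exists>C. C-lipschitz_on UNIV \<phi>) \<and> \<phi> 0 = 0 \<longrightarrow>
             (\<forall>u\<in>domE M E. L2_comp M \<phi> u \<in> domE M E)) \<and>
          subspace_nvs (L2_space M) (domE M E \<inter> Linf M) \<and>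
          (\<forall>u\<in>domE M E \<inter> Linf M. \<forall>v\<in>domE M E \<inter> Linf M. L2_mult M u v \<in> domE M E \<inter> Linf M)) \<and>
         is_dual_space_nvs (energy_space M E)"
proof -
  obtain T where form: "convex_functional M E" "lsc_functional M E" "dense_in_L2 M (domE M E)"
    "gradient_flow M E T" "Lp_contractive M T" "order_preserving M T"
    using assms(3) unfolding nonlinear_dirichlet_form_def by blast
  interpret homogeneous_energy M E
    using form assms(4) by unfold_locales
  interpret homogeneous_dirichlet_form M E T
    by (intro homogeneous_dirichlet_form.intro dirichlet_flow.intro dirichlet_flow_axioms.intro
        lsc_gradient_flow.intro homogeneous_energy_axioms assms(1) form E_null)
  show ?thesis
    unfolding energy_space_eq[symmetric]
    using domE_subspace energy.W_normed energy.W_banach energy.W_dual_space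
      hilbert_iff_quadratic[OF form(3)] Lipschitz_operates Linf_subspace Linf_algebra
    by (auto simp: energy_space_eq)
qed

end
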